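(* Let $d\ge 1$, let $\Sigma$ be a fixed $d\times d$ positive definite matrix, and let $A_i = \Sigma^{1/2} G_i^{\rm c}$ $(i=1,2,\dots)$, where the $G_i^{\rm c}$ are independent $d\times d$ complex Gaussian matrices whose entries are independent standard complex normals. Let $y_1,\dots,y_d$ denote the eigenvalues of $\Sigma^{-1}$, and let $\mu_1\ge\cdots\ge\mu_d$ be the Lyapunov exponents of the product $P_N = A_N A_{N-1}\cdots A_1$. Then for each $k=1,\dots,d$, $$\mu_k = -\frac{1}{2\prod_{1\le i<j\le d}(y_j-y_i)}\,\det M^{(k)} + \frac12\Psi(k),$$ where $M^{(k)}$ is the $d\times d$ matrix with entries $$M^{(k)}_{ij} = y_j^{i-1}\ \ (i\ne k),\qquad M^{(k)}_{kj} = (\log y_j)\,y_j^{k-1}\qquad (j=1,\dots,d).$$ If some of the $y_j$ coincide, the right-hand side is understood as its limiting value, i.e. its continuous extension from distinct $y_1,\dots,y_d>0$.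
   Context: A standard complex normal is a complex random variable with density $\pi^{-1}e^{-|z|^2}$ on $\mathbb{C}$ (so $\langle |z|^2\rangle = 1$). $\Psi(x) = \Gamma'(x)/\Gamma(x)$ is the digamma function. $\Sigma^{1/2}$ is the positive definite square root. Lyapunov exponents: for i.i.d. $d\times d$ random matrices $A_i$ such that the diagonal elements of $A_i^\dagger A_i$ have finite second moments, the limit $V_d := \lim_{N\to\infty}(P_N^\dagger P_N)^{1/(2N)}$, with $P_N = A_N\cdots A_1$, exists almost surely (Oseledec's multiplicative ergodic theorem) and has nonrandom positive eigenvalues, written $e^{\mu_1}\ge \cdots\ge e^{\mu_d}$; the numbers $\mu_1\ge\cdots\ge\mu_d$ are the Lyapunov exponents. *)

theory Defs
  imports
    "HOL-Probability.Probability"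
    "Jordan_Normal_Form.Schur_Decomposition"
begin

text \<open>
  Matrices are those of \<open>Jordan_Normal_Form.Matrix\<close>, so the dimension \<open>d\<close> is a natural number and
  matrix indices run over \<open>0, \<dots>, d - 1\<close>. Scalar families (\<open>y\<close>, \<open>\<mu>\<close>) and matrix sequences are
  indexed from 1.
\<close>

definition hermitian_mat :: "nat \<Rightarrow> complex mat \<Rightarrow> bool" where
  "hermitian_mat d A \<longleftrightarrow> A \<in> carrier_mat d d \<and> mat_adjoint A = A"

definition positive_definite_mat :: "nat \<Rightarrow> complex mat \<Rightarrow> bool" where
  "positive_definite_mat d A \<longleftrightarrow> hermitian_mat d A \<and>
     (\<forall>v \<in> carrier_vec d. v \<noteq> 0\<^sub>v d \<longrightarrow> Re ((A *\<^sub>v v) \<bullet>c v) > 0)"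

definition positive_semidefinite_mat :: "nat \<Rightarrow> complex mat \<Rightarrow> bool" where
  "positive_semidefinite_mat d A \<longleftrightarrow> hermitian_mat d A \<and>
     (\<forall>v \<in> carrier_vec d. Re ((A *\<^sub>v v) \<bullet>c v) \<ge> 0)"

text \<open>
  The power \<open>A\<close> to the \<open>1/n\<close> for positive semidefinite \<open>A\<close> and \<open>n \<ge> 1\<close>, i.e. the unique positive
  semidefinite \<open>n\<close>-th root; unspecified otherwise.
\<close>

definition psd_root :: "nat \<Rightarrow> nat \<Rightarrow> complex mat \<Rightarrow> complex mat" where
  "psd_root d n A = (THE X. positive_semidefinite_mat d X \<and> X ^\<^sub>m n = A)"

definition mat_tendsto :: "nat \<Rightarrow> (nat \<Rightarrow> complex mat) \<Rightarrow> complex mat \<Rightarrow> bool" where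
  "mat_tendsto d X V \<longleftrightarrow> (\<forall>i<d. \<forall>j<d. (\<lambda>N. X N $$ (i, j)) \<longlonglongrightarrow> V $$ (i, j))"

primrec left_product :: "nat \<Rightarrow> (nat \<Rightarrow> complex mat) \<Rightarrow> nat \<Rightarrow> complex mat" where
  "left_product d A 0 = 1\<^sub>m d"
| "left_product d A (Suc N) = A (Suc N) * left_product d A N"

text \<open>
  The eigenvalues of the limit matrix are listed with multiplicity, through its characteristic
  polynomial.
\<close>

definition lyapunov_exponents ::
  "'a measure \<Rightarrow> nat \<Rightarrow> (nat \<Rightarrow> 'a \<Rightarrow> complex mat) \<Rightarrow> (nat \<Rightarrow> real) \<Rightarrow> bool" where
  "lyapunov_exponents M d A \<mu> \<longleftrightarrow>
     (\<forall>i j. 1 \<le> i \<and> i \<le> j \<and> j \<le> d \<longrightarrow> \<mu> j \<le> \<mu> i) \<and>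
     (AE \<omega> in M. \<exists>V \<in> carrier_mat d d.
        mat_tendsto d
          (\<lambda>N. let P = left_product d (\<lambda>i. A i \<omega>) N in psd_root d (2 * N) (mat_adjoint P * P)) V \<and>
        char_poly V = (\<Prod>k = 1..d. [:- complex_of_real (exp (\<mu> k)), 1:]))"

definition standard_complex_normal :: "'a measure \<Rightarrow> ('a \<Rightarrow> complex) \<Rightarrow> bool" where
  "standard_complex_normal M Z \<longleftrightarrow>
     distributed M lborel Z (\<lambda>z. ennreal (exp (- (cmod z)\<^sup>2) / pi))"

definition iid_complex_gaussian_matrices ::
  "'a measure \<Rightarrow> nat \<Rightarrow> (nat \<Rightarrow> 'a \<Rightarrow> complex mat) \<Rightarrow> bool" where
  "iid_complex_gaussian_matrices M d G \<longleftrightarrow>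
     (\<forall>n\<ge>1. \<forall>\<omega> \<in> space M. G n \<omega> \<in> carrier_mat d d) \<and>
     (\<forall>n\<ge>1. \<forall>i<d. \<forall>j<d. standard_complex_normal M (\<lambda>\<omega>. G n \<omega> $$ (i, j))) \<and>
     prob_space.indep_vars M (\<lambda>_. borel) (\<lambda>(n, i, j) \<omega>. G n \<omega> $$ (i, j))
       ({1..} \<times> {..<d} \<times> {..<d})"

text \<open>Row and column indices of \<open>exponent_mat\<close> are shifted down by one; \<open>k\<close> is not.\<close>

definition exponent_mat :: "nat \<Rightarrow> nat \<Rightarrow> (nat \<Rightarrow> real) \<Rightarrow> real mat" where
  "exponent_mat d k y = Matrix.mat d d (\<lambda>(i, j).
     if i + 1 = k then ln (y (j + 1)) * y (j + 1) ^ (k - 1) else y (j + 1) ^ i)"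

definition exponent_formula :: "nat \<Rightarrow> nat \<Rightarrow> (nat \<Rightarrow> real) \<Rightarrow> real" where
  "exponent_formula d k y =
     - (1 / (2 * (\<Prod>j = 1..d. \<Prod>i = 1..<j. y j - y i))) * Determinant.det (exponent_mat d k y)
     + 1 / 2 * Digamma (real k)"

definition distinct_positive :: "nat \<Rightarrow> (nat \<Rightarrow> real) set" where
  "distinct_positive d = {y. inj_on y {1..d} \<and> (\<forall>j \<in> {1..d}. 0 < y j)}"

end

theory Submission
  imports Defs
begin

text \<open>
  The sum of the \<open>k\<close> largest exponents can be read off from the \<open>k \<times> k\<close> principal minors of \<open>P\<^sup>* P\<close>, where
  \<open>P\<close> is the product of the first \<open>N\<close> factors: the sum of these minors is the \<open>k\<close>-th elementary symmetric
  function of the eigenvalues, and for large \<open>N\<close> it is governed by the product of the \<open>k\<close> largest ones.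
  Any exponential rate shared by all the minors is therefore twice the sum of the first \<open>k\<close> exponents
  (\<open>minor_growth_determines_exponent_sum\<close>).

  Such a minor is the Gram determinant of the images under \<open>P\<close> of \<open>k\<close> coordinate vectors. By unitary
  invariance of the Gaussian distribution, one more factor multiplies it by an independent random
  number with the law of \<open>det (X\<^sup>* diag(1/y) X)\<close>, where \<open>X\<close> is a \<open>d \<times> k\<close> matrix of standard complex
  normals (\<open>gauss_factor_step\<close>). Its \<open>s\<close>-th moment after \<open>N\<close> steps is thus at most \<open>f(s)\<^sup>N\<close>, where \<open>f(s)\<close> bounds
  the \<open>s\<close>-th moment of one factor and \<open>f(0) = 1\<close>. Small positive \<open>s\<close> control the growth from above
  and small negative \<open>s\<close> from below; by Markov's inequality and the Borel-Cantelli lemma the almost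
  sure rate is the derivative of \<open>f\<close> at \<open>0\<close> (\<open>image_gram_growth\<close>).

  The function \<open>f\<close> is found as follows. With \<open>W = X\<^sup>* diag(1/y) X\<close>, the expectation of
  \<open>det (1 + r W)\<close> to the power \<open>- n\<close> is a Gaussian integral over an auxiliary \<open>n \<times> k\<close> matrix \<open>Z\<close>, and
  integrating over the independent rows of \<open>X\<close> first leaves the average of \<open>\<Prod>i. 1 / p(r / y i)\<close> with
  \<open>p(t) = det (1 + t Z\<^sup>* Z)\<close> (\<open>gram_det1_moments\<close>). Since \<open>p\<close> has degree at most \<open>k\<close> and \<open>p(0) = 1\<close>,
  operations on a Vandermonde determinant write this product as a combination of products over
  \<open>k\<close>-subsets of the indices, with weights that depend on \<open>y\<close> only (\<open>interpolation_identity\<close>). Hence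
  \<open>det W\<close> is distributed as a signed mixture of the corresponding determinants with only \<open>k\<close> rows
  present. These are constants times \<open>\<bar>det Y\<bar>\<^sup>2\<close> for a square Gaussian \<open>Y\<close>, whose moments are products
  of quotients of Gamma functions (\<open>gauss_square_det_moment\<close>). The derivative at \<open>0\<close> consists of
  digamma values and a weighted sum of logarithms, and the difference between its values for \<open>k\<close> and
  \<open>k - 1\<close> is the expansion of the determinant in the formula (\<open>exponent_formula_eq_log_det_mean\<close>).

  The interpolation weights exist only for distinct \<open>y\<close>. In general \<open>y\<close> is replaced by distinct \<open>y'\<close>
  with \<open>exp (- \<epsilon>) y \<le> y' \<le> exp \<epsilon> y\<close>, which changes the moments per step by a factor of at most
  \<open>exp (k \<epsilon> \<bar>s\<bar>)\<close>. The exponent therefore differs from the formula at \<open>y'\<close> by at most \<open>d \<epsilon>\<close>, which is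
  both the formula (for \<open>\<epsilon> = 0\<close>) and the limit statement.
\<close>

section \<open>The spectral theorem for Hermitian matrices\<close>

lemma mat_adjoint_altdef:
  "mat_adjoint A = Matrix.mat (dim_col A) (dim_row A) (\<lambda>(i, j). cnj (A $$ (j, i)))"
  by (rule eq_matI) (auto simp: mat_adjoint_def mat_of_rows_def)

lemma mat_adjoint_carrier [simp]: "A \<in> carrier_mat m n \<Longrightarrow> mat_adjoint A \<in> carrier_mat n m"
  for A :: "complex mat"
  by (auto simp: mat_adjoint_altdef)

lemma mat_adjoint_dim [simp]:
  "dim_row (mat_adjoint A) = dim_col A" "dim_col (mat_adjoint A) = dim_row A"
  for A :: "complex mat"
  by (auto simp: mat_adjoint_altdef)

lemma mat_adjoint_index [simp]:
  "i < dim_col A \<Longrightarrow> j < dim_row A \<Longrightarrow> mat_adjoint A $$ (i, j) = cnj (A $$ (j, i))"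
  by (auto simp: mat_adjoint_altdef)

lemma mat_adjoint_adjoint [simp]: "mat_adjoint (mat_adjoint A) = A" for A :: "complex mat"
  by (rule eq_matI) auto

lemma mat_adjoint_mult:
  fixes A :: "complex mat"
  assumes "A \<in> carrier_mat m n" "B \<in> carrier_mat n p"
  shows "mat_adjoint (A * B) = mat_adjoint B * mat_adjoint A"
  using assms by (intro eq_matI) (auto simp: scalar_prod_def mult.commute intro!: sum.cong)

lemma mat_adjoint_one [simp]: "mat_adjoint (1\<^sub>m n) = (1\<^sub>m n :: complex mat)"
  by (rule eq_matI) auto

lemma cnj_times_self: "cnj z * z = (complex_of_real (cmod z))\<^sup>2"
  using complex_norm_square[of z] by (simp add: mult.commute)

lemma square_mat_mult_closed [simp]:
  "A \<in> carrier_mat n n \<Longrightarrow> B \<in> carrier_mat n n \<Longrightarrow> A * B \<in> carrier_mat n n"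
  by (rule mult_carrier_mat)

lemma det_mat_adjoint:
  assumes "A \<in> carrier_mat n n"
  shows "Determinant.det (mat_adjoint A) = cnj (Determinant.det A)"
proof -
  interpret cnj: comm_ring_hom cnj
    by unfold_locales auto
  have "mat_adjoint A = transpose_mat (map_mat cnj A)"
    using assms by (intro eq_matI) auto
  then show ?thesis
    using det_transpose[of "map_mat cnj A" n] assms by simp
qed

definition unitary_mat :: "nat \<Rightarrow> complex mat \<Rightarrow> bool" where
  "unitary_mat n U \<longleftrightarrow> U \<in> carrier_mat n n \<and> mat_adjoint U * U = 1\<^sub>m n \<and> U * mat_adjoint U = 1\<^sub>m n"

lemma unitary_matD:
  assumes "unitary_mat n U"
  shows "U \<in> carrier_mat n n" "mat_adjoint U * U = 1\<^sub>m n" "U * mat_adjoint U = 1\<^sub>m n"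
  using assms by (auto simp: unitary_mat_def)

lemma unitary_matI:
  assumes U: "U \<in> carrier_mat n n" and "mat_adjoint U * U = 1\<^sub>m n"
  shows "unitary_mat n U"
  unfolding unitary_mat_def using mat_mult_left_right_inverse[of "mat_adjoint U" n U] assms by auto

lemma unitary_mat_adjoint: "unitary_mat n U \<Longrightarrow> unitary_mat n (mat_adjoint U)"
  by (auto simp: unitary_mat_def)

lemma unitary_mat_mult:
  assumes "unitary_mat n U" "unitary_mat n V"
  shows "unitary_mat n (U * V)"
proof (rule unitary_matI)
  note U = unitary_matD[OF assms(1)] and V = unitary_matD[OF assms(2)]
  show "U * V \<in> carrier_mat n n" using U V by auto
  have "mat_adjoint (U * V) * (U * V) = mat_adjoint V * (mat_adjoint U * U) * V"
    using U(1) V(1) by (simp add: mat_adjoint_mult[OF U(1) V(1)] assoc_mult_mat[of _ n n _ n _ n])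
  then show "mat_adjoint (U * V) * (U * V) = 1\<^sub>m n"
    using U V by simp
qed

text \<open>Gram-Schmidt, applied to a completion of \<open>v\<close> to a basis, starts with \<open>v\<close> itself.\<close>

lemma unitary_mat_with_first_col:
  fixes v :: "complex vec"
  assumes v: "v \<in> carrier_vec n" and v0: "v \<noteq> 0\<^sub>v n"
  obtains U c where "unitary_mat n U" "col U 0 = c \<cdot>\<^sub>v v"
proof -
  interpret cof_vec_space n "TYPE(complex)" .
  define b where "b = basis_completion v"
  define ws where "ws = gram_schmidt n b"
  define W where "W = mat_of_cols n ws"
  have n: "n \<noteq> 0" using v v0 by (intro notI) auto
  from basis_completion[OF v v0, folded b_def]
  have b: "set b \<subseteq> carrier_vec n" "distinct b" "\<not> lin_dep (set b)" "length b = n" "hd b = v"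
    by auto
  obtain vs where bv: "b = v # vs" using b n by (cases b) auto
  from gram_schmidt_result[OF b(1,2,3) refl, folded ws_def]
  have ws: "set ws \<subseteq> carrier_vec n" "corthogonal ws" "length ws = n" using b by auto
  have hd: "hd ws = v" using gram_schmidt_hd[OF v, of vs] by (simp add: ws_def bv)
  have W: "W \<in> carrier_mat n n" using mat_of_cols_carrier(1)[of n ws] ws by (simp add: W_def)
  have orth: "corthogonal_mat W" using orthogonal_mat_of_cols[OF ws] by (simp add: W_def)
  define B where "B = mat_adjoint W * W"
  define N where "N i = (\<Sum>j<n. (cmod (W $$ (j, i)))\<^sup>2)" for i
  have off: "B $$ (i, j) = 0" if "i < n" "j < n" "i \<noteq> j" for i j
    using orth that W unfolding corthogonal_mat_def B_def Let_def diagonal_mat_def by auto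
  have nz: "B $$ (i, i) \<noteq> 0" if "i < n" for i
    using orth that W unfolding corthogonal_mat_def B_def Let_def by auto
  have BN: "B $$ (i, i) = of_real (N i)" if "i < n" for i
    using that W unfolding B_def N_def
    by (simp add: scalar_prod_def atLeast0LessThan cnj_times_self)
  have Npos: "N i > 0" if "i < n" for i
  proof -
    have "N i \<ge> 0" unfolding N_def by (auto intro!: sum_nonneg)
    moreover have "N i \<noteq> 0" using nz[OF that] BN[OF that] by auto
    ultimately show ?thesis by simp
  qed
  define D where "D = mat_diag n (\<lambda>i. complex_of_real (1 / sqrt (N i)))"
  define U where "U = W * D"
  have D: "D \<in> carrier_mat n n" by (simp add: D_def)
  have adjD: "mat_adjoint D = D"
    by (rule eq_matI) (auto simp: D_def mat_diag_def)
  have "mat_adjoint U * U = D * B * D"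
    using W D by (simp add: U_def B_def mat_adjoint_mult[OF W D] adjD assoc_mult_mat[of _ n n _ n _ n])
  also have "\<dots> = 1\<^sub>m n"
  proof -
    have Bc: "B \<in> carrier_mat n n" using W by (simp add: B_def)
    have "D * B * D = Matrix.mat n n (\<lambda>(i, j). (1 / sqrt (N i)) * B $$ (i, j) * (1 / sqrt (N j)))"
      unfolding D_def mat_diag_mult_left[OF Bc] by (subst mat_diag_mult_right[of _ n]) auto
    also have "\<dots> = 1\<^sub>m n"
    proof (rule eq_matI, goal_cases)
      case (1 i j)
      then have ij: "i < n" "j < n" by auto
      show ?case
      proof (cases "i = j")
        case True
        have "complex_of_real (1 / sqrt (N i)) * complex_of_real (N i) * complex_of_real (1 / sqrt (N i))
            = complex_of_real ((1 / sqrt (N i)) * N i * (1 / sqrt (N i)))"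
          by (simp only: of_real_mult)
        also have "(1 / sqrt (N i)) * N i * (1 / sqrt (N i)) = 1"
          using Npos[OF ij(1)] by (simp add: field_simps)
        finally show ?thesis using True ij by (simp add: BN)
      next
        case False
        then show ?thesis using ij off by auto
      qed
    qed auto
    finally show ?thesis .
  qed
  finally have "unitary_mat n U"
    using W D by (intro unitary_matI) (auto simp: U_def)
  moreover have "col U 0 = complex_of_real (1 / sqrt (N 0)) \<cdot>\<^sub>v v"
  proof -
    have W0: "col W 0 = v"
      using hd ws n by (cases ws) (auto simp: W_def)
    have "col U 0 = complex_of_real (1 / sqrt (N 0)) \<cdot>\<^sub>v col W 0"
      unfolding U_def D_def mat_diag_mult_right[OF W] using W n by (intro eq_vecI) auto
    then show ?thesis using W0 by simp
  qed
  ultimately show thesis by (rule that)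
qed

text \<open>Deflation: with an eigenvector as first column of a unitary matrix, the first row and column of
  the conjugated matrix vanish off the diagonal and a smaller Hermitian block is left. The induction
  runs over the list of eigenvalues, so these appear in the given order.\<close>

theorem hermitian_spectral:
  fixes A :: "complex mat"
  assumes "A \<in> carrier_mat n n" "mat_adjoint A = A"
    and "char_poly A = (\<Prod>e\<leftarrow>es. [:- e, 1:])"
  obtains U where "unitary_mat n U" "A = U * mat_diag n (\<lambda>i. es ! i) * mat_adjoint U" "length es = n"
  using assms
proof (induction es arbitrary: n A thesis)
  case Nil
  have n: "n = 0" using degree_monic_char_poly[OF Nil(2)] Nil(4) by auto
  show ?case
    by (rule Nil(1)[of "1\<^sub>m 0"]) (use Nil n in \<open>auto simp: unitary_mat_def intro!: eq_matI\<close>)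
next
  case (Cons e es n A)
  note A = Cons(3) and H = Cons(4)
  let ?cp = "char_poly A"
  have cp: "?cp = [:- e, 1:] * (\<Prod>e\<leftarrow>es. [:- e, 1:])" using Cons(5) by simp
  have mon: "monic (\<Prod>e\<leftarrow>es. [:- e, 1:])" by (rule monic_prod_list) auto
  have deg: "degree ?cp = Suc (degree (\<Prod>e\<leftarrow>es. [:- e, 1:]))" unfolding cp
    by (subst degree_mult_eq) (use mon in auto)
  with degree_monic_char_poly[OF A] obtain m where n: "n = Suc m" by (cases n) auto
  have "eigenvalue A e" unfolding eigenvalue_root_char_poly[OF A] cp by simp
  then obtain v where v: "v \<in> carrier_vec n" "v \<noteq> 0\<^sub>v n" and Av: "A *\<^sub>v v = e \<cdot>\<^sub>v v"
    using A unfolding eigenvalue_def eigenvector_def by auto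
  obtain U c where U: "unitary_mat n U" and U0: "col U 0 = c \<cdot>\<^sub>v v"
    using unitary_mat_with_first_col[OF v] .
  note U' = unitary_matD[OF U]
  define A' where "A' = mat_adjoint U * A * U"
  have A': "A' \<in> carrier_mat n n" using U' A by (simp add: A'_def)
  have A'H: "mat_adjoint A' = A'"
    using U'(1) A H unfolding A'_def
    by (subst mat_adjoint_mult[of _ n n _ n], simp, simp, subst mat_adjoint_mult[of _ n n _ n])
       (auto simp: assoc_mult_mat[of _ n n _ n _ n])
  have cU: "col U 0 \<in> carrier_vec n" using U'(1) n by (metis carrier_matD(1) col_carrier_vec zero_less_Suc)
  have "col A' 0 = mat_adjoint U *\<^sub>v (A *\<^sub>v col U 0)"
  proof -
    have "col A' 0 = (mat_adjoint U * A) *\<^sub>v col U 0"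
      unfolding A'_def by (rule col_mult2[of _ n n _ n]) (use U'(1) A n in auto)
    also have "\<dots> = mat_adjoint U *\<^sub>v (A *\<^sub>v col U 0)"
      by (rule assoc_mult_mat_vec[OF mat_adjoint_carrier[OF U'(1)] A cU])
    finally show ?thesis .
  qed
  also have "A *\<^sub>v col U 0 = e \<cdot>\<^sub>v col U 0"
    using A v Av by (simp add: U0 mult_mat_vec smult_smult_assoc mult.commute)
  also have "mat_adjoint U *\<^sub>v (e \<cdot>\<^sub>v col U 0) = e \<cdot>\<^sub>v (mat_adjoint U *\<^sub>v col U 0)"
    by (rule mult_mat_vec[OF mat_adjoint_carrier[OF U'(1)] cU])
  also have "mat_adjoint U *\<^sub>v col U 0 = col (mat_adjoint U * U) 0"
    by (rule col_mult2[of _ n n _ n, symmetric]) (use U'(1) n in auto)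
  finally have col0: "col A' 0 = e \<cdot>\<^sub>v col (1\<^sub>m n) 0" using U'(2) by simp
  have c0: "A' $$ (i, 0) = (if i = 0 then e else 0)" if "i < n" for i
  proof -
    have "A' $$ (i, 0) = col A' 0 $ i" using A' n that by auto
    then show ?thesis using col0 n that by auto
  qed
  have r0: "A' $$ (0, i) = 0" if "i < n" "i \<noteq> 0" for i
  proof -
    have "A' $$ (0, i) = mat_adjoint A' $$ (0, i)" by (simp add: A'H)
    also have "\<dots> = cnj (A' $$ (i, 0))" using A' that n by auto
    finally show ?thesis using c0[OF that(1)] that by simp
  qed
  define A1 where "A1 = Matrix.mat 1 1 (\<lambda>_. e)"
  define A3 where "A3 = Matrix.mat m m (\<lambda>(i, j). A' $$ (Suc i, Suc j))"
  have A1c: "A1 \<in> carrier_mat 1 1" and A3c: "A3 \<in> carrier_mat m m" by (auto simp: A1_def A3_def)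
  have A'block: "A' = four_block_mat A1 (0\<^sub>m 1 m) (0\<^sub>m m 1) A3"
    using A' n c0 r0 by (intro eq_matI) (auto simp: A1_def A3_def)
  have "char_poly A' = char_poly A1 * char_poly A3"
    unfolding A'block by (rule char_poly_four_block_zeros_col[OF A1c _ A3c]) auto
  moreover have "char_poly A1 = [:- e, 1:]"
    by (simp add: A1_def char_poly_defs det_def sign_def)
  moreover have "char_poly A' = char_poly A"
    by (rule char_poly_similar, unfold similar_mat_def,
        intro exI, rule similar_mat_witI[of "mat_adjoint U" U n A' A])
       (use U' A A' in \<open>auto simp: A'_def\<close>)
  ultimately have cp3: "char_poly A3 = (\<Prod>e\<leftarrow>es. [:- e, 1:])"
    using cp by (metis mult_cancel_left pCons_eq_0_iff zero_neq_one)
  have A3H: "mat_adjoint A3 = A3"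
  proof (rule eq_matI, goal_cases)
    case (1 i j)
    then have "i < m" "j < m" using A3c by auto
    then have "A' $$ (Suc i, Suc j) = cnj (A' $$ (Suc j, Suc i))"
      using A' n by (subst A'H[symmetric]) auto
    then show ?case using \<open>i < m\<close> \<open>j < m\<close> by (auto simp: A3_def)
  qed (use A3c in auto)
  obtain P where P: "unitary_mat m P" and AP: "A3 = P * mat_diag m (\<lambda>i. es ! i) * mat_adjoint P"
    and len: "length es = m"
    by (rule Cons.IH[OF _ A3c A3H cp3])
  note P' = unitary_matD[OF P]
  define Q where "Q = four_block_mat (1\<^sub>m 1) (0\<^sub>m 1 m) (0\<^sub>m m 1) P"
  have adjQ: "mat_adjoint Q = four_block_mat (1\<^sub>m 1) (0\<^sub>m 1 m) (0\<^sub>m m 1) (mat_adjoint P)"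
    using P' by (intro eq_matI) (auto simp: Q_def)
  have Qc: "Q \<in> carrier_mat n n" using P' n by (auto simp: Q_def)
  have QQ: "unitary_mat n Q"
  proof (rule unitary_matI[OF Qc])
    have "mat_adjoint Q * Q = four_block_mat (1\<^sub>m 1) (0\<^sub>m 1 m) (0\<^sub>m m 1) (1\<^sub>m m)"
      unfolding adjQ unfolding Q_def using P'
      by (subst mult_four_block_mat[of _ 1 1 _ m _ m _ _ 1 _ m]) auto
    also have "\<dots> = 1\<^sub>m n" using n by (intro eq_matI) auto
    finally show "mat_adjoint Q * Q = 1\<^sub>m n" .
  qed
  have diag: "mat_diag n (\<lambda>i. (e # es) ! i) = four_block_mat A1 (0\<^sub>m 1 m) (0\<^sub>m m 1) (mat_diag m (\<lambda>i. es ! i))"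
    using n by (intro eq_matI) (auto simp: mat_diag_def A1_def nth_Cons split: nat.splits)
  let ?Dm = "mat_diag n (\<lambda>i. (e # es) ! i)"
  have "Q * ?Dm * mat_adjoint Q = four_block_mat A1 (0\<^sub>m 1 m) (0\<^sub>m m 1) (P * mat_diag m (\<lambda>i. es ! i)) * mat_adjoint Q"
    unfolding diag unfolding Q_def using P' A1c
    by (subst mult_four_block_mat[of _ 1 1 _ m _ m _ _ 1 _ m]) (auto simp: mat_diag_def)
  also have "\<dots> = A'"
    unfolding adjQ A'block AP using P' A1c
    by (subst mult_four_block_mat[of _ 1 1 _ m _ m _ _ 1 _ m])
       (auto simp: right_mult_zero_mat[of _ m m "Suc 0"])
  finally have A'Q: "A' = Q * ?Dm * mat_adjoint Q" by simp
  have "A = U * A' * mat_adjoint U"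
  proof -
    have "U * A' * mat_adjoint U = (U * mat_adjoint U) * A * (U * mat_adjoint U)"
      using U'(1) A by (simp add: A'_def assoc_mult_mat[of _ n n _ n _ n])
    then show ?thesis using U' A by simp
  qed
  also have "\<dots> = (U * Q) * ?Dm * mat_adjoint (U * Q)"
    using U'(1) Qc by (simp add: A'Q mat_adjoint_mult[OF U'(1) Qc] assoc_mult_mat[of _ n n _ n _ n]
        mult_carrier_mat[of _ n n _ n])
  finally show ?case
    using unitary_mat_mult[OF U QQ] len n by (intro Cons.prems(1)[of "U * Q"]) auto
qed

section \<open>Roots of positive semidefinite matrices\<close>

unbundle no vec_syntax

lemma square_mat_one_mult [simp]:
  "A \<in> carrier_mat n n \<Longrightarrow> 1\<^sub>m n * A = A" "A \<in> carrier_mat n n \<Longrightarrow> A * 1\<^sub>m n = A"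
  for A :: "complex mat"
  by simp_all

lemma square_mat_vec_closed [simp]:
  "A \<in> carrier_mat n n \<Longrightarrow> v \<in> carrier_vec n \<Longrightarrow> A *\<^sub>v v \<in> carrier_vec n"
  by (rule mult_mat_vec_carrier)

text \<open>For a fixed unitary \<open>U\<close> these matrices form a commutative algebra in which every operation
  acts on the eigenvalues \<open>f\<close> alone.\<close>

definition eigen_mat :: "nat \<Rightarrow> complex mat \<Rightarrow> (nat \<Rightarrow> complex) \<Rightarrow> complex mat" where
  "eigen_mat n U f = U * mat_diag n f * mat_adjoint U"

lemma mat_diag_cong: "(\<And>i. i < n \<Longrightarrow> f i = g i) \<Longrightarrow> mat_diag n f = mat_diag n g"
  by (rule eq_matI) (auto simp: mat_diag_def)

lemma eigen_mat_cong: "(\<And>i. i < n \<Longrightarrow> f i = g i) \<Longrightarrow> eigen_mat n U f = eigen_mat n U g"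
  unfolding eigen_mat_def by (simp cong: mat_diag_cong)

lemma eigen_mat_carrier [simp]: "unitary_mat n U \<Longrightarrow> eigen_mat n U f \<in> carrier_mat n n"
  by (simp add: eigen_mat_def unitary_mat_def)

lemma eigen_mat_const:
  assumes "unitary_mat n U"
  shows "eigen_mat n U (\<lambda>_. c) = c \<cdot>\<^sub>m 1\<^sub>m n"
proof -
  note U = unitary_matD[OF assms]
  have "mat_diag n (\<lambda>_. c) = c \<cdot>\<^sub>m 1\<^sub>m n" by (rule eq_matI) (auto simp: mat_diag_def)
  then show ?thesis
    using U mult_smult_assoc_mat[OF U(1) mat_adjoint_carrier[OF U(1)], of c]
      mult_smult_distrib[OF U(1) one_carrier_mat, of c]
    by (simp add: eigen_mat_def)
qed

lemma eigen_mat_add: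
  assumes "unitary_mat n U"
  shows "eigen_mat n U f + eigen_mat n U g = eigen_mat n U (\<lambda>i. f i + g i)"
proof -
  note U = unitary_matD[OF assms]
  have "mat_diag n (\<lambda>i. f i + g i) = mat_diag n f + mat_diag n g"
    by (rule eq_matI) (auto simp: mat_diag_def)
  then show ?thesis
    using U by (simp add: eigen_mat_def mult_add_distrib_mat[of _ n n _ n] add_mult_distrib_mat[of _ n n _ _ n])
qed

lemma eigen_mat_mult:
  assumes "unitary_mat n U"
  shows "eigen_mat n U f * eigen_mat n U g = eigen_mat n U (\<lambda>i. f i * g i)"
proof -
  note U = unitary_matD[OF assms]
  have "eigen_mat n U f * eigen_mat n U g
      = U * (mat_diag n f * ((mat_adjoint U * U) * (mat_diag n g * mat_adjoint U)))"
    using U(1) by (simp add: eigen_mat_def assoc_mult_mat[of _ n n _ n _ n])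
  also have "\<dots> = U * ((mat_diag n f * mat_diag n g) * mat_adjoint U)"
    using U(1) left_mult_one_mat[of "mat_diag n g * mat_adjoint U" n n]
    by (simp add: U(2) assoc_mult_mat[of _ n n _ n _ n] del: mat_diag_diag)
  finally show ?thesis using U(1) by (simp add: eigen_mat_def assoc_mult_mat[of _ n n _ n _ n])
qed

lemma eigen_mat_smult:
  assumes "unitary_mat n U"
  shows "c \<cdot>\<^sub>m eigen_mat n U f = eigen_mat n U (\<lambda>i. c * f i)"
proof -
  have "c \<cdot>\<^sub>m eigen_mat n U f = (c \<cdot>\<^sub>m 1\<^sub>m n) * eigen_mat n U f"
    using assms left_mult_one_mat[OF eigen_mat_carrier[OF assms]]
    by (subst mult_smult_assoc_mat[of _ n n _ n]) auto
  then show ?thesis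
    using assms by (simp add: eigen_mat_const[OF assms, symmetric] eigen_mat_mult)
qed

lemma eigen_mat_pow:
  assumes "unitary_mat n U"
  shows "eigen_mat n U f ^\<^sub>m m = eigen_mat n U (\<lambda>i. f i ^ m)"
proof (induction m)
  case 0
  show ?case using eigen_mat_const[OF assms, of 1] carrier_matD[OF eigen_mat_carrier[OF assms, of f]]
    by (auto intro!: eq_matI)
next
  case (Suc m)
  then show ?case using assms by (simp add: eigen_mat_mult mult.commute)
qed

lemma eigen_mat_adjoint:
  assumes "unitary_mat n U"
  shows "mat_adjoint (eigen_mat n U f) = eigen_mat n U (\<lambda>i. cnj (f i))"
proof -
  note U = unitary_matD[OF assms]
  have "mat_adjoint (mat_diag n f) = mat_diag n (\<lambda>i. cnj (f i))"
    by (rule eq_matI) (auto simp: mat_diag_def)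
  then show ?thesis
    using U(1) by (simp add: eigen_mat_def mat_adjoint_mult[of _ n n _ n] assoc_mult_mat[of _ n n _ n _ n])
qed

lemma det_mat_diag: "Determinant.det (mat_diag n f) = (\<Prod>i<n. f i)"
  by (subst det_upper_triangular[of _ n])
     (auto simp: mat_diag_def diag_mat_def prod.list_conv_set_nth atLeast0LessThan
       intro!: prod.cong simp flip: prod.distinct_set_conv_list)

lemma det_eigen_mat:
  assumes "unitary_mat n U"
  shows "Determinant.det (eigen_mat n U f) = (\<Prod>i<n. f i)"
proof -
  note U = unitary_matD[OF assms]
  have "Determinant.det (mat_adjoint U) * Determinant.det U = 1"
    using det_mult[of "mat_adjoint U" n U] U by simp
  then show ?thesis
    using U(1) by (simp add: eigen_mat_def det_mult[of _ n] det_mat_diag mult.commute mult.left_commute)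
qed

lemma adjoint_cscalar_prod:
  fixes X :: "complex mat"
  assumes X: "X \<in> carrier_mat m n" and a: "a \<in> carrier_vec m" and b: "b \<in> carrier_vec n"
  shows "(X *\<^sub>v b) \<bullet>c a = b \<bullet>c (mat_adjoint X *\<^sub>v a)"
proof -
  have "(X *\<^sub>v b) \<bullet>c a = (\<Sum>i<m. \<Sum>j<n. X $$ (i, j) * b $ j * cnj (a $ i))"
    using assms by (auto simp: scalar_prod_def atLeast0LessThan sum_distrib_right intro!: sum.cong)
  also have "\<dots> = (\<Sum>j<n. \<Sum>i<m. X $$ (i, j) * b $ j * cnj (a $ i))" by (rule sum.swap)
  also have "\<dots> = b \<bullet>c (mat_adjoint X *\<^sub>v a)"
    using assms by (auto simp: scalar_prod_def atLeast0LessThan sum_distrib_left mult_ac intro!: sum.cong)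
  finally show ?thesis .
qed

lemma cscalar_prod_self:
  fixes v :: "complex vec"
  assumes "v \<in> carrier_vec n"
  shows "v \<bullet>c v = complex_of_real (\<Sum>i<n. (cmod (v $ i))\<^sup>2)"
  using assms by (auto simp: scalar_prod_def atLeast0LessThan complex_norm_square[symmetric] simp del: of_real_power
      intro!: sum.cong)

lemma positive_semidefinite_mat_gram:
  assumes "B \<in> carrier_mat m n"
  shows "positive_semidefinite_mat n (mat_adjoint B * B)"
  unfolding positive_semidefinite_mat_def hermitian_mat_def
proof (intro conjI ballI)
  show "mat_adjoint B * B \<in> carrier_mat n n" using assms by auto
  show "mat_adjoint (mat_adjoint B * B) = mat_adjoint B * B"
    using assms by (simp add: mat_adjoint_mult[of _ n m _ n])
  fix v :: "complex vec" assume v: "v \<in> carrier_vec n"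
  have "(mat_adjoint B * B *\<^sub>v v) \<bullet>c v = (B *\<^sub>v v) \<bullet>c (B *\<^sub>v v)"
    using assms v adjoint_cscalar_prod[of "mat_adjoint B" n m v "B *\<^sub>v v"]
    by (simp add: assoc_mult_mat_vec[of _ n m _ n])
  then show "0 \<le> Re ((mat_adjoint B * B *\<^sub>v v) \<bullet>c v)"
    using cscalar_prod_self[of "B *\<^sub>v v" m] assms v by (auto intro!: sum_nonneg)
qed

text \<open>The quadratic form is diagonal in the coordinates with respect to the columns of \<open>U\<close>.\<close>

lemma eigen_mat_form:
  assumes U: "unitary_mat n U" and v: "v \<in> carrier_vec n"
  shows "(eigen_mat n U f *\<^sub>v v) \<bullet>c v = (\<Sum>i<n. f i * (cmod ((mat_adjoint U *\<^sub>v v) $ i))\<^sup>2)"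
proof -
  note U' = unitary_matD[OF U]
  define w where "w = mat_adjoint U *\<^sub>v v"
  have w: "w \<in> carrier_vec n" using U' v by (simp add: w_def)
  have "eigen_mat n U f *\<^sub>v v = U *\<^sub>v (mat_diag n f *\<^sub>v w)"
    using U'(1) v by (simp add: eigen_mat_def w_def assoc_mult_mat_vec[of _ n n _ n])
  then have "(eigen_mat n U f *\<^sub>v v) \<bullet>c v = (mat_diag n f *\<^sub>v w) \<bullet>c w"
    using adjoint_cscalar_prod[OF U'(1) v, of "mat_diag n f *\<^sub>v w"] w
    by (simp add: w_def mult_mat_vec_carrier[of _ n n])
  also have "mat_diag n f *\<^sub>v w = vec n (\<lambda>i. f i * w $ i)"
    using w by (intro eq_vecI)
      (auto simp: mat_diag_def scalar_prod_def if_distrib sum.delta' if_distribR cong: if_cong)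
  also have "\<dots> \<bullet>c w = (\<Sum>i<n. f i * (w $ i * cnj (w $ i)))"
    using w by (auto simp: scalar_prod_def atLeast0LessThan intro!: sum.cong)
  finally show ?thesis by (simp add: w_def flip: complex_norm_square)
qed

lemma positive_semidefinite_eigen_mat:
  assumes U: "unitary_mat n U" and f: "\<And>i. i < n \<Longrightarrow> 0 \<le> f i"
  shows "positive_semidefinite_mat n (eigen_mat n U (\<lambda>i. complex_of_real (f i)))"
  unfolding positive_semidefinite_mat_def hermitian_mat_def
  using U f by (auto simp: eigen_mat_adjoint eigen_mat_form intro!: sum_nonneg)

text \<open>Column \<open>i\<close> of \<open>U\<close> takes the \<open>i\<close>-th eigenvalue as the value of the form, so it is nonnegative; sorting permutes the eigenvalue list
  before \<open>U\<close> is chosen.\<close>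

lemma psd_spectral:
  assumes A: "positive_semidefinite_mat n A"
  obtains U \<rho> where "unitary_mat n U" "A = eigen_mat n U (\<lambda>i. complex_of_real (\<rho> i))"
    "\<And>i. i < n \<Longrightarrow> 0 \<le> \<rho> i" "\<And>i j. i \<le> j \<Longrightarrow> j < n \<Longrightarrow> \<rho> j \<le> (\<rho> i :: real)"
proof -
  have Ac: "A \<in> carrier_mat n n" and AH: "mat_adjoint A = A"
    and Apos: "\<And>v. v \<in> carrier_vec n \<Longrightarrow> 0 \<le> Re ((A *\<^sub>v v) \<bullet>c v)"
    using A by (auto simp: positive_semidefinite_mat_def hermitian_mat_def)
  obtain as where as: "char_poly A = (\<Prod>a\<leftarrow>as. [:- a, 1:])" and len: "length as = n"
    using char_poly_factorized[OF Ac] by blast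
  obtain U where U: "unitary_mat n U" and AU: "A = eigen_mat n U (\<lambda>i. as ! i)"
    using hermitian_spectral[OF Ac AH as] unfolding eigen_mat_def by metis
  note U' = unitary_matD[OF U]
  have form: "(A *\<^sub>v col U i) \<bullet>c col U i = as ! i" if i: "i < n" for i
  proof -
    have c: "col U i \<in> carrier_vec n" using U'(1) i by (metis carrier_matD(1) col_carrier_vec carrier_matD(2))
    have "mat_adjoint U *\<^sub>v col U i = col (mat_adjoint U * U) i"
      by (rule col_mult2[of _ n n _ n, symmetric]) (use U'(1) i in auto)
    also have "\<dots> = unit_vec n i" using U'(2) i by simp
    finally have "(A *\<^sub>v col U i) \<bullet>c col U i = (\<Sum>j<n. as ! j * (cmod (unit_vec n i $ j))\<^sup>2)"
      unfolding AU eigen_mat_form[OF U c] by simp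
    also have "\<dots> = (\<Sum>j<n. if j = i then as ! j else 0)"
      using i by (intro sum.cong) (auto simp: unit_vec_def)
    finally show ?thesis using i by simp
  qed
  have real: "cnj (as ! i) = as ! i" if i: "i < n" for i
  proof -
    have c: "col U i \<in> carrier_vec n" using U'(1) i by (metis carrier_matD(1) col_carrier_vec carrier_matD(2))
    have "A = eigen_mat n U (\<lambda>i. cnj (as ! i))"
      using AH eigen_mat_adjoint[OF U, of "\<lambda>i. as ! i"] by (simp add: AU)
    then have "(A *\<^sub>v col U i) \<bullet>c col U i = (\<Sum>j<n. cnj (as ! j) * (cmod ((mat_adjoint U *\<^sub>v col U i) $ j))\<^sup>2)"
      using eigen_mat_form[OF U c] by metis
    also have "\<dots> = cnj (\<Sum>j<n. as ! j * (cmod ((mat_adjoint U *\<^sub>v col U i) $ j))\<^sup>2)" by simp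
    also have "\<dots> = cnj ((A *\<^sub>v col U i) \<bullet>c col U i)"
      unfolding AU eigen_mat_form[OF U c] ..
    finally show ?thesis using form[OF i] by simp
  qed
  define rs where "rs = rev (sort (map Re as))"
  have pos: "0 \<le> Re (as ! i)" if "i < n" for i
    using form[OF that] Apos[of "col U i"] U'(1) that
    by (metis carrier_matD(1) col_carrier_vec carrier_matD(2))
  have "map (complex_of_real \<circ> Re) as = as"
    using real len by (intro nth_equalityI) (auto simp: complex_eq_iff)
  then have "mset (map complex_of_real rs) = mset as"
    by (metis (no_types, lifting) map_map mset_map mset_rev mset_sort rs_def)
  have "char_poly A = prod_mset (image_mset (\<lambda>a. [:- a, 1:]) (mset as))"
    by (simp add: as flip: mset_map prod_mset_prod_list)
  also have "mset as = mset (map complex_of_real rs)"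
    using \<open>mset (map complex_of_real rs) = mset as\<close> ..
  finally have as': "char_poly A = (\<Prod>a\<leftarrow>map complex_of_real rs. [:- a, 1:])"
    by (simp flip: mset_map prod_mset_prod_list add: image_mset.compositionality)
  obtain V where V: "unitary_mat n V" and AV: "A = eigen_mat n V (\<lambda>i. map complex_of_real rs ! i)"
    and len': "length rs = n"
    using hermitian_spectral[OF Ac AH as'] unfolding eigen_mat_def by (metis length_map)
  show thesis
  proof (rule that[of V "\<lambda>i. rs ! i"])
    show "A = eigen_mat n V (\<lambda>i. complex_of_real (rs ! i))"
      unfolding AV by (rule eigen_mat_cong) (simp add: len')
    have "set rs = Re ` set as" by (simp add: rs_def)
    then show "0 \<le> rs ! i" if "i < n" for i
      using that pos len len' by (metis (no_types, lifting) image_iff in_set_conv_nth)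
    show "rs ! j \<le> rs ! i" if "i \<le> j" "j < n" for i j
      using that len' sorted_nth_mono[of "sort (map Re as)" "n - Suc j" "n - Suc i"] len
      by (simp add: rs_def rev_nth)
  qed (rule V)
qed

text \<open>The matrix \<open>U\<^sup>* W\<close> between the two eigenbases intertwines the \<open>n\<close>-th powers of the eigenvalues; as
  \<open>n\<close>-th powers of nonnegative numbers separate, it also intertwines the eigenvalues themselves.\<close>

lemma psd_root_unique:
  assumes U: "unitary_mat d U" and W: "unitary_mat d W" and n: "n > 0"
    and \<alpha>: "\<And>i. i < d \<Longrightarrow> 0 \<le> \<alpha> i" and \<beta>: "\<And>i. i < d \<Longrightarrow> 0 \<le> \<beta> i"
    and eq: "eigen_mat d U (\<lambda>i. complex_of_real (\<alpha> i)) ^\<^sub>m n = eigen_mat d W (\<lambda>i. complex_of_real (\<beta> i)) ^\<^sub>m n"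
  shows "eigen_mat d U (\<lambda>i. complex_of_real (\<alpha> i)) = eigen_mat d W (\<lambda>i. complex_of_real (\<beta> i))"
proof -
  note U' = unitary_matD[OF U] and W' = unitary_matD[OF W]
  define C where "C = mat_adjoint U * W"
  have C: "C \<in> carrier_mat d d" using U' W' by (simp add: C_def)
  have conj: "mat_adjoint U * eigen_mat d U f * W = mat_diag d f * C" for f
  proof -
    have "mat_adjoint U * eigen_mat d U f * W = (mat_adjoint U * U) * (mat_diag d f * (mat_adjoint U * W))"
      using U'(1) W'(1) by (simp add: eigen_mat_def assoc_mult_mat[of _ d d _ d _ d])
    then show ?thesis using U' C by (simp add: C_def)
  qed
  have conj': "mat_adjoint U * eigen_mat d W f * W = C * mat_diag d f" for f
  proof -
    have "mat_adjoint U * eigen_mat d W f * W = mat_adjoint U * W * (mat_diag d f * (mat_adjoint W * W))"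
      using U'(1) W'(1) by (simp add: eigen_mat_def assoc_mult_mat[of _ d d _ d _ d])
    then show ?thesis using W' C by (simp add: C_def)
  qed
  have "mat_diag d (\<lambda>i. complex_of_real (\<alpha> i) ^ n) * C = C * mat_diag d (\<lambda>i. complex_of_real (\<beta> i) ^ n)"
    using arg_cong[OF eq, of "\<lambda>X. mat_adjoint U * X * W"]
    unfolding eigen_mat_pow[OF U] eigen_mat_pow[OF W] conj conj' .
  then have entry: "complex_of_real (\<alpha> i) ^ n * C $$ (i, j) = C $$ (i, j) * complex_of_real (\<beta> j) ^ n"
    if "i < d" "j < d" for i j
    unfolding mat_diag_mult_left[OF C] mat_diag_mult_right[OF C]
    using that by (auto dest!: arg_cong[where f = "\<lambda>A. A $$ (i, j)"])
  have entry': "complex_of_real (\<alpha> i) * C $$ (i, j) = C $$ (i, j) * complex_of_real (\<beta> j)"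
    if ij: "i < d" "j < d" for i j
  proof (cases "C $$ (i, j) = 0")
    case False
    then have "complex_of_real (\<alpha> i ^ n) = complex_of_real (\<beta> j ^ n)" using entry[OF ij] by simp
    then have "\<alpha> i ^ n = \<beta> j ^ n" by (simp only: of_real_eq_iff)
    then show ?thesis using power_eq_imp_eq_base[of "\<alpha> i" n "\<beta> j"] \<alpha> \<beta> ij n by simp
  qed simp
  have "mat_diag d (\<lambda>i. complex_of_real (\<alpha> i)) * C = C * mat_diag d (\<lambda>i. complex_of_real (\<beta> i))"
    unfolding mat_diag_mult_left[OF C] mat_diag_mult_right[OF C]
  proof (rule eq_matI, goal_cases)
    case (1 i j)
    then show ?case using entry'[of i j] by simp
  qed simp_all
  then have "mat_adjoint U * eigen_mat d U (\<lambda>i. complex_of_real (\<alpha> i)) * W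
      = mat_adjoint U * eigen_mat d W (\<lambda>i. complex_of_real (\<beta> i)) * W" (is "_ * ?A * _ = _ * ?B * _")
    unfolding conj conj' .
  then have "U * (mat_adjoint U * ?A * W) * mat_adjoint W = U * (mat_adjoint U * ?B * W) * mat_adjoint W"
    by (simp only:)
  moreover have undo: "U * (mat_adjoint U * X * W) * mat_adjoint W = X" if "X \<in> carrier_mat d d" for X
  proof -
    have "U * (mat_adjoint U * X * W) * mat_adjoint W = (U * mat_adjoint U) * X * (W * mat_adjoint W)"
      using U'(1) W'(1) that by (simp add: assoc_mult_mat[of _ d d _ d _ d])
    then show ?thesis using U' W' that by simp
  qed
  ultimately show ?thesis
    by (simp only: undo[OF eigen_mat_carrier[OF U]] undo[OF eigen_mat_carrier[OF W]])
qed

lemma psd_root: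
  assumes A: "positive_semidefinite_mat d A" and n: "n > 0"
  shows "positive_semidefinite_mat d (psd_root d n A)" "psd_root d n A ^\<^sub>m n = A"
proof -
  obtain U \<rho> where U: "unitary_mat d U" and AU: "A = eigen_mat d U (\<lambda>i. complex_of_real (\<rho> i))"
    and \<rho>: "\<And>i. i < d \<Longrightarrow> 0 \<le> \<rho> i" using psd_spectral[OF A] by metis
  define X where "X = eigen_mat d U (\<lambda>i. complex_of_real (root n (\<rho> i)))"
  have X1: "positive_semidefinite_mat d X"
    unfolding X_def by (rule positive_semidefinite_eigen_mat[OF U]) (simp add: \<rho> real_root_ge_zero)
  have X2: "X ^\<^sub>m n = A"
    unfolding X_def AU eigen_mat_pow[OF U]
    by (rule eigen_mat_cong) (use \<rho> n in \<open>simp flip: of_real_power\<close>)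
  have unique: "Y = X" if Y: "positive_semidefinite_mat d Y" "Y ^\<^sub>m n = A" for Y
  proof -
    obtain W \<beta> where W: "unitary_mat d W" and YW: "Y = eigen_mat d W (\<lambda>i. complex_of_real (\<beta> i))"
      and \<beta>: "\<And>i. i < d \<Longrightarrow> 0 \<le> \<beta> i" using psd_spectral[OF Y(1)] by metis
    have eq: "eigen_mat d W (\<lambda>i. complex_of_real (\<beta> i)) ^\<^sub>m n
        = eigen_mat d U (\<lambda>i. complex_of_real (root n (\<rho> i))) ^\<^sub>m n"
      using Y(2)[unfolded YW] X2[unfolded X_def] by (rule trans[OF _ sym])
    show ?thesis
      unfolding YW X_def by (rule psd_root_unique[OF W U n \<beta> _ eq]) (simp_all add: \<rho> real_root_ge_zero)
  qed
  have "psd_root d n A = X"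
    unfolding psd_root_def by (rule the_equality) (use X1 X2 unique in blast)+
  with X1 X2 show "positive_semidefinite_mat d (psd_root d n A)" "psd_root d n A ^\<^sub>m n = A"
    by simp_all
qed

section \<open>Principal minors and exponents\<close>

text \<open>Indexing the minor by the set \<open>J\<close> itself instead of by an enumeration of it is what
  lets the Leibniz formula for \<open>1 + t Q\<close> fall apart into principal minors.\<close>

definition principal_minor :: "complex mat \<Rightarrow> nat set \<Rightarrow> complex" where
  "principal_minor Q J = (\<Sum>p | p permutes J. of_int (sign p) * (\<Prod>i\<in>J. Q $$ (i, p i)))"

lemma principal_minor_eq_det:
  assumes e: "bij_betw e {..<k} J"
  shows "principal_minor Q J = Determinant.det (Matrix.mat k k (\<lambda>(a, b). Q $$ (e a, e b)))"
proof -
  have inj: "inj_on e {..<k}" and J: "J = e ` {..<k}" using e by (auto simp: bij_betw_def)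
  have bij: "bij_betw (map_permutation {..<k} e) {p. p permutes {..<k}} {p. p permutes J}"
  proof (rule bij_betwI[where g = "map_permutation J (inv_into {..<k} e)"])
    have e': "bij_betw (inv_into {..<k} e) J {..<k}" using e by (rule bij_betw_inv_into)
    show "map_permutation {..<k} e \<in> {p. p permutes {..<k}} \<rightarrow> {p. p permutes J}"
      using map_permutation_permutes[OF e] by auto
    show "map_permutation J (inv_into {..<k} e) \<in> {p. p permutes J} \<rightarrow> {p. p permutes {..<k}}"
      using map_permutation_permutes[OF e'] by auto
    show "map_permutation J (inv_into {..<k} e) (map_permutation {..<k} e p) = p"
      if "p \<in> {p. p permutes {..<k}}" for p
      using that map_permutation_compose_inv[OF e] inj by auto
    show "map_permutation {..<k} e (map_permutation J (inv_into {..<k} e) p) = p"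
      if "p \<in> {p. p permutes J}" for p
      using that map_permutation_compose_inv[OF e', of p e] by (auto simp: J f_inv_into_f)
  qed
  have "principal_minor Q J = (\<Sum>p | p permutes {..<k}. of_int (sign (map_permutation {..<k} e p)) *
      (\<Prod>i\<in>J. Q $$ (i, map_permutation {..<k} e p i)))"
    unfolding principal_minor_def by (rule sum.reindex_bij_betw[OF bij, symmetric])
  also have "\<dots> = (\<Sum>p | p permutes {..<k}. of_int (sign p) * (\<Prod>a<k. Q $$ (e a, e (p a))))"
  proof (intro sum.cong refl)
    fix p assume "p \<in> {p. p permutes {..<k}}"
    then have p: "p permutes {..<k}" by simp
    have "(\<Prod>i\<in>J. Q $$ (i, map_permutation {..<k} e p i)) =
        (\<Prod>a<k. Q $$ (e a, map_permutation {..<k} e p (e a)))"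
      by (rule prod.reindex_bij_betw[OF e, symmetric])
    also have "\<dots> = (\<Prod>a<k. Q $$ (e a, e (p a)))"
      using inj by (intro prod.cong) (simp_all add: map_permutation_apply)
    finally show "of_int (sign (map_permutation {..<k} e p)) * (\<Prod>i\<in>J. Q $$ (i, map_permutation {..<k} e p i))
        = of_int (sign p) * (\<Prod>a<k. Q $$ (e a, e (p a)))"
      using sign_map_permutation[OF inj p] by simp
  qed
  also have "\<dots> = Determinant.det (Matrix.mat k k (\<lambda>(a, b). Q $$ (e a, e b)))"
    by (subst det_def'[of _ k])
       (auto simp: atLeast0LessThan permutes_in_image intro!: sum.cong prod.cong)
  finally show ?thesis .
qed

text \<open>Expanding each factor of the Leibniz formula as \<open>t Q + 1\<close> sorts the terms by the set \<open>J\<close> of rows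
  from which \<open>t Q\<close> is taken.\<close>

lemma det_one_plus_smult:
  assumes Q: "Q \<in> carrier_mat n n"
  shows "Determinant.det (1\<^sub>m n + t \<cdot>\<^sub>m Q) = (\<Sum>J\<in>Pow {..<n}. t ^ card J * principal_minor Q J)"
proof -
  let ?P = "{p. p permutes {..<n}}"
  have fin: "finite ?P" by (simp add: finite_permutations)
  have "Determinant.det (1\<^sub>m n + t \<cdot>\<^sub>m Q) =
      (\<Sum>p\<in>?P. of_int (sign p) * (\<Prod>i<n. (t * Q $$ (i, p i)) + (if i = p i then 1 else 0)))"
    using Q by (subst det_def'[of _ n])
      (auto simp: atLeast0LessThan permutes_in_image add.commute intro!: sum.cong prod.cong)
  also have "\<dots> = (\<Sum>p\<in>?P. \<Sum>J\<in>Pow {..<n}. of_int (sign p) *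
      ((\<Prod>i\<in>J. t * Q $$ (i, p i)) * (\<Prod>i\<in>{..<n} - J. if i = p i then 1 else 0)))"
    by (simp add: prod_add sum_distrib_left)
  also have "\<dots> = (\<Sum>J\<in>Pow {..<n}. \<Sum>p\<in>?P. of_int (sign p) *
      ((\<Prod>i\<in>J. t * Q $$ (i, p i)) * (\<Prod>i\<in>{..<n} - J. if i = p i then 1 else 0)))"
    by (rule sum.swap)
  also have "\<dots> = (\<Sum>J\<in>Pow {..<n}. t ^ card J * principal_minor Q J)"
  proof (intro sum.cong refl)
    fix J assume "J \<in> Pow {..<n}"
    then have J: "J \<subseteq> {..<n}" by simp
    \<comment> \<open>a permutation contributes only if it fixes the complement of \<open>J\<close>\<close>
    have "(\<Sum>p\<in>?P. of_int (sign p) *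
        ((\<Prod>i\<in>J. t * Q $$ (i, p i)) * (\<Prod>i\<in>{..<n} - J. if i = p i then 1 else 0)))
      = (\<Sum>p | p permutes J. of_int (sign p) * (\<Prod>i\<in>J. t * Q $$ (i, p i)))"
    proof (rule sum.mono_neutral_cong_right[OF fin])
      show "{p. p permutes J} \<subseteq> ?P" using J permutes_subset by blast
      show "\<forall>p\<in>?P - {p. p permutes J}. of_int (sign p) *
          ((\<Prod>i\<in>J. t * Q $$ (i, p i)) * (\<Prod>i\<in>{..<n} - J. if i = p i then 1 else 0)) = 0"
      proof
        fix p assume p: "p \<in> ?P - {p. p permutes J}"
        then obtain i where "i \<in> {..<n}" "i \<notin> J" "p i \<noteq> i"
          using permutes_superset[of p "{..<n}" J] by auto
        then show "of_int (sign p) *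
          ((\<Prod>i\<in>J. t * Q $$ (i, p i)) * (\<Prod>i\<in>{..<n} - J. if i = p i then 1 else 0)) = 0"
          by (auto intro!: bexI[of _ i] simp: prod_zero_iff)
      qed
      fix p assume "p \<in> {p. p permutes J}"
      then have "(\<Prod>i\<in>{..<n} - J. if i = p i then 1 else 0 :: complex) = 1"
        by (intro prod.neutral) (auto simp: permutes_not_in)
      then show "of_int (sign p) *
          ((\<Prod>i\<in>J. t * Q $$ (i, p i)) * (\<Prod>i\<in>{..<n} - J. if i = p i then 1 else 0))
        = of_int (sign p) * (\<Prod>i\<in>J. t * Q $$ (i, p i))" by simp
    qed
    also have "\<dots> = t ^ card J * principal_minor Q J"
      by (simp add: principal_minor_def prod.distrib sum_distrib_left mult_ac)
    finally show "(\<Sum>p\<in>?P. of_int (sign p) *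
        ((\<Prod>i\<in>J. t * Q $$ (i, p i)) * (\<Prod>i\<in>{..<n} - J. if i = p i then 1 else 0)))
      = t ^ card J * principal_minor Q J" .
  qed
  finally show ?thesis .
qed

lemma sum_Pow_by_card:
  fixes f :: "'b set \<Rightarrow> complex"
  assumes "finite A"
  shows "(\<Sum>J\<in>Pow A. t ^ card J * f J) = (\<Sum>k\<le>card A. (\<Sum>J | J \<subseteq> A \<and> card J = k. f J) * t ^ k)"
proof -
  have "(\<Sum>k\<le>card A. (\<Sum>J | J \<subseteq> A \<and> card J = k. f J) * t ^ k)
      = (\<Sum>k\<le>card A. \<Sum>J | J \<in> Pow A \<and> card J = k. t ^ card J * f J)"
    unfolding sum_distrib_right by (intro sum.cong) auto
  also have "\<dots> = (\<Sum>J\<in>Pow A. t ^ card J * f J)"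
    by (rule sum.group) (use assms in \<open>auto intro: card_mono\<close>)
  finally show ?thesis ..
qed

text \<open>Both sides are the coefficient of \<open>t\<^sup>k\<close> in \<open>det (1 + t Q)\<close>: once through principal minors and once
  through the eigenvalues.\<close>

lemma sum_principal_minors:
  assumes U: "unitary_mat n U"
  shows "(\<Sum>J | J \<subseteq> {..<n} \<and> card J = k. principal_minor (eigen_mat n U f) J)
       = (\<Sum>J | J \<subseteq> {..<n} \<and> card J = k. \<Prod>i\<in>J. f i)"
proof (cases "k \<le> n")
  case True
  let ?Q = "eigen_mat n U f"
  have "(\<Sum>k\<le>n. (\<Sum>J | J \<subseteq> {..<n} \<and> card J = k. principal_minor ?Q J) * t ^ k)
      = (\<Sum>k\<le>n. (\<Sum>J | J \<subseteq> {..<n} \<and> card J = k. \<Prod>i\<in>J. f i) * t ^ k)" for t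
  proof -
    have "(\<Sum>k\<le>n. (\<Sum>J | J \<subseteq> {..<n} \<and> card J = k. principal_minor ?Q J) * t ^ k)
        = Determinant.det (1\<^sub>m n + t \<cdot>\<^sub>m ?Q)"
      using sum_Pow_by_card[of "{..<n}" t "principal_minor ?Q"] det_one_plus_smult[of ?Q n t] U by simp
    also have "1\<^sub>m n + t \<cdot>\<^sub>m ?Q = eigen_mat n U (\<lambda>i. 1 + t * f i)"
    proof -
      have "eigen_mat n U (\<lambda>_. 1) = 1\<^sub>m n"
        unfolding eigen_mat_const[OF U] by (rule eq_matI) auto
      then show ?thesis
        using U by (simp add: eigen_mat_smult eigen_mat_add[OF U, of "\<lambda>_. 1", symmetric])
    qed
    also have "Determinant.det \<dots> = (\<Prod>i<n. t * f i + 1)"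
      using U by (simp add: det_eigen_mat add.commute)
    also have "\<dots> = (\<Sum>J\<in>Pow {..<n}. t ^ card J * (\<Prod>i\<in>J. f i))"
      by (simp add: prod_add prod.distrib)
    also have "\<dots> = (\<Sum>k\<le>n. (\<Sum>J | J \<subseteq> {..<n} \<and> card J = k. \<Prod>i\<in>J. f i) * t ^ k)"
      using sum_Pow_by_card[of "{..<n}" t "\<lambda>J. \<Prod>i\<in>J. f i"] by simp
    finally show ?thesis .
  qed
  note poly = this
  have "\<forall>k\<le>n. (\<Sum>J | J \<subseteq> {..<n} \<and> card J = k. principal_minor ?Q J)
      = (\<Sum>J | J \<subseteq> {..<n} \<and> card J = k. \<Prod>i\<in>J. f i)"
    by (rule iffD1[OF polyfun_eq_coeffs]) (rule allI, rule poly)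
  with True show ?thesis by blast
next
  case False
  then have "{J. J \<subseteq> {..<n} \<and> card J = k} = {}"
    using card_mono[of "{..<n}"] by fastforce
  then show ?thesis by (simp only: sum.empty)
qed

text \<open>The \<open>a\<close>-th smallest element of a set of naturals is at least \<open>a\<close>, so a product of decreasing
  numbers over \<open>J\<close> is largest for an initial segment.\<close>

lemma prod_le_initial_segment:
  fixes \<rho> :: "nat \<Rightarrow> real"
  assumes pos: "\<And>i. i < d \<Longrightarrow> 0 \<le> \<rho> i" and dec: "\<And>i j. i \<le> j \<Longrightarrow> j < d \<Longrightarrow> \<rho> j \<le> \<rho> i"
    and J: "J \<subseteq> {..<d}"
  shows "(\<Prod>i\<in>J. \<rho> i) \<le> (\<Prod>i<card J. \<rho> i)"
proof -
  have "finite J" using J finite_subset by blast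
  then obtain h where h: "bij_betw h {..<card J} J" and mono: "strict_mono_on {..<card J} h"
    using ex_bij_betw_strict_mono_card by blast
  have ge: "a < card J \<Longrightarrow> a \<le> h a" for a
  proof (induction a)
    case (Suc a)
    then have "h a < h (Suc a)" using mono by (auto simp: strict_mono_on_def)
    then show ?case using Suc by simp
  qed simp
  have lt: "h a < d" if "a < card J" for a
    using h J that by (auto simp: bij_betw_def)
  have "(\<Prod>i\<in>J. \<rho> i) = (\<Prod>a<card J. \<rho> (h a))"
    by (rule prod.reindex_bij_betw[OF h, symmetric])
  also have "\<dots> \<le> (\<Prod>a<card J. \<rho> a)"
    by (rule prod_mono) (use ge lt pos dec in auto)
  finally show ?thesis .
qed

lemma card_subsets_le: "card {J. J \<subseteq> {..<d} \<and> card J = k} \<le> 2 ^ d" for d :: nat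
proof -
  have "card {J. J \<subseteq> {..<d} \<and> card J = k} \<le> card (Pow {..<d})"
    by (rule card_mono) auto
  then show ?thesis by (simp add: card_Pow)
qed

text \<open>The roots agree as multisets, and a decreasing enumeration of a multiset is unique.\<close>

lemma prod_monic_linear_determines:
  fixes a b :: "nat \<Rightarrow> real"
  assumes a: "\<And>i j. i \<le> j \<Longrightarrow> j < d \<Longrightarrow> a j \<le> a i" and b: "\<And>i j. i \<le> j \<Longrightarrow> j < d \<Longrightarrow> b j \<le> b i"
    and eq: "(\<Prod>i<d. [:- complex_of_real (a i), 1:]) = (\<Prod>i<d. [:- complex_of_real (b i), 1:])"
    and i: "i < d"
  shows "a i = b i"
proof -
  have roots: "proots (\<Prod>i<d. [:- complex_of_real (c i), 1:]) = mset (map (\<lambda>i. complex_of_real (c i)) [0..<d])" for c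
  proof -
    have "proots (\<Prod>i<d. [:- complex_of_real (c i), 1:]) = (\<Sum>i<d. {#complex_of_real (c i)#})"
      by (subst proots_prod) auto
    also have "\<dots> = mset (map (\<lambda>i. complex_of_real (c i)) [0..<d])"
      by (induction d) auto
    finally show ?thesis .
  qed
  have "image_mset Re (mset (map (\<lambda>i. complex_of_real (a i)) [0..<d]))
      = image_mset Re (mset (map (\<lambda>i. complex_of_real (b i)) [0..<d]))"
    using eq roots[of a] roots[of b] by simp
  then have "mset (map a [0..<d]) = mset (map b [0..<d])"
    by (simp flip: mset_map add: o_def)
  then have "mset (rev (map a [0..<d])) = mset (rev (map b [0..<d]))" by simp
  moreover have "sorted (rev (map c [0..<d]))" if "\<And>i j. i \<le> j \<Longrightarrow> j < d \<Longrightarrow> c j \<le> c i" for c :: "nat \<Rightarrow> real"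
    using that by (auto simp: sorted_iff_nth_mono rev_nth)
  ultimately have "rev (map a [0..<d]) = rev (map b [0..<d])"
    using a b by (metis properties_for_sort)
  then have "map a [0..<d] = map b [0..<d]" by simp
  then show ?thesis using i by simp
qed

lemma finitely_many_convergent_subseq:
  fixes X :: "nat \<Rightarrow> nat \<Rightarrow> real"
  assumes "\<And>i. i < d \<Longrightarrow> Bseq (\<lambda>N. X N i)"
  shows "\<exists>r v. strict_mono r \<and> (\<forall>i<d. (\<lambda>N. X (r N) i) \<longlonglongrightarrow> v i)"
  using assms
proof (induction d)
  case 0
  show ?case by (intro exI[of _ id]) (auto simp: strict_mono_id)
next
  case (Suc d)
  then obtain r v where r: "strict_mono r" and v: "\<And>i. i < d \<Longrightarrow> (\<lambda>N. X (r N) i) \<longlonglongrightarrow> v i"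
    by (metis less_Suc_eq)
  have "Bseq (\<lambda>N. X (r N) d)"
    using Suc.prems[of d] by (rule Bseq_subseq) simp
  then have "bounded (range (\<lambda>N. X (r N) d))" by (simp add: Bseq_eq_bounded)
  then obtain s l where s: "strict_mono s" and l: "((\<lambda>N. X (r N) d) \<circ> s) \<longlonglongrightarrow> l"
    using bounded_imp_convergent_subsequence by blast
  show ?case
  proof (intro exI conjI allI impI)
    show "strict_mono (r \<circ> s)" using r s by (rule strict_mono_o)
    show "(\<lambda>N. X ((r \<circ> s) N) i) \<longlonglongrightarrow> (v(d := l)) i" if "i < Suc d" for i
    proof (cases "i = d")
      case True
      then show ?thesis using l by (simp add: o_def)
    next
      case False
      then have "(\<lambda>N. X (r N) i) \<longlonglongrightarrow> v i" using v that by simp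
      from LIMSEQ_subseq_LIMSEQ[OF this s] False show ?thesis by (simp add: o_def)
    qed
  qed
qed

lemma tendsto_det:
  fixes A :: "'b \<Rightarrow> complex mat"
  assumes "\<And>N. A N \<in> carrier_mat n n" "B \<in> carrier_mat n n"
    and "\<And>i j. i < n \<Longrightarrow> j < n \<Longrightarrow> ((\<lambda>N. A N $$ (i, j)) \<longlongrightarrow> B $$ (i, j)) F"
  shows "((\<lambda>N. Determinant.det (A N)) \<longlongrightarrow> Determinant.det B) F"
proof -
  have "((\<lambda>N. of_int (sign p) * (\<Prod>i = 0..<n. A N $$ (i, p i))) \<longlongrightarrow>
      of_int (sign p) * (\<Prod>i = 0..<n. B $$ (i, p i))) F" if "p permutes {0..<n}" for p
    by (intro tendsto_mult tendsto_const tendsto_prod assms(3))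
       (use permutes_in_image[OF that] in auto)
  then show ?thesis
    unfolding det_def'[OF assms(1)] det_def'[OF assms(2)] by (intro tendsto_sum) simp
qed


text \<open>For large \<open>N\<close> the \<open>k\<close>-th elementary symmetric function of the eigenvalues
  \<open>\<rho> i ^ (2 N)\<close> of \<open>Q N\<close> is governed by its largest term, which involves the \<open>k\<close> largest
  eigenvalues; it is also the sum of the principal minors of size \<open>k\<close>. The growth rate of these
  minors is therefore twice the sum of the first \<open>k\<close> exponents.\<close>

lemma minor_growth_determines_exponent_sum:
  fixes Q :: "nat \<Rightarrow> complex mat" and \<mu> :: "nat \<Rightarrow> real"
  assumes Q: "\<And>N. positive_semidefinite_mat d (Q N)"
    and V: "V \<in> carrier_mat d d" "mat_tendsto d (\<lambda>N. psd_root d (2 * N) (Q N)) V"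
    and cV: "char_poly V = (\<Prod>k = 1..d. [:- complex_of_real (exp (\<mu> k)), 1:])"
    and \<mu>: "\<And>i j. 1 \<le> i \<Longrightarrow> i \<le> j \<Longrightarrow> j \<le> d \<Longrightarrow> \<mu> j \<le> \<mu> i"
    and k: "k \<le> d"
    and nonneg: "\<And>N J. J \<subseteq> {..<d} \<Longrightarrow> card J = k \<Longrightarrow> 0 \<le> Re (principal_minor (Q N) J)"
    and upper: "\<And>\<delta>. \<delta> > 0 \<Longrightarrow> eventually (\<lambda>N. \<forall>J. J \<subseteq> {..<d} \<and> card J = k \<longrightarrow>
        Re (principal_minor (Q N) J) \<le> exp (real N * (b + \<delta>))) sequentially"
    and lower: "\<And>\<delta>. \<delta> > 0 \<Longrightarrow> eventually (\<lambda>N. \<forall>J. J \<subseteq> {..<d} \<and> card J = k \<longrightarrow>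
        exp (real N * (a - \<delta>)) \<le> Re (principal_minor (Q N) J)) sequentially"
  shows "2 * (\<Sum>i = 1..k. \<mu> i) \<in> {a..b}"
proof -
  \<comment> \<open>\<open>psd_root d 0\<close> is unspecified, so the sequence starts at \<open>1\<close>\<close>
  define R where "R N = psd_root d (2 * Suc N) (Q (Suc N))" for N
  have R: "positive_semidefinite_mat d (R N)" "R N ^\<^sub>m (2 * Suc N) = Q (Suc N)" for N
    unfolding R_def by (rule psd_root[OF Q], simp)+
  have "\<exists>U \<rho>. unitary_mat d U \<and> R N = eigen_mat d U (\<lambda>i. complex_of_real (\<rho> i)) \<and>
      (\<forall>i<d. 0 \<le> \<rho> i) \<and> (\<forall>i j. i \<le> j \<longrightarrow> j < d \<longrightarrow> \<rho> j \<le> \<rho> i)" for N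
    using psd_spectral[OF R(1)[of N]] by metis
  then obtain U \<rho> where U: "\<And>N. unitary_mat d (U N)"
    and RU: "\<And>N. R N = eigen_mat d (U N) (\<lambda>i. complex_of_real (\<rho> N i))"
    and \<rho>0: "\<And>N i. i < d \<Longrightarrow> 0 \<le> \<rho> N i"
    and \<rho>dec: "\<And>N i j. i \<le> j \<Longrightarrow> j < d \<Longrightarrow> \<rho> N j \<le> \<rho> N i"
    by metis
  have RV: "(\<lambda>N. R N $$ (i, j)) \<longlonglongrightarrow> V $$ (i, j)" if "i < d" "j < d" for i j
    using V(2) that unfolding mat_tendsto_def R_def by (intro LIMSEQ_Suc) auto
  have Rc: "R N \<in> carrier_mat d d" for N using U by (simp add: RU)
  \<comment> \<open>the trace bounds the eigenvalues\<close>
  have trace: "(\<Sum>i<d. \<rho> N i) = (\<Sum>i<d. Re (R N $$ (i, i)))" for N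
  proof -
    have sing: "{J. J \<subseteq> {..<d} \<and> card J = 1} = (\<lambda>i. {i}) ` {..<d}"
      by (auto simp: card_1_singleton_iff)
    have pm: "principal_minor (R N) {i} = R N $$ (i, i)" for i
      using permutes_sing by (simp add: principal_minor_def)
    have "(\<Sum>i<d. R N $$ (i, i)) = (\<Sum>i<d. complex_of_real (\<rho> N i))"
      using sum_principal_minors[OF U, of N "\<lambda>i. complex_of_real (\<rho> N i)" 1]
      unfolding sing by (simp add: sum.reindex pm flip: RU)
    from arg_cong[OF this, of Re] show ?thesis by simp
  qed
  have "Bseq (\<lambda>N. \<rho> N i)" if i: "i < d" for i
  proof -
    have "(\<lambda>N. \<Sum>i<d. Re (R N $$ (i, i))) \<longlonglongrightarrow> (\<Sum>i<d. Re (V $$ (i, i)))"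
      by (intro tendsto_sum tendsto_Re RV) auto
    then have "Bseq (\<lambda>N. \<Sum>i<d. \<rho> N i)"
      unfolding trace by (rule convergent_imp_Bseq[OF convergentI])
    moreover have "\<bar>\<rho> N i\<bar> \<le> \<bar>\<Sum>i<d. \<rho> N i\<bar>" for N
      using \<rho>0 i member_le_sum[of i "{..<d}" "\<rho> N"] by (auto simp: sum_nonneg)
    ultimately show ?thesis by (auto intro!: Bseq_eventually_mono[of "\<lambda>N. \<rho> N i" "\<lambda>N. \<Sum>i<d. \<rho> N i"])
  qed
  \<comment> \<open>convergence of the eigenvalues along one subsequence is enough, since their limit is identified below\<close>
  then obtain r v where r: "strict_mono r" and v: "\<And>i. i < d \<Longrightarrow> (\<lambda>N. \<rho> (r N) i) \<longlonglongrightarrow> v i"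
    using finitely_many_convergent_subseq[of d \<rho>] by blast
  have vdec: "v j \<le> v i" if "i \<le> j" "j < d" for i j
    by (rule LIMSEQ_le[OF v v]) (use that \<rho>dec in auto)
  \<comment> \<open>the characteristic polynomial passes to the limit\<close>
  define C where "C A x = Matrix.mat d d (\<lambda>(i, j). (if i = j then x else 0) - A $$ (i, j))"
    for A :: "complex mat" and x
  have C_eigen: "Determinant.det (C (eigen_mat d W f) x) = (\<Prod>i<d. x - f i)" if W: "unitary_mat d W" for W f x
  proof -
    have "C (eigen_mat d W f) x = eigen_mat d W (\<lambda>_. x) + eigen_mat d W (\<lambda>i. (- 1) * f i)"
      unfolding eigen_mat_smult[OF W, symmetric] eigen_mat_const[OF W]
      by (rule eq_matI) (use carrier_matD[OF eigen_mat_carrier[OF W, of f]] in \<open>auto simp: C_def\<close>)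
    also have "\<dots> = eigen_mat d W (\<lambda>i. x - f i)" by (simp add: eigen_mat_add[OF W])
    finally show ?thesis by (simp add: det_eigen_mat[OF W])
  qed
  have VH: "mat_adjoint V = V"
  proof (rule eq_matI, goal_cases)
    case (1 i j)
    then have ij: "i < d" "j < d" using V by auto
    have "(\<lambda>N. cnj (R N $$ (j, i))) \<longlonglongrightarrow> cnj (V $$ (j, i))"
      by (intro tendsto_cnj RV ij)
    moreover have "cnj (R N $$ (j, i)) = R N $$ (i, j)" for N
    proof -
      have "mat_adjoint (R N) $$ (i, j) = cnj (R N $$ (j, i))"
        using ij Rc[of N] by (intro mat_adjoint_index) auto
      then show ?thesis using R(1)[of N] by (simp add: positive_semidefinite_mat_def hermitian_mat_def)
    qed
    ultimately have "(\<lambda>N. R N $$ (i, j)) \<longlonglongrightarrow> cnj (V $$ (j, i))" by simp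
    then have "cnj (V $$ (j, i)) = V $$ (i, j)"
      by (rule LIMSEQ_unique[OF _ RV[OF ij]])
    then show ?case using ij V by simp
  qed (use V in auto)
  define es where "es = map (\<lambda>i. complex_of_real (exp (\<mu> (Suc i)))) [0..<d]"
  have "char_poly V = (\<Prod>e\<leftarrow>es. [:- e, 1:])"
  proof -
    have "char_poly V = (\<Prod>i = 0..<d. [:- complex_of_real (exp (\<mu> (Suc i))), 1:])"
      unfolding cV by (rule prod.reindex_bij_witness[of _ Suc "\<lambda>i. i - 1"]) auto
    then show ?thesis by (simp add: es_def o_def prod.list_conv_set_nth atLeast0LessThan)
  qed
  from hermitian_spectral[OF V(1) VH this]
  obtain W where W: "unitary_mat d W" and VW: "V = eigen_mat d W (\<lambda>i. es ! i)"
    unfolding eigen_mat_def by metis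
  have "(\<Prod>i<d. [:- complex_of_real (v i), 1:]) = (\<Prod>i<d. [:- complex_of_real (exp (\<mu> (Suc i))), 1:])"
  proof (rule poly_ext)
    fix x :: complex
    have "(\<lambda>N. Determinant.det (C (R (r N)) x)) \<longlonglongrightarrow> Determinant.det (C V x)"
    proof (rule tendsto_det[of _ d])
      show "(\<lambda>N. C (R (r N)) x $$ (i, j)) \<longlonglongrightarrow> C V x $$ (i, j)" if "i < d" "j < d" for i j
        using LIMSEQ_subseq_LIMSEQ[OF RV[OF that] r] that
        by (auto simp: C_def o_def intro!: tendsto_diff tendsto_minus)
    qed (auto simp: C_def)
    moreover have "Determinant.det (C V x) = (\<Prod>i<d. x - exp (\<mu> (Suc i)))"
      unfolding VW C_eigen[OF W] by (simp add: es_def)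
    moreover have "(\<lambda>N. \<Prod>i<d. x - complex_of_real (\<rho> (r N) i)) \<longlonglongrightarrow> (\<Prod>i<d. x - complex_of_real (v i))"
      by (intro tendsto_prod tendsto_diff tendsto_const tendsto_of_real v) auto
    ultimately have "(\<Prod>i<d. x - complex_of_real (v i)) = (\<Prod>i<d. x - exp (\<mu> (Suc i)))"
      unfolding RU C_eigen[OF U] using LIMSEQ_unique[of "\<lambda>N. \<Prod>i<d. x - complex_of_real (\<rho> (r N) i)"] by auto
    then show "poly (\<Prod>i<d. [:- complex_of_real (v i), 1:]) x
        = poly (\<Prod>i<d. [:- complex_of_real (exp (\<mu> (Suc i))), 1:]) x"
      by (simp add: poly_prod)
  qed
  then have v_eq: "v i = exp (\<mu> (Suc i))" if "i < d" for i
    by (rule prod_monic_linear_determines[rotated 2]) (use that vdec \<mu> in auto)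
  define P where "P N = (\<Prod>i<k. \<rho> (r N) i)" for N
  have "P \<longlonglongrightarrow> (\<Prod>i<k. exp (\<mu> (Suc i)))"
    unfolding P_def by (intro tendsto_prod) (use v v_eq k in fastforce)
  also have "(\<Prod>i<k. exp (\<mu> (Suc i))) = exp (\<Sum>i = 1..k. \<mu> i)"
  proof -
    have "(\<Sum>i = 1..k. \<mu> i) = (\<Sum>i<k. \<mu> (Suc i))"
      by (rule sum.reindex_bij_witness[of _ Suc "\<lambda>i. i - 1"]) auto
    then show ?thesis by (simp add: exp_sum)
  qed
  finally have P: "P \<longlonglongrightarrow> exp (\<Sum>i = 1..k. \<mu> i)" .
  then have lnP: "(\<lambda>N. ln (P N)) \<longlonglongrightarrow> (\<Sum>i = 1..k. \<mu> i)"
    using tendsto_ln[OF P] by simp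
  have Ppos: "eventually (\<lambda>N. P N > 0) sequentially"
    using order_tendstoD(1)[OF P, of 0] by simp
  \<comment> \<open>\<open>E N\<close> is the elementary symmetric function, once through minors and once through eigenvalues\<close>
  define E where "E N = (\<Sum>J | J \<subseteq> {..<d} \<and> card J = k. Re (principal_minor (Q (Suc (r N))) J))" for N
  have E: "E N = (\<Sum>J | J \<subseteq> {..<d} \<and> card J = k. \<Prod>i\<in>J. \<rho> (r N) i ^ (2 * Suc (r N)))" for N
  proof -
    have "Q (Suc (r N)) = eigen_mat d (U (r N)) (\<lambda>i. complex_of_real (\<rho> (r N) i) ^ (2 * Suc (r N)))"
      unfolding R(2)[symmetric] RU eigen_mat_pow[OF U] ..
    then have "(\<Sum>J | J \<subseteq> {..<d} \<and> card J = k. principal_minor (Q (Suc (r N))) J)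
        = (\<Sum>J | J \<subseteq> {..<d} \<and> card J = k. \<Prod>i\<in>J. complex_of_real (\<rho> (r N) i) ^ (2 * Suc (r N)))"
      using sum_principal_minors[OF U] by simp
    from arg_cong[OF this, of Re] show ?thesis by (simp add: E_def flip: of_real_power of_real_prod)
  qed
  have fin: "finite {J. J \<subseteq> {..<d} \<and> card J = k}" by simp
  have ke: "{..<k} \<in> {J. J \<subseteq> {..<d} \<and> card J = k}" using k by auto
  \<comment> \<open>the two bounds differ by the factor \<open>2\<^sup>d\<close>, which does not affect the exponential rate\<close>
  have E_ge: "P N ^ (2 * Suc (r N)) \<le> E N" for N
  proof -
    have "P N ^ (2 * Suc (r N)) = (\<Prod>i\<in>{..<k}. \<rho> (r N) i ^ (2 * Suc (r N)))"
      by (simp add: P_def prod_power_distrib)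
    also have "\<dots> \<le> E N"
      unfolding E
    proof (rule member_le_sum[OF ke _ fin])
      fix J assume "J \<in> {J. J \<subseteq> {..<d} \<and> card J = k} - {{..<k}}"
      then show "0 \<le> (\<Prod>i\<in>J. \<rho> (r N) i ^ (2 * Suc (r N)))"
        by (intro prod_nonneg ballI zero_le_power \<rho>0) auto
    qed
    finally show ?thesis .
  qed
  have E_le: "E N \<le> 2 ^ d * P N ^ (2 * Suc (r N))" for N
  proof -
    have P0: "0 \<le> P N" unfolding P_def using \<rho>0 k by (intro prod_nonneg) auto
    have "E N \<le> (\<Sum>J | J \<subseteq> {..<d} \<and> card J = k. P N ^ (2 * Suc (r N)))"
      unfolding E
    proof (rule sum_mono)
      fix J assume J: "J \<in> {J. J \<subseteq> {..<d} \<and> card J = k}"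
      have "(\<Prod>i\<in>J. \<rho> (r N) i ^ (2 * Suc (r N))) = (\<Prod>i\<in>J. \<rho> (r N) i) ^ (2 * Suc (r N))"
        by (simp only: prod_power_distrib)
      also have "\<dots> \<le> P N ^ (2 * Suc (r N))"
        using prod_le_initial_segment[of d "\<rho> (r N)" J] J \<rho>0 \<rho>dec
        by (intro power_mono) (auto simp: P_def intro!: prod_nonneg)
      finally show "(\<Prod>i\<in>J. \<rho> (r N) i ^ (2 * Suc (r N))) \<le> P N ^ (2 * Suc (r N))" .
    qed
    also have "\<dots> = real (card {J. J \<subseteq> {..<d} \<and> card J = k}) * P N ^ (2 * Suc (r N))"
      by simp
    also have "\<dots> \<le> 2 ^ d * P N ^ (2 * Suc (r N))"
      using P0 of_nat_mono[OF card_subsets_le[of d k], where 'a = real] by (intro mult_right_mono) auto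
    finally show ?thesis .
  qed
  have lnpow: "P N ^ (2 * Suc (r N)) = exp (real (Suc (r N)) * (2 * ln (P N)))" if "P N > 0" for N
  proof -
    have "P N ^ (2 * Suc (r N)) = exp (ln (P N)) ^ (2 * Suc (r N))" using that by simp
    also have "\<dots> = exp (real (2 * Suc (r N)) * ln (P N))" by (rule exp_of_nat_mult[symmetric])
    finally show ?thesis by (simp add: algebra_simps)
  qed
  have rinf: "filterlim (\<lambda>N. Suc (r N)) sequentially sequentially"
    using r filterlim_subseq filterlim_Suc filterlim_compose by blast
  have small: "(\<lambda>N. real d * ln 2 / real (Suc (r N))) \<longlonglongrightarrow> 0"
    by (rule tendsto_divide_0[OF tendsto_const])
       (rule filterlim_at_top_imp_at_infinity, rule filterlim_compose[OF filterlim_real_sequentially rinf])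
  have pow2: "(2::real) ^ d = exp (real d * ln 2)"
    by (simp add: exp_of_nat_mult)
  have card1: "card {J. J \<subseteq> {..<d} \<and> card J = k} \<ge> 1"
    using ke fin by (metis (no_types, lifting) One_nat_def Suc_leI card_gt_0_iff empty_iff)
  have "2 * (\<Sum>i = 1..k. \<mu> i) \<le> b"
  proof (rule field_le_epsilon)
    fix \<delta> :: real assume \<delta>: "0 < \<delta>"
    have ev: "eventually (\<lambda>N. 2 * ln (P N) \<le> real d * ln 2 / real (Suc (r N)) + (b + \<delta>)) sequentially"
      using Ppos eventually_compose_filterlim[OF upper[OF \<delta>] rinf]
    proof eventually_elim
      case (elim N)
      have "exp (real (Suc (r N)) * (2 * ln (P N))) \<le> E N" using E_ge[of N] lnpow[OF elim(1)] by simp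
      also have "E N \<le> (\<Sum>J | J \<subseteq> {..<d} \<and> card J = k. exp (real (Suc (r N)) * (b + \<delta>)))"
        unfolding E_def by (rule sum_mono) (use elim(2) in auto)
      also have "\<dots> = real (card {J. J \<subseteq> {..<d} \<and> card J = k}) * exp (real (Suc (r N)) * (b + \<delta>))"
        by simp
      also have "\<dots> \<le> 2 ^ d * exp (real (Suc (r N)) * (b + \<delta>))"
        using of_nat_mono[OF card_subsets_le[of d k], where 'a = real] by (intro mult_right_mono) auto
      also have "\<dots> = exp (real d * ln 2 + real (Suc (r N)) * (b + \<delta>))"
        by (simp only: pow2 exp_add)
      finally have "real (Suc (r N)) * (2 * ln (P N)) \<le> real d * ln 2 + real (Suc (r N)) * (b + \<delta>)"
        by (simp only: exp_le_cancel_iff)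
      then show ?case by (simp add: field_simps)
    qed
    have "(\<lambda>N. real d * ln 2 / real (Suc (r N)) + (b + \<delta>)) \<longlonglongrightarrow> 0 + (b + \<delta>)"
      by (intro tendsto_add small tendsto_const)
    from tendsto_le[OF _ this tendsto_mult[OF tendsto_const lnP] ev]
    show "2 * (\<Sum>i = 1..k. \<mu> i) \<le> b + \<delta>" by simp
  qed
  moreover have "a \<le> 2 * (\<Sum>i = 1..k. \<mu> i)"
  proof (rule field_le_epsilon)
    fix \<delta> :: real assume \<delta>: "0 < \<delta>"
    have ev: "eventually (\<lambda>N. a - \<delta> \<le> real d * ln 2 / real (Suc (r N)) + 2 * ln (P N)) sequentially"
      using Ppos eventually_compose_filterlim[OF lower[OF \<delta>] rinf]
    proof eventually_elim
      case (elim N)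
      have "exp (real (Suc (r N)) * (a - \<delta>)) \<le> Re (principal_minor (Q (Suc (r N))) {..<k})"
        using elim(2) k by auto
      also have "\<dots> \<le> E N"
        unfolding E_def by (rule member_le_sum[OF ke _ fin]) (use nonneg in auto)
      also have "\<dots> \<le> exp (real d * ln 2 + real (Suc (r N)) * (2 * ln (P N)))"
        using E_le[of N] by (simp only: lnpow[OF elim(1)] pow2 exp_add)
      finally have "real (Suc (r N)) * (a - \<delta>) \<le> real d * ln 2 + real (Suc (r N)) * (2 * ln (P N))"
        by (simp only: exp_le_cancel_iff)
      then show ?case by (simp add: field_simps)
    qed
    have "(\<lambda>N. real d * ln 2 / real (Suc (r N)) + 2 * ln (P N)) \<longlonglongrightarrow> 0 + 2 * (\<Sum>i = 1..k. \<mu> i)"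
      by (intro tendsto_add small tendsto_mult tendsto_const lnP)
    from tendsto_le[OF _ this tendsto_const ev]
    show "a \<le> 2 * (\<Sum>i = 1..k. \<mu> i) + \<delta>" by simp
  qed
  ultimately show ?thesis by simp
qed

section \<open>Unitary invariance of the complex Gaussian measure\<close>

definition cgauss :: "complex measure" where
  "cgauss = density lborel (\<lambda>z. ennreal (exp (- (cmod z)\<^sup>2) / pi))"

lemma sets_cgauss [simp, measurable_cong]: "sets cgauss = sets borel"
  by (simp add: cgauss_def)

lemma space_cgauss [simp]: "space cgauss = UNIV"
  by (simp add: cgauss_def)

text \<open>Polar coordinates for radial functions: the disc of squared radius \<open>r\<close> has area \<open>\<pi> r\<close>.\<close>

lemma distr_neg_cmod_square:
  "distr lborel borel (\<lambda>z::complex. - (cmod z)\<^sup>2) = density lborel (\<lambda>r. ennreal (pi * indicator {..0} r))"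
  (is "?M = ?N")
proof (rule measure_eqI_lessThan)
  have M: "emeasure ?M {x<..} = ennreal (pi * max 0 (- x))" for x
  proof (cases "x < 0")
    case True
    have *: "(\<lambda>z::complex. - (cmod z)\<^sup>2) -` {x<..} = ball 0 (sqrt (- x))"
    proof -
      have "cmod z < sqrt (- x) \<longleftrightarrow> (cmod z)\<^sup>2 < - x" for z
        using real_sqrt_less_iff[of "(cmod z)\<^sup>2" "- x"] by simp
      then show ?thesis by (auto simp: dist_norm)
    qed
    have "emeasure ?M {x<..} = emeasure lborel (ball (0::complex) (sqrt (- x)))"
      by (subst emeasure_distr) (auto simp: *)
    also have "\<dots> = ennreal (pi * (- x))"
      using True by (subst emeasure_ball) (simp_all add: unit_ball_vol_2)
    finally show ?thesis using True by simp
  next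
    case False
    then have "(\<lambda>z::complex. - (cmod z)\<^sup>2) -` {x<..} \<inter> space lborel = {}"
    proof -
      have "\<not> x < - (cmod z)\<^sup>2" for z
        using False zero_le_power2[of "cmod z"] by linarith
      then show ?thesis by auto
    qed
    then show ?thesis using False by (subst emeasure_distr) auto
  qed
  have N: "emeasure ?N {x<..} = ennreal (pi * max 0 (- x))" for x
  proof -
    have "emeasure ?N {x<..} = (\<integral>\<^sup>+r. ennreal pi * indicator ({x<..} \<inter> {..0}) r \<partial>lborel)"
      by (subst emeasure_density) (auto intro!: nn_integral_cong split: split_indicator)
    also have "\<dots> = ennreal pi * emeasure lborel ({x<..} \<inter> {..0::real})"
      by (subst nn_integral_cmult_indicator) auto
    also have "{x<..} \<inter> {..0} = {x<..0}" by auto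
    also have "ennreal pi * emeasure lborel {x<..0} = ennreal (pi * max 0 (- x))"
      by (cases "x \<le> 0") (auto simp flip: ennreal_mult)
    finally show ?thesis .
  qed
  show "emeasure ?M {x<..} < \<infinity>" "emeasure ?M {x<..} = emeasure ?N {x<..}" for x
    by (simp_all add: M N)
qed auto

text \<open>The squared modulus of a standard complex normal is exponentially distributed.\<close>

lemma nn_integral_cgauss_radial:
  assumes [measurable]: "f \<in> borel_measurable borel"
  shows "(\<integral>\<^sup>+z. f ((cmod z)\<^sup>2) \<partial>cgauss) = (\<integral>\<^sup>+r. ennreal (exponential_density 1 r) * f r \<partial>lborel)"
proof -
  have "(\<integral>\<^sup>+z. f ((cmod z)\<^sup>2) \<partial>cgauss)
      = (\<integral>\<^sup>+z. ennreal (exp (- (cmod z)\<^sup>2) / pi) * f (- (- (cmod z)\<^sup>2)) \<partial>lborel)"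
    by (simp add: cgauss_def nn_integral_density)
  also have "\<dots> = (\<integral>\<^sup>+r. ennreal (exp r / pi) * f (- r) \<partial>distr lborel borel (\<lambda>z::complex. - (cmod z)\<^sup>2))"
    by (subst nn_integral_distr) auto
  also have "\<dots> = (\<integral>\<^sup>+r. ennreal (pi * indicator {..0} r) * (ennreal (exp r / pi) * f (- r)) \<partial>lborel)"
    unfolding distr_neg_cmod_square by (subst nn_integral_density) auto
  also have "\<dots> = (\<integral>\<^sup>+r. ennreal (exp r * indicator {..0} r) * f (- r) \<partial>lborel)"
    by (intro nn_integral_cong)
       (auto simp: mult.assoc[symmetric] ennreal_mult[symmetric] split: split_indicator)
  also have "\<dots> = (\<integral>\<^sup>+r. ennreal (exp (- r) * indicator {..0} (- r)) * f r \<partial>lborel)"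
    by (subst nn_integral_real_affine[where c = "-1" and t = 0]) (auto simp: one_ennreal_def[symmetric])
  also have "\<dots> = (\<integral>\<^sup>+r. ennreal (exponential_density 1 r) * f r \<partial>lborel)"
    by (intro nn_integral_cong) (auto simp: exponential_density_def split: split_indicator)
  finally show ?thesis .
qed

lemma nn_integral_cgauss_exp:
  assumes c: "c \<ge> 0"
  shows "(\<integral>\<^sup>+z. ennreal (exp (- c * (cmod z)\<^sup>2)) \<partial>cgauss) = ennreal (1 / (1 + c))"
proof -
  have nz: "1 + c \<noteq> 0" using c by simp
  have "(\<integral>\<^sup>+z. ennreal (exp (- c * (cmod z)\<^sup>2)) \<partial>cgauss)
      = (\<integral>\<^sup>+r. ennreal (exponential_density 1 r) * ennreal (exp (- c * r)) \<partial>lborel)"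
    by (rule nn_integral_cgauss_radial) auto
  also have "\<dots> = (\<integral>\<^sup>+r. ennreal (1 / (1 + c)) * ennreal (exponential_density (1 + c) r) \<partial>lborel)"
    using c by (intro nn_integral_cong)
      (auto simp: exponential_density_def ennreal_mult[symmetric] exp_add[symmetric] field_simps nz)
  also have "\<dots> = ennreal (1 / (1 + c)) * (\<integral>\<^sup>+r. ennreal (exponential_density (1 + c) r) \<partial>lborel)"
    by (rule nn_integral_cmult) auto
  also have "(\<integral>\<^sup>+r. ennreal (exponential_density (1 + c) r) \<partial>lborel) = 1"
    using prob_space.emeasure_space_1[OF prob_space_exponential_density[of "1 + c"]] c
    by (simp add: emeasure_density)
  finally show ?thesis by simp
qed

lemma prob_space_cgauss: "prob_space cgauss"
proof
  have "emeasure cgauss (space cgauss) = (\<integral>\<^sup>+z. ennreal (exp (- 0 * (cmod z)\<^sup>2)) \<partial>cgauss)" by simp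
  also have "\<dots> = 1" by (subst nn_integral_cgauss_exp) auto
  finally show "emeasure cgauss (space cgauss) = 1" .
qed

interpretation cgauss: prob_space cgauss by (rule prob_space_cgauss)

abbreviation gauss :: "'i set \<Rightarrow> ('i \<Rightarrow> complex) measure" where
  "gauss K \<equiv> PiM K (\<lambda>_. cgauss)"

interpretation gauss: product_sigma_finite "\<lambda>_. cgauss"
  by unfold_locales

lemma prob_space_gauss: "prob_space (gauss K)"
  by (rule prob_space_PiM) (rule prob_space_cgauss)

interpretation clebesgue: product_sigma_finite "\<lambda>_. lborel :: complex measure"
  by unfold_locales

abbreviation clebesgue :: "'i set \<Rightarrow> ('i \<Rightarrow> complex) measure" where
  "clebesgue K \<equiv> PiM K (\<lambda>_. lborel)"

definition gauss_weight :: "'i set \<Rightarrow> ('i \<Rightarrow> complex) \<Rightarrow> real" where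
  "gauss_weight K x = exp (- (\<Sum>i\<in>K. (cmod (x i))\<^sup>2)) / pi ^ card K"

lemma gauss_weight_measurable [measurable]: "finite K \<Longrightarrow> gauss_weight K \<in> borel_measurable (clebesgue K)"
  unfolding gauss_weight_def by measurable

lemma gauss_eq_density:
  assumes K: "finite K"
  shows "gauss K = density (clebesgue K) (\<lambda>x. ennreal (gauss_weight K x))"
proof (rule gauss.PiM_eqI[OF K, symmetric])
  have "sets (clebesgue K) = sets (gauss K)" by (intro sets_PiM_cong) auto
  then show "sets (density (clebesgue K) (\<lambda>x. ennreal (gauss_weight K x))) = sets (gauss K)" by simp
  fix A :: "'a \<Rightarrow> complex set" assume "\<And>i. i \<in> K \<Longrightarrow> A i \<in> sets cgauss"
  then have A [measurable]: "\<And>i. i \<in> K \<Longrightarrow> A i \<in> sets borel" by simp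
  then have PA: "Pi\<^sub>E K A \<in> sets (clebesgue K)" using K by (intro sets_PiM_I_finite) auto
  have "emeasure (density (clebesgue K) (\<lambda>x. ennreal (gauss_weight K x))) (Pi\<^sub>E K A)
      = (\<integral>\<^sup>+x. ennreal (gauss_weight K x) * indicator (Pi\<^sub>E K A) x \<partial>clebesgue K)"
    using PA K by (subst emeasure_density) auto
  also have "\<dots> = (\<integral>\<^sup>+x. (\<Prod>i\<in>K. ennreal (exp (- (cmod (x i))\<^sup>2) / pi) * indicator (A i) (x i)) \<partial>clebesgue K)"
  proof (rule nn_integral_cong)
    fix x assume "x \<in> space (clebesgue K)"
    then have x: "x \<in> extensional K" by (auto simp: space_PiM PiE_def)
    have "gauss_weight K x = (\<Prod>i\<in>K. exp (- (cmod (x i))\<^sup>2) / pi)"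
      using K by (simp add: gauss_weight_def prod_dividef exp_sum sum_negf[symmetric])
    then have 1: "ennreal (gauss_weight K x) = (\<Prod>i\<in>K. ennreal (exp (- (cmod (x i))\<^sup>2) / pi))"
      by (simp add: prod_ennreal)
    have 2: "(indicator (Pi\<^sub>E K A) x :: ennreal) = (\<Prod>i\<in>K. indicator (A i) (x i))"
    proof (cases "x \<in> Pi\<^sub>E K A")
      case True
      then have "indicator (A i) (x i) = (1 :: ennreal)" if "i \<in> K" for i
        using that by (auto simp: PiE_def Pi_def)
      then show ?thesis using True by simp
    next
      case False
      then obtain i where "i \<in> K" "x i \<notin> A i" using x by (auto simp: PiE_def)
      then have "(\<Prod>i\<in>K. indicator (A i) (x i) :: ennreal) = 0"
        using K by (intro prod_zero) (auto intro!: bexI[of _ i])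
      then show ?thesis using False by simp
    qed
    show "ennreal (gauss_weight K x) * indicator (Pi\<^sub>E K A) x
        = (\<Prod>i\<in>K. ennreal (exp (- (cmod (x i))\<^sup>2) / pi) * indicator (A i) (x i))"
      unfolding 1 2 by (rule prod.distrib[symmetric])
  qed
  also have "\<dots> = (\<Prod>i\<in>K. \<integral>\<^sup>+z. ennreal (exp (- (cmod z)\<^sup>2) / pi) * indicator (A i) z \<partial>lborel)"
    using K by (intro clebesgue.product_nn_integral_prod) auto
  also have "\<dots> = (\<Prod>i\<in>K. emeasure cgauss (A i))"
    by (intro prod.cong refl) (simp add: cgauss_def emeasure_density)
  finally show "emeasure (density (clebesgue K) (\<lambda>x. ennreal (gauss_weight K x))) (Pi\<^sub>E K A)
      = (\<Prod>i\<in>K. emeasure cgauss (A i))" .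
qed

definition shift :: "'i set \<Rightarrow> ('i \<Rightarrow> complex) \<Rightarrow> ('i \<Rightarrow> complex) \<Rightarrow> 'i \<Rightarrow> complex" where
  "shift K y x = (\<lambda>i\<in>K. x i + y i)"

lemma shift_measurable [measurable]: "shift K y \<in> clebesgue K \<rightarrow>\<^sub>M clebesgue K"
  unfolding shift_def by measurable

lemma shift_measurable_raw [measurable (raw)]:
  assumes [measurable]: "g \<in> N \<rightarrow>\<^sub>M clebesgue K" "h \<in> N \<rightarrow>\<^sub>M clebesgue K"
  shows "(\<lambda>p. shift K (g p) (h p)) \<in> N \<rightarrow>\<^sub>M clebesgue K"
proof -
  have "(\<lambda>p. h p i + g p i) \<in> borel_measurable N" if i: "i \<in> K" for i
    using measurable_compose[OF assms(1) measurable_component_singleton[OF i]]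
      measurable_compose[OF assms(2) measurable_component_singleton[OF i]] by simp
  then show ?thesis unfolding shift_def by (intro measurable_restrict) simp
qed

lemma distr_shift:
  assumes K: "finite K"
  shows "distr (clebesgue K) (clebesgue K) (shift K y) = clebesgue K"
proof (rule clebesgue.PiM_eqI[OF K])
  fix A :: "'a \<Rightarrow> complex set" assume "\<And>i. i \<in> K \<Longrightarrow> A i \<in> sets lborel"
  then have A [measurable]: "\<And>i. i \<in> K \<Longrightarrow> A i \<in> sets borel" by simp
  have B: "(\<lambda>z. y i + z) -` A i \<in> sets borel" if "i \<in> K" for i
    using measurable_sets[OF borel_measurable_add[OF borel_measurable_const measurable_ident] A[OF that], of "y i"]
    by simp
  have "shift K y -` Pi\<^sub>E K A \<inter> space (clebesgue K) = (\<Pi>\<^sub>E i\<in>K. (\<lambda>z. y i + z) -` A i)"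
    by (auto simp: shift_def space_PiM PiE_def Pi_def extensional_def add.commute)
  then have "emeasure (distr (clebesgue K) (clebesgue K) (shift K y)) (Pi\<^sub>E K A)
      = emeasure (clebesgue K) (\<Pi>\<^sub>E i\<in>K. (\<lambda>z. y i + z) -` A i)"
    using K A by (subst emeasure_distr) (auto intro!: sets_PiM_I_finite)
  also have "\<dots> = (\<Prod>i\<in>K. emeasure lborel ((\<lambda>z. y i + z) -` A i))"
    using K B by (intro clebesgue.emeasure_PiM) auto
  also have "\<dots> = (\<Prod>i\<in>K. emeasure lborel (A i))"
  proof (intro prod.cong refl)
    fix i assume i: "i \<in> K"
    have "emeasure lborel (A i) = emeasure (distr lborel borel ((+) (y i))) (A i)"
      by (simp only: lborel_distr_plus)
    also have "\<dots> = emeasure lborel ((\<lambda>z. y i + z) -` A i)"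
      using A[OF i] by (subst emeasure_distr) auto
    finally show "emeasure lborel ((\<lambda>z. y i + z) -` A i) = emeasure lborel (A i)" ..
  qed
  finally show "emeasure (distr (clebesgue K) (clebesgue K) (shift K y)) (Pi\<^sub>E K A)
      = (\<Prod>i\<in>K. emeasure lborel (A i))" .
qed simp

lemma nn_integral_shift:
  assumes "finite K" "f \<in> borel_measurable (clebesgue K)"
  shows "(\<integral>\<^sup>+x. f (shift K y x) \<partial>clebesgue K) = (\<integral>\<^sup>+x. f x \<partial>clebesgue K)"
  by (subst (2) distr_shift[OF assms(1), of y, symmetric]) (simp add: nn_integral_distr assms)

text \<open>Averaging over translates with Gaussian weight turns the integral of \<open>F\<close> along \<open>L\<close> into the
  integral of \<open>F\<close>: by Fubini only the translation invariance of Lebesgue measure and the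
  \<open>L\<close>-invariance of the weight matter, so no Jacobian is ever computed.\<close>

lemma gauss_isometry_invariant:
  assumes K: "finite K"
    and L [measurable]: "L \<in> clebesgue K \<rightarrow>\<^sub>M clebesgue K"
    and L': "\<And>y. y \<in> extensional K \<Longrightarrow> L' y \<in> extensional K \<and> L (L' y) = y"
    and add: "\<And>x y. x \<in> extensional K \<Longrightarrow> y \<in> extensional K \<Longrightarrow> L (shift K y x) = shift K (L y) (L x)"
    and norm: "\<And>x. x \<in> extensional K \<Longrightarrow> (\<Sum>i\<in>K. (cmod (L x i))\<^sup>2) = (\<Sum>i\<in>K. (cmod (x i))\<^sup>2)"
    and f [measurable]: "f \<in> borel_measurable (clebesgue K)"
  shows "(\<integral>\<^sup>+x. f (L x) \<partial>gauss K) = (\<integral>\<^sup>+x. f x \<partial>gauss K)"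
proof -
  interpret clebesgue_K: sigma_finite_measure "clebesgue K" by (rule clebesgue.sigma_finite[OF K])
  interpret pair: pair_sigma_finite "clebesgue K" "clebesgue K" ..
  have space: "x \<in> extensional K" if "x \<in> space (clebesgue K)" for x
    using that by (auto simp: space_PiM PiE_def)
  have Lx: "L x \<in> extensional K" if "x \<in> extensional K" for x
    using measurable_space[OF L, of x] that by (auto simp: space_PiM PiE_def)
  define e where "e x = ennreal (gauss_weight K x)" for x
  have e [measurable]: "e \<in> borel_measurable (clebesgue K)"
    unfolding e_def using K by measurable
  define neg where "neg x = (\<lambda>i\<in>K. - x i)" for x :: "'a \<Rightarrow> complex"
  have neg [measurable]: "neg \<in> clebesgue K \<rightarrow>\<^sub>M clebesgue K" unfolding neg_def by measurable
  have e_L: "e (L x) = e x" and e_neg: "e (neg x) = e x" if "x \<in> extensional K" for x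
    using norm[OF that] by (simp_all add: e_def gauss_weight_def neg_def)
  have e_int: "(\<integral>\<^sup>+x. e x \<partial>clebesgue K) = 1"
  proof -
    have "1 = (\<integral>\<^sup>+x. 1 \<partial>gauss K)"
      using prob_space.emeasure_space_1[OF prob_space_gauss[of K]] by simp
    also have "\<dots> = (\<integral>\<^sup>+x. e x \<partial>clebesgue K)"
      unfolding gauss_eq_density[OF K] e_def[symmetric] by (subst nn_integral_density) auto
    finally show ?thesis ..
  qed
  define F where "F x = e x * f x" for x
  have F [measurable]: "F \<in> borel_measurable (clebesgue K)" unfolding F_def by measurable
  have m1: "(\<lambda>(x, y). e y * F (shift K y (L x))) \<in> borel_measurable (clebesgue K \<Otimes>\<^sub>M clebesgue K)"
    by measurable
  have m2: "(\<lambda>(x, y). e (shift K (neg (L x)) y) * F y) \<in> borel_measurable (clebesgue K \<Otimes>\<^sub>M clebesgue K)"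
    by measurable
  \<comment> \<open>insert the total mass of the Gaussian in a second variable, and translate by it\<close>
  have "(\<integral>\<^sup>+x. f (L x) \<partial>gauss K) = (\<integral>\<^sup>+x. F (L x) \<partial>clebesgue K)"
    unfolding gauss_eq_density[OF K] e_def[symmetric] F_def
    by (subst nn_integral_density) (auto intro!: nn_integral_cong simp: e_L space)
  also have "\<dots> = (\<integral>\<^sup>+y. e y * (\<integral>\<^sup>+x. F (L x) \<partial>clebesgue K) \<partial>clebesgue K)"
    by (subst nn_integral_multc) (simp_all add: e_int)
  also have "\<dots> = (\<integral>\<^sup>+y. \<integral>\<^sup>+x. e y * F (shift K y (L x)) \<partial>clebesgue K \<partial>clebesgue K)"
  proof (rule nn_integral_cong)
    fix y assume "y \<in> space (clebesgue K)"
    note y = space[OF this]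
    have "(\<integral>\<^sup>+x. F (L x) \<partial>clebesgue K) = (\<integral>\<^sup>+x. F (L (shift K (L' y) x)) \<partial>clebesgue K)"
      by (rule nn_integral_shift[OF K, symmetric]) measurable
    also have "\<dots> = (\<integral>\<^sup>+x. F (shift K y (L x)) \<partial>clebesgue K)"
      by (intro nn_integral_cong) (use L'[OF y] in \<open>simp add: add space\<close>)
    finally show "e y * (\<integral>\<^sup>+x. F (L x) \<partial>clebesgue K) = (\<integral>\<^sup>+x. e y * F (shift K y (L x)) \<partial>clebesgue K)"
      by (subst nn_integral_cmult) auto
  qed
  also have "\<dots> = (\<integral>\<^sup>+x. \<integral>\<^sup>+y. e y * F (shift K y (L x)) \<partial>clebesgue K \<partial>clebesgue K)"
    by (rule pair.Fubini'[OF m1])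
  also have "\<dots> = (\<integral>\<^sup>+x. \<integral>\<^sup>+y. e (shift K (neg (L x)) y) * F y \<partial>clebesgue K \<partial>clebesgue K)"
  proof (rule nn_integral_cong)
    fix x assume "x \<in> space (clebesgue K)"
    have "(\<integral>\<^sup>+y. e y * F (shift K y (L x)) \<partial>clebesgue K) = (\<integral>\<^sup>+y. e y * F (shift K (L x) y) \<partial>clebesgue K)"
      by (simp add: shift_def add.commute)
    also have "\<dots> = (\<integral>\<^sup>+y. e (shift K (neg (L x)) y) * F (shift K (L x) (shift K (neg (L x)) y)) \<partial>clebesgue K)"
      by (rule nn_integral_shift[OF K, symmetric]) measurable
    also have "\<dots> = (\<integral>\<^sup>+y. e (shift K (neg (L x)) y) * F y \<partial>clebesgue K)"
    proof (rule nn_integral_cong)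
      fix y assume "y \<in> space (clebesgue K)"
      then have "shift K (L x) (shift K (neg (L x)) y) = y"
        using space by (intro extensionalityI[of _ K]) (auto simp: shift_def neg_def)
      then show "e (shift K (neg (L x)) y) * F (shift K (L x) (shift K (neg (L x)) y))
          = e (shift K (neg (L x)) y) * F y" by simp
    qed
    finally show "(\<integral>\<^sup>+y. e y * F (shift K y (L x)) \<partial>clebesgue K)
        = (\<integral>\<^sup>+y. e (shift K (neg (L x)) y) * F y \<partial>clebesgue K)" .
  qed
  also have "\<dots> = (\<integral>\<^sup>+y. \<integral>\<^sup>+x. e (shift K (neg (L x)) y) * F y \<partial>clebesgue K \<partial>clebesgue K)"
    by (rule pair.Fubini'[OF m2, symmetric])
  also have "\<dots> = (\<integral>\<^sup>+y. F y \<partial>clebesgue K)"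
  proof (rule nn_integral_cong)
    fix y assume ysp: "y \<in> space (clebesgue K)"
    note y = space[OF this]
    have my: "(\<lambda>x. e (shift K (neg (L x)) y)) \<in> borel_measurable (clebesgue K)"
      by (rule measurable_compose[OF shift_measurable_raw[OF measurable_compose[OF L neg] measurable_const[OF ysp]] e])
    have "(\<integral>\<^sup>+x. e (shift K (neg (L x)) y) \<partial>clebesgue K)
        = (\<integral>\<^sup>+x. e (shift K (neg (L (shift K (L' y) x))) y) \<partial>clebesgue K)"
      by (rule nn_integral_shift[OF K my, symmetric])
    also have "\<dots> = (\<integral>\<^sup>+x. e x \<partial>clebesgue K)"
    proof (rule nn_integral_cong)
      fix x assume "x \<in> space (clebesgue K)"
      note x = space[OF this]
      have "shift K (neg (L (shift K (L' y) x))) y = neg (L x)"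
      proof -
        have "L (shift K (L' y) x) = shift K y (L x)" using L'[OF y] x by (simp add: add)
        then show ?thesis by (auto simp: shift_def neg_def)
      qed
      then show "e (shift K (neg (L (shift K (L' y) x))) y) = e x"
        using x by (simp add: e_neg e_L Lx)
    qed
    finally show "(\<integral>\<^sup>+x. e (shift K (neg (L x)) y) * F y \<partial>clebesgue K) = F y"
      by (subst nn_integral_multc[OF my]) (simp_all add: e_int)
  qed
  also have "\<dots> = (\<integral>\<^sup>+x. f x \<partial>gauss K)"
    unfolding gauss_eq_density[OF K] e_def[symmetric] F_def by (subst nn_integral_density) auto
  finally show ?thesis .
qed

lemma sum_orthonormal_norm:
  fixes u :: "'i \<Rightarrow> 'i \<Rightarrow> complex"
  assumes K: "finite K"
    and u: "\<And>b c. b \<in> K \<Longrightarrow> c \<in> K \<Longrightarrow> (\<Sum>a\<in>K. u a b * cnj (u a c)) = (if b = c then 1 else 0)"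
  shows "(\<Sum>a\<in>K. (cmod (\<Sum>b\<in>K. u a b * x b))\<^sup>2) = (\<Sum>b\<in>K. (cmod (x b))\<^sup>2)"
proof -
  have "complex_of_real (\<Sum>a\<in>K. (cmod (\<Sum>b\<in>K. u a b * x b))\<^sup>2)
      = (\<Sum>a\<in>K. (\<Sum>b\<in>K. u a b * x b) * (\<Sum>c\<in>K. cnj (u a c) * cnj (x c)))"
    by (simp only: of_real_sum complex_norm_square cnj_sum complex_cnj_mult)
  also have "\<dots> = (\<Sum>a\<in>K. \<Sum>b\<in>K. \<Sum>c\<in>K. (x b * cnj (x c)) * (u a b * cnj (u a c)))"
    by (simp add: sum_product mult_ac)
  also have "\<dots> = (\<Sum>b\<in>K. \<Sum>c\<in>K. \<Sum>a\<in>K. (x b * cnj (x c)) * (u a b * cnj (u a c)))"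
    by (subst sum.swap) (intro sum.cong refl sum.swap)
  also have "\<dots> = (\<Sum>b\<in>K. \<Sum>c\<in>K. (x b * cnj (x c)) * (if b = c then 1 else 0))"
    by (intro sum.cong refl) (simp only: sum_distrib_left[symmetric] u)
  also have "\<dots> = complex_of_real (\<Sum>b\<in>K. (cmod (x b))\<^sup>2)"
    using K by (simp add: if_distrib sum.delta complex_norm_square[symmetric] del: of_real_power cong: if_cong)
  finally show ?thesis by (simp only: of_real_eq_iff)
qed

text \<open>The columns being orthonormal makes the map an isometry; the rows being orthonormal makes it
  surjective.\<close>

lemma gauss_unitary_invariant:
  fixes u :: "'i \<Rightarrow> 'i \<Rightarrow> complex"
  assumes K: "finite K"
    and col: "\<And>b c. b \<in> K \<Longrightarrow> c \<in> K \<Longrightarrow> (\<Sum>a\<in>K. u a b * cnj (u a c)) = (if b = c then 1 else 0)"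
    and row: "\<And>a c. a \<in> K \<Longrightarrow> c \<in> K \<Longrightarrow> (\<Sum>b\<in>K. u a b * cnj (u c b)) = (if a = c then 1 else 0)"
    and f: "f \<in> borel_measurable (clebesgue K)"
  shows "(\<integral>\<^sup>+x. f (\<lambda>a\<in>K. \<Sum>b\<in>K. u a b * x b) \<partial>gauss K) = (\<integral>\<^sup>+x. f x \<partial>gauss K)"
proof (rule gauss_isometry_invariant[where L = "\<lambda>x. \<lambda>a\<in>K. \<Sum>b\<in>K. u a b * x b"
      and L' = "\<lambda>y. \<lambda>b\<in>K. \<Sum>c\<in>K. cnj (u c b) * y c", OF K _ _ _ _ f])
  show "(\<lambda>x. \<lambda>a\<in>K. \<Sum>b\<in>K. u a b * x b) \<in> clebesgue K \<rightarrow>\<^sub>M clebesgue K"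
    by measurable
  fix y :: "'i \<Rightarrow> complex" assume y: "y \<in> extensional K"
  have "(\<Sum>b\<in>K. u a b * (\<Sum>c\<in>K. cnj (u c b) * y c)) = y a" if a: "a \<in> K" for a
  proof -
    have "(\<Sum>b\<in>K. u a b * (\<Sum>c\<in>K. cnj (u c b) * y c)) = (\<Sum>b\<in>K. \<Sum>c\<in>K. y c * (u a b * cnj (u c b)))"
      by (simp add: sum_distrib_left mult_ac)
    also have "\<dots> = (\<Sum>c\<in>K. y c * (\<Sum>b\<in>K. u a b * cnj (u c b)))"
      by (subst sum.swap) (simp only: sum_distrib_left)
    also have "\<dots> = (\<Sum>c\<in>K. y c * (if a = c then 1 else 0))"
      using a by (intro sum.cong refl) (simp only: row)
    also have "\<dots> = y a" using a K by (simp add: if_distrib sum.delta cong: if_cong)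
    finally show ?thesis .
  qed
  then show "(\<lambda>b\<in>K. \<Sum>c\<in>K. cnj (u c b) * y c) \<in> extensional K \<and>
      (\<lambda>a\<in>K. \<Sum>b\<in>K. u a b * (\<lambda>b\<in>K. \<Sum>c\<in>K. cnj (u c b) * y c) b) = y"
    using y by (auto intro!: extensionalityI[of _ K])
next
  fix x y :: "'i \<Rightarrow> complex"
  show "(\<lambda>a\<in>K. \<Sum>b\<in>K. u a b * shift K y x b)
      = shift K (\<lambda>a\<in>K. \<Sum>b\<in>K. u a b * y b) (\<lambda>a\<in>K. \<Sum>b\<in>K. u a b * x b)"
    by (auto simp: shift_def distrib_left sum.distrib)
next
  fix x :: "'i \<Rightarrow> complex"
  show "(\<Sum>i\<in>K. (cmod ((\<lambda>a\<in>K. \<Sum>b\<in>K. u a b * x b) i))\<^sup>2) = (\<Sum>i\<in>K. (cmod (x i))\<^sup>2)"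
    using sum_orthonormal_norm[OF K col] by simp
qed

lemma unitary_mat_cols:
  assumes U: "unitary_mat n U" and ij: "i < n" "j < n"
  shows "(\<Sum>a<n. U $$ (a, i) * cnj (U $$ (a, j))) = (if i = j then 1 else 0)"
proof -
  note U' = unitary_matD[OF U]
  have "(mat_adjoint U * U) $$ (j, i) = (\<Sum>a<n. cnj (U $$ (a, j)) * U $$ (a, i))"
    using U'(1) ij by (simp add: scalar_prod_def atLeast0LessThan)
  then have "(\<Sum>a<n. U $$ (a, i) * cnj (U $$ (a, j))) = (1\<^sub>m n :: complex mat) $$ (j, i)"
    unfolding U'(2) by (simp add: mult.commute)
  then show ?thesis using ij by auto
qed

lemma unitary_mat_rows:
  assumes U: "unitary_mat n U" and ij: "i < n" "j < n"
  shows "(\<Sum>a<n. U $$ (i, a) * cnj (U $$ (j, a))) = (if i = j then 1 else 0)"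
proof -
  note U' = unitary_matD[OF U]
  have "(U * mat_adjoint U) $$ (i, j) = (\<Sum>a<n. U $$ (i, a) * cnj (U $$ (j, a)))"
    using U'(1) ij by (simp add: scalar_prod_def atLeast0LessThan)
  then show ?thesis using U'(3) ij by simp
qed

lemma gauss_vec_unitary:
  assumes U: "unitary_mat n U" and f: "f \<in> borel_measurable (clebesgue {..<n})"
  shows "(\<integral>\<^sup>+x. f (\<lambda>i\<in>{..<n}. \<Sum>j<n. U $$ (i, j) * x j) \<partial>gauss {..<n}) = (\<integral>\<^sup>+x. f x \<partial>gauss {..<n})"
  by (rule gauss_unitary_invariant) (use unitary_mat_cols[OF U] unitary_mat_rows[OF U] f in auto)

lemma sum_Times: "sum g (A \<times> B) = (\<Sum>a\<in>A. \<Sum>b\<in>B. g (a, b))"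
  by (simp add: sum.cartesian_product)

lemma gauss_left_unitary:
  assumes U: "unitary_mat n U" and J: "finite J" and f: "f \<in> borel_measurable (clebesgue ({..<n} \<times> J))"
  shows "(\<integral>\<^sup>+x. f (\<lambda>(i, a)\<in>{..<n} \<times> J. \<Sum>j<n. U $$ (i, j) * x (j, a)) \<partial>gauss ({..<n} \<times> J))
       = (\<integral>\<^sup>+x. f x \<partial>gauss ({..<n} \<times> J))"
proof -
  define u where "u p q = (if snd p = snd q then U $$ (fst p, fst q) else 0)" for p q :: "nat \<times> 'a"
  let ?K = "{..<n} \<times> J"
  have Lu: "(\<lambda>(i, a)\<in>?K. \<Sum>j<n. U $$ (i, j) * x (j, a)) = (\<lambda>p\<in>?K. \<Sum>q\<in>?K. u p q * x q)" for x
  proof (rule restrict_ext)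
    fix p assume "p \<in> ?K"
    then obtain i a where p: "p = (i, a)" and "i \<in> {..<n}" "a \<in> J" by auto
    then have "(\<Sum>q\<in>?K. u (i, a) q * x q) = (\<Sum>j<n. \<Sum>b\<in>J. if a = b then U $$ (i, j) * x (j, b) else 0)"
      unfolding sum_Times by (auto simp: u_def intro!: sum.cong)
    then show "(case p of (i, a) \<Rightarrow> \<Sum>j<n. U $$ (i, j) * x (j, a)) = (\<Sum>q\<in>?K. u p q * x q)"
      using J \<open>a \<in> J\<close> by (simp add: p)
  qed
  have "(\<Sum>p\<in>?K. u p q * cnj (u p r)) = (if q = r then 1 else 0)" if "q \<in> ?K" "r \<in> ?K" for q r
  proof -
    have "(\<Sum>p\<in>?K. u p q * cnj (u p r))
        = (\<Sum>i<n. \<Sum>a\<in>J. if a = snd q then (if snd q = snd r then U $$ (i, fst q) * cnj (U $$ (i, fst r)) else 0) else 0)"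
      unfolding sum_Times by (auto simp: u_def intro!: sum.cong)
    also have "\<dots> = (if snd q = snd r then (\<Sum>i<n. U $$ (i, fst q) * cnj (U $$ (i, fst r))) else 0)"
      using J that by auto
    finally show ?thesis using unitary_mat_cols[OF U] that by (auto simp: prod_eq_iff)
  qed
  moreover have "(\<Sum>p\<in>?K. u q p * cnj (u r p)) = (if q = r then 1 else 0)" if "q \<in> ?K" "r \<in> ?K" for q r
  proof -
    have "(\<Sum>p\<in>?K. u q p * cnj (u r p))
        = (\<Sum>i<n. \<Sum>a\<in>J. if a = snd q then (if snd q = snd r then U $$ (fst q, i) * cnj (U $$ (fst r, i)) else 0) else 0)"
      unfolding sum_Times by (auto simp: u_def intro!: sum.cong)
    also have "\<dots> = (if snd q = snd r then (\<Sum>i<n. U $$ (fst q, i) * cnj (U $$ (fst r, i))) else 0)"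
      using J that by auto
    finally show ?thesis using unitary_mat_rows[OF U] that by (auto simp: prod_eq_iff)
  qed
  ultimately show ?thesis
    unfolding Lu using J f by (intro gauss_unitary_invariant) auto
qed

lemma gauss_right_unitary:
  assumes U: "unitary_mat n U" and J: "finite J" and f: "f \<in> borel_measurable (clebesgue (J \<times> {..<n}))"
  shows "(\<integral>\<^sup>+x. f (\<lambda>(a, i)\<in>J \<times> {..<n}. \<Sum>j<n. x (a, j) * U $$ (j, i)) \<partial>gauss (J \<times> {..<n}))
       = (\<integral>\<^sup>+x. f x \<partial>gauss (J \<times> {..<n}))"
proof -
  define u where "u p q = (if fst p = fst q then U $$ (snd q, snd p) else 0)" for p q :: "'a \<times> nat"
  let ?K = "J \<times> {..<n}"
  have Lu: "(\<lambda>(a, i)\<in>?K. \<Sum>j<n. x (a, j) * U $$ (j, i)) = (\<lambda>p\<in>?K. \<Sum>q\<in>?K. u p q * x q)" for x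
  proof (rule restrict_ext)
    fix p assume "p \<in> ?K"
    then obtain a i where p: "p = (a, i)" and "i \<in> {..<n}" "a \<in> J" by auto
    then have "(\<Sum>q\<in>?K. u (a, i) q * x q) = (\<Sum>b\<in>J. if a = b then (\<Sum>j<n. x (b, j) * U $$ (j, i)) else 0)"
      unfolding sum_Times by (auto simp: u_def mult.commute intro!: sum.cong)
    then show "(case p of (a, i) \<Rightarrow> \<Sum>j<n. x (a, j) * U $$ (j, i)) = (\<Sum>q\<in>?K. u p q * x q)"
      using J \<open>a \<in> J\<close> by (simp add: p)
  qed
  have "(\<Sum>p\<in>?K. u p q * cnj (u p r)) = (if q = r then 1 else 0)" if "q \<in> ?K" "r \<in> ?K" for q r
  proof -
    have "(\<Sum>p\<in>?K. u p q * cnj (u p r))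
        = (\<Sum>a\<in>J. if a = fst q then (if fst q = fst r then (\<Sum>i<n. U $$ (snd q, i) * cnj (U $$ (snd r, i))) else 0) else 0)"
      unfolding sum_Times by (auto simp: u_def intro!: sum.cong sum.neutral)
    also have "\<dots> = (if fst q = fst r then (\<Sum>i<n. U $$ (snd q, i) * cnj (U $$ (snd r, i))) else 0)"
      using J that by auto
    finally show ?thesis using unitary_mat_rows[OF U] that by (auto simp: prod_eq_iff)
  qed
  moreover have "(\<Sum>p\<in>?K. u q p * cnj (u r p)) = (if q = r then 1 else 0)" if "q \<in> ?K" "r \<in> ?K" for q r
  proof -
    have "(\<Sum>p\<in>?K. u q p * cnj (u r p))
        = (\<Sum>a\<in>J. if a = fst q then (if fst q = fst r then (\<Sum>i<n. U $$ (i, snd q) * cnj (U $$ (i, snd r))) else 0) else 0)"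
      unfolding sum_Times by (auto simp: u_def intro!: sum.cong sum.neutral)
    also have "\<dots> = (if fst q = fst r then (\<Sum>i<n. U $$ (i, snd q) * cnj (U $$ (i, snd r))) else 0)"
      using J that by auto
    finally show ?thesis using unitary_mat_cols[OF U] that by (auto simp: prod_eq_iff)
  qed
  ultimately show ?thesis
    unfolding Lu using J f by (intro gauss_unitary_invariant) auto
qed

section \<open>Gaussian integrals of quadratic forms\<close>

text \<open>The weighted Gram matrix \<open>X\<^sup>* diag(w) X\<close> of the matrix \<open>X\<close> with rows \<open>z c\<close>, \<open>c \<in> C\<close>.\<close>

definition gram_mat :: "nat \<Rightarrow> 'c set \<Rightarrow> ('c \<Rightarrow> real) \<Rightarrow> ('c \<Rightarrow> nat \<Rightarrow> complex) \<Rightarrow> complex mat" where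
  "gram_mat k C w z = Matrix.mat k k (\<lambda>(a, b). \<Sum>c\<in>C. of_real (w c) * cnj (z c a) * z c b)"

lemma gram_mat_carrier [simp]: "gram_mat k C w z \<in> carrier_mat k k"
  by (simp add: gram_mat_def)

lemma gram_mat_form:
  assumes C: "finite C"
  shows "(gram_mat k C w z *\<^sub>v vec k x) \<bullet>c vec k x
       = of_real (\<Sum>c\<in>C. w c * (cmod (\<Sum>b<k. x b * z c b))\<^sup>2)"
proof -
  have "(gram_mat k C w z *\<^sub>v vec k x) \<bullet>c vec k x
      = (\<Sum>a<k. \<Sum>b<k. \<Sum>c\<in>C. of_real (w c) * (cnj (x a * z c a) * (x b * z c b)))"
    by (simp add: gram_mat_def scalar_prod_def atLeast0LessThan sum_distrib_right sum_distrib_left mult_ac)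
  also have "\<dots> = (\<Sum>a<k. \<Sum>c\<in>C. \<Sum>b<k. of_real (w c) * (cnj (x a * z c a) * (x b * z c b)))"
    by (intro sum.cong refl sum.swap)
  also have "\<dots> = (\<Sum>c\<in>C. \<Sum>a<k. \<Sum>b<k. of_real (w c) * (cnj (x a * z c a) * (x b * z c b)))"
    by (rule sum.swap)
  also have "\<dots> = (\<Sum>c\<in>C. of_real (w c) * (cnj (\<Sum>a<k. x a * z c a) * (\<Sum>b<k. x b * z c b)))"
    unfolding cnj_sum sum_product by (simp only: sum_distrib_left)
  also have "\<dots> = (\<Sum>c\<in>C. of_real (w c * (cmod (\<Sum>b<k. x b * z c b))\<^sup>2))"
    by (simp only: cnj_times_self of_real_mult of_real_power)
  finally show ?thesis by (simp only: of_real_sum)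
qed

lemma gram_mat_psd:
  assumes C: "finite C" and w: "\<And>c. c \<in> C \<Longrightarrow> 0 \<le> w c"
  shows "positive_semidefinite_mat k (gram_mat k C w z)"
  unfolding positive_semidefinite_mat_def hermitian_mat_def
proof (intro conjI ballI)
  show "mat_adjoint (gram_mat k C w z) = gram_mat k C w z"
    by (rule eq_matI) (auto simp: gram_mat_def mult_ac)
  fix v :: "complex vec" assume "v \<in> carrier_vec k"
  then have "v = vec k (\<lambda>i. v $ i)" by auto
  then show "0 \<le> Re ((gram_mat k C w z *\<^sub>v v) \<bullet>c v)"
    using gram_mat_form[OF C, of k w z "\<lambda>i. v $ i"] w by (auto intro!: sum_nonneg)
qed simp

lemma psd_det_one_plus:
  assumes "positive_semidefinite_mat k W"
  obtains \<rho> where "\<And>i. i < k \<Longrightarrow> 0 \<le> (\<rho> i :: real)"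
    "\<And>t. Determinant.det (1\<^sub>m k + of_real t \<cdot>\<^sub>m W) = of_real (\<Prod>i<k. 1 + t * \<rho> i)"
    "Determinant.det W = of_real (\<Prod>i<k. \<rho> i)"
proof -
  obtain U \<rho> where U: "unitary_mat k U" and W: "W = eigen_mat k U (\<lambda>i. complex_of_real (\<rho> i))"
    and \<rho>: "\<And>i. i < k \<Longrightarrow> 0 \<le> \<rho> i" using psd_spectral[OF assms] by metis
  have one: "eigen_mat k U (\<lambda>_. 1) = 1\<^sub>m k"
    unfolding eigen_mat_const[OF U] by (rule eq_matI) auto
  have "Determinant.det (1\<^sub>m k + of_real t \<cdot>\<^sub>m W) = of_real (\<Prod>i<k. 1 + t * \<rho> i)" for t
  proof -
    have "1\<^sub>m k + of_real t \<cdot>\<^sub>m W = eigen_mat k U (\<lambda>i. 1 + of_real t * of_real (\<rho> i))"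
      by (simp add: W eigen_mat_smult[OF U] eigen_mat_add[OF U, of "\<lambda>_. 1", symmetric] one)
    then show ?thesis by (simp add: det_eigen_mat[OF U])
  qed
  moreover have "Determinant.det W = of_real (\<Prod>i<k. \<rho> i)" by (simp add: W det_eigen_mat[OF U])
  ultimately show thesis using \<rho> that by blast
qed

text \<open>In the eigenbasis of the Gram matrix the exponent is a sum over independent coordinates, each of
  which contributes \<open>1 / (1 + \<rho>)\<close> for its eigenvalue \<open>\<rho>\<close>.\<close>

lemma gauss_exp_quadratic:
  assumes C: "finite C" and w: "\<And>c. c \<in> C \<Longrightarrow> 0 \<le> w c"
  shows "(\<integral>\<^sup>+x. ennreal (exp (- (\<Sum>c\<in>C. w c * (cmod (\<Sum>b<k. x b * z c b))\<^sup>2))) \<partial>gauss {..<k})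
       = ennreal (1 / Re (Determinant.det (1\<^sub>m k + gram_mat k C w z)))"
proof -
  let ?W = "gram_mat k C w z"
  obtain U \<rho> where U: "unitary_mat k U" and W: "?W = eigen_mat k U (\<lambda>i. complex_of_real (\<rho> i))"
    and \<rho>: "\<And>i. i < k \<Longrightarrow> 0 \<le> \<rho> i"
    using psd_spectral[OF gram_mat_psd[where k = k and z = z and w = w, OF C w]] by metis
  note U' = unitary_matD[OF U]
  define f where "f y = ennreal (exp (- (\<Sum>i<k. \<rho> i * (cmod (y i))\<^sup>2)))" for y :: "nat \<Rightarrow> complex"
  have f: "f \<in> borel_measurable (clebesgue {..<k})" unfolding f_def by measurable
  have form: "(\<Sum>c\<in>C. w c * (cmod (\<Sum>b<k. x b * z c b))\<^sup>2)
      = (\<Sum>i<k. \<rho> i * (cmod (\<Sum>j<k. mat_adjoint U $$ (i, j) * x j))\<^sup>2)" for x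
  proof -
    have "complex_of_real (\<Sum>c\<in>C. w c * (cmod (\<Sum>b<k. x b * z c b))\<^sup>2) = (?W *\<^sub>v vec k x) \<bullet>c vec k x"
      by (rule gram_mat_form[OF C, symmetric])
    also have "\<dots> = complex_of_real (\<Sum>i<k. \<rho> i * (cmod ((mat_adjoint U *\<^sub>v vec k x) $ i))\<^sup>2)"
      unfolding W by (subst eigen_mat_form[OF U]) auto
    finally have "(\<Sum>c\<in>C. w c * (cmod (\<Sum>b<k. x b * z c b))\<^sup>2)
        = (\<Sum>i<k. \<rho> i * (cmod ((mat_adjoint U *\<^sub>v vec k x) $ i))\<^sup>2)"
      by (simp only: of_real_eq_iff)
    then show ?thesis using U'(1) by (simp add: scalar_prod_def atLeast0LessThan)
  qed
  have "(\<integral>\<^sup>+x. ennreal (exp (- (\<Sum>c\<in>C. w c * (cmod (\<Sum>b<k. x b * z c b))\<^sup>2))) \<partial>gauss {..<k})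
      = (\<integral>\<^sup>+x. f (\<lambda>i\<in>{..<k}. \<Sum>j<k. mat_adjoint U $$ (i, j) * x j) \<partial>gauss {..<k})"
    by (simp add: f_def form)
  also have "\<dots> = (\<integral>\<^sup>+x. f x \<partial>gauss {..<k})"
    by (rule gauss_vec_unitary[OF unitary_mat_adjoint[OF U] f])
  also have "\<dots> = (\<integral>\<^sup>+x. (\<Prod>i<k. ennreal (exp (- \<rho> i * (cmod (x i))\<^sup>2))) \<partial>gauss {..<k})"
    by (simp add: f_def exp_sum prod_ennreal sum_negf[symmetric])
  also have "\<dots> = (\<Prod>i<k. \<integral>\<^sup>+z. ennreal (exp (- \<rho> i * (cmod z)\<^sup>2)) \<partial>cgauss)"
    by (rule gauss.product_nn_integral_prod) auto
  also have "\<dots> = (\<Prod>i<k. ennreal (1 / (1 + \<rho> i)))"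
    using \<rho> by (intro prod.cong refl nn_integral_cgauss_exp) auto
  also have "\<dots> = ennreal (1 / (\<Prod>i<k. 1 + \<rho> i))"
    using \<rho> by (subst prod_ennreal) (auto simp: prod_dividef)
  also have "(\<Prod>i<k. 1 + \<rho> i) = Re (Determinant.det (1\<^sub>m k + ?W))"
  proof -
    have one: "eigen_mat k U (\<lambda>_. 1) = 1\<^sub>m k"
      unfolding eigen_mat_const[OF U] by (rule eq_matI) auto
    have "1\<^sub>m k + ?W = eigen_mat k U (\<lambda>i. complex_of_real (1 + \<rho> i))"
      by (simp add: W eigen_mat_add[OF U, of "\<lambda>_. 1", symmetric] one)
    then show ?thesis by (simp only: det_eigen_mat[OF U] of_real_prod[symmetric] Re_complex_of_real)
  qed
  finally show ?thesis .
qed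

section \<open>Vandermonde determinants as interpolation weights\<close>

definition vandermonde_det :: "nat \<Rightarrow> (nat \<Rightarrow> real) \<Rightarrow> real" where
  "vandermonde_det d \<eta> = Determinant.det (Matrix.mat d d (\<lambda>(i, j). \<eta> j ^ i))"

text \<open>The change of basis from powers to monic polynomials is triangular with unit diagonal.\<close>

lemma det_monic_polys_eq_vandermonde:
  assumes q: "\<And>i. i < d \<Longrightarrow> degree (q i) = i" "\<And>i. i < d \<Longrightarrow> coeff (q i) i = 1"
  shows "Determinant.det (Matrix.mat d d (\<lambda>(i, j). poly (q i) (\<eta> j))) = vandermonde_det d \<eta>"
proof -
  define L where "L = Matrix.mat d d (\<lambda>(i, l). coeff (q i) l)"
  define V where "V = Matrix.mat d d (\<lambda>(i, j). \<eta> j ^ i)"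
  have L: "L \<in> carrier_mat d d" and V: "V \<in> carrier_mat d d" by (auto simp: L_def V_def)
  have "Matrix.mat d d (\<lambda>(i, j). poly (q i) (\<eta> j)) = L * V"
  proof (rule eq_matI, goal_cases)
    case (1 i j)
    then have i: "i < d" and j: "j < d" by (auto simp: L_def V_def)
    have "poly (q i) (\<eta> j) = (\<Sum>l\<le>i. coeff (q i) l * \<eta> j ^ l)"
      using poly_altdef[of "q i" "\<eta> j"] q(1)[OF i] by simp
    also have "\<dots> = (\<Sum>l<d. coeff (q i) l * \<eta> j ^ l)"
      using i q(1)[OF i] by (intro sum.mono_neutral_left) (auto simp: coeff_eq_0)
    finally show ?case using i j by (simp add: L_def V_def scalar_prod_def atLeast0LessThan)
  qed (auto simp: L_def V_def)
  moreover have "Determinant.det L = 1"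
  proof -
    have "Determinant.det L = prod_list (diag_mat L)"
      by (rule det_lower_triangular[OF _ L]) (use q(1) in \<open>auto simp: L_def coeff_eq_0\<close>)
    also have "diag_mat L = map (\<lambda>_. 1) [0..<d]"
      using q(2) by (auto simp: diag_mat_def L_def)
    also have "prod_list (map (\<lambda>_. 1::real) [0..<d]) = 1" by (induction d) auto
    finally show ?thesis .
  qed
  ultimately show ?thesis using det_mult[OF L V] by (simp add: vandermonde_det_def V_def)
qed

lemma vandermonde_det_eq: "vandermonde_det d \<eta> = (\<Prod>j<d. \<Prod>i<j. \<eta> j - \<eta> i)"
proof -
  define q where "q i = (\<Prod>l<i. [:- \<eta> l, 1:])" for i
  have deg: "degree (q i) = i" and lead: "coeff (q i) i = 1" for i
  proof -
    show d: "degree (q i) = i" unfolding q_def by (subst degree_prod_eq_sum_degree) auto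
    have "lead_coeff (q i) = 1" unfolding q_def by (simp add: lead_coeff_prod)
    then show "coeff (q i) i = 1" by (simp add: d)
  qed
  define A where "A = Matrix.mat d d (\<lambda>(i, j). poly (q i) (\<eta> j))"
  have "vandermonde_det d \<eta> = Determinant.det A"
    unfolding A_def by (rule det_monic_polys_eq_vandermonde[symmetric]) (auto simp: deg lead)
  also have "\<dots> = prod_list (diag_mat A)"
    by (rule det_upper_triangular[of _ d]) (auto simp: A_def q_def poly_prod intro!: upper_triangularI)
  also have "diag_mat A = map (\<lambda>j. \<Prod>i<j. \<eta> j - \<eta> i) [0..<d]"
    by (auto simp: diag_mat_def A_def q_def poly_prod)
  also have "prod_list \<dots> = (\<Prod>j<d. \<Prod>i<j. \<eta> j - \<eta> i)"
    by (induction d) (auto simp: mult.commute)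
  finally show ?thesis .
qed

lemma vandermonde_det_nonzero: "inj_on \<eta> {..<d} \<Longrightarrow> vandermonde_det d \<eta> \<noteq> 0"
  unfolding vandermonde_det_eq
  by (auto simp: prod_zero_iff) (metis inj_onD lessThan_iff less_irrefl less_trans)

definition vandermonde_weight :: "nat \<Rightarrow> (nat \<Rightarrow> real) \<Rightarrow> (nat \<Rightarrow> nat) \<Rightarrow> real" where
  "vandermonde_weight d \<eta> \<sigma> = of_int (sign \<sigma>) * (\<Prod>j<d. \<eta> j ^ \<sigma> j) / vandermonde_det d \<eta>"

lemma det_by_columns:
  fixes A :: "real mat"
  assumes "A \<in> carrier_mat d d"
  shows "Determinant.det A = (\<Sum>\<sigma> | \<sigma> permutes {..<d}. of_int (sign \<sigma>) * (\<Prod>j<d. A $$ (\<sigma> j, j)))"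
proof -
  have "Determinant.det A = Determinant.det (transpose_mat A)" using det_transpose[OF assms] by simp
  also have "\<dots> = (\<Sum>\<sigma> | \<sigma> permutes {..<d}. of_int (sign \<sigma>) * (\<Prod>j<d. A $$ (\<sigma> j, j)))"
    using assms by (subst det_def'[of _ d])
      (auto simp: atLeast0LessThan permutes_in_image intro!: sum.cong prod.cong)
  finally show ?thesis .
qed

text \<open>Both sides come from the determinant of the matrix with the rows \<open>\<phi>(\<eta>) \<eta>\<^sup>i\<close> for \<open>i < k\<close> and \<open>\<eta>\<^sup>i\<close> for
  \<open>i \<ge> k\<close>. Since \<open>\<eta>\<^sup>k = \<phi>(\<eta>) q(\<eta>)\<close> with \<open>q = \<Prod>a<k. (x + \<rho> a)\<close> monic of degree \<open>k\<close>, a factor \<open>\<phi>(\<eta>)\<close>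
  can be taken out of every column; row \<open>i\<close> then consists of values of a monic polynomial of degree
  \<open>i\<close>, and the Vandermonde determinant remains. Expanding over permutations instead gives the sum.
  The weights do not involve \<open>\<rho>\<close>, so the identity can be averaged over random \<open>\<rho>\<close>.\<close>

lemma interpolation_identity:
  fixes \<eta> \<rho> :: "nat \<Rightarrow> real"
  assumes inj: "inj_on \<eta> {..<d}" and pos: "\<And>i. i < d \<Longrightarrow> 0 < \<eta> i" and \<rho>: "\<And>a. a < k \<Longrightarrow> 0 \<le> \<rho> a"
  defines "\<phi> \<equiv> \<lambda>i. 1 / (\<Prod>a<k. 1 + \<rho> a / \<eta> i)"
  shows "(\<Prod>i<d. \<phi> i) = (\<Sum>\<sigma> | \<sigma> permutes {..<d}. vandermonde_weight d \<eta> \<sigma> * (\<Prod>i<d. if \<sigma> i < k then \<phi> i else 1))"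
proof -
  define q where "q = (\<Prod>a<k. [:\<rho> a, 1:])"
  have q: "degree q = k" "lead_coeff q = 1"
    unfolding q_def by (subst degree_prod_eq_sum_degree, auto simp: lead_coeff_prod)
  have poly_q: "poly q x = (\<Prod>a<k. x + \<rho> a)" for x
    by (simp add: q_def poly_prod add.commute)
  have \<phi>q: "\<eta> i ^ k = \<phi> i * poly q (\<eta> i)" and \<phi>0: "\<phi> i \<noteq> 0" if i: "i < d" for i
  proof -
    define P where "P = (\<Prod>a<k. 1 + \<rho> a / \<eta> i)"
    have nz: "P > 0"
      unfolding P_def using pos[OF i] \<rho> by (intro prod_pos) (auto intro!: add_pos_nonneg)
    have "poly q (\<eta> i) = (\<Prod>a<k. \<eta> i * (1 + \<rho> a / \<eta> i))"
      unfolding poly_q using pos[OF i] by (intro prod.cong refl) (simp add: field_simps)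
    also have "\<dots> = \<eta> i ^ k * P" by (simp add: prod.distrib P_def)
    finally show "\<eta> i ^ k = \<phi> i * poly q (\<eta> i)" using nz by (simp add: \<phi>_def P_def[symmetric])
    show "\<phi> i \<noteq> 0" using nz by (simp add: \<phi>_def P_def[symmetric])
  qed
  \<comment> \<open>the monic polynomials left in the rows once \<open>\<phi>\<close> has been taken out of the columns\<close>
  define r where "r i = (if i < k then monom 1 i else monom 1 (i - k) * q)" for i
  have r: "degree (r i) = i" "coeff (r i) i = 1" for i
  proof -
    have q0: "q \<noteq> 0" using q(2) by auto
    show d: "degree (r i) = i"
      using q q0 by (auto simp: r_def degree_monom_eq degree_mult_eq monom_eq_0_iff)
    have "lead_coeff (r i) = 1" using q by (auto simp: r_def lead_coeff_mult degree_monom_eq)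
    then show "coeff (r i) i = 1" by (simp add: d)
  qed
  define A where "A = Matrix.mat d d (\<lambda>(i, j). (if i < k then \<phi> j else 1) * \<eta> j ^ i)"
  have "A = Matrix.mat d d (\<lambda>(i, j). poly (r i) (\<eta> j)) * mat_diag d \<phi>"
  proof (subst mat_diag_mult_right[of _ d], simp, rule eq_matI, goal_cases)
    case (1 i j)
    then have ij: "i < d" "j < d" by auto
    show ?case
    proof (cases "i < k")
      case False
      then have "\<eta> j ^ i = \<eta> j ^ (i - k) * \<eta> j ^ k" by (simp flip: power_add)
      then show ?thesis using False ij \<phi>q[OF ij(2)] by (simp add: A_def r_def poly_monom)
    qed (use ij in \<open>simp add: A_def r_def poly_monom\<close>)
  qed (auto simp: A_def)
  then have "Determinant.det A = vandermonde_det d \<eta> * Determinant.det (mat_diag d \<phi>)"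
    using det_mult[of "Matrix.mat d d (\<lambda>(i, j). poly (r i) (\<eta> j))" d "mat_diag d \<phi>"]
      det_monic_polys_eq_vandermonde[of d r \<eta>] r by simp
  also have "Determinant.det (mat_diag d \<phi>) = (\<Prod>i<d. \<phi> i)"
    by (subst det_upper_triangular[of _ d])
       (auto simp: mat_diag_def diag_mat_def prod.list_conv_set_nth atLeast0LessThan)
  finally have det: "Determinant.det A = vandermonde_det d \<eta> * (\<Prod>i<d. \<phi> i)" .
  have "Determinant.det A = (\<Sum>\<sigma> | \<sigma> permutes {..<d}. of_int (sign \<sigma>) * (\<Prod>j<d. A $$ (\<sigma> j, j)))"
    by (rule det_by_columns) (simp add: A_def)
  also have "\<dots> = (\<Sum>\<sigma> | \<sigma> permutes {..<d}. of_int (sign \<sigma>) * (\<Prod>j<d. \<eta> j ^ \<sigma> j) * (\<Prod>i<d. if \<sigma> i < k then \<phi> i else 1))"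
  proof (intro sum.cong refl)
    fix \<sigma> assume "\<sigma> \<in> {\<sigma>. \<sigma> permutes {..<d}}"
    then have "(\<Prod>j<d. A $$ (\<sigma> j, j)) = (\<Prod>j<d. (if \<sigma> j < k then \<phi> j else 1) * \<eta> j ^ \<sigma> j)"
      by (intro prod.cong refl) (auto simp: A_def permutes_in_image[of \<sigma> "{..<d}", simplified])
    then show "of_int (sign \<sigma>) * (\<Prod>j<d. A $$ (\<sigma> j, j))
        = of_int (sign \<sigma>) * (\<Prod>j<d. \<eta> j ^ \<sigma> j) * (\<Prod>i<d. if \<sigma> i < k then \<phi> i else 1)"
      by (simp add: prod.distrib mult_ac)
  qed
  finally have "vandermonde_det d \<eta> * (\<Prod>i<d. \<phi> i)
      = (\<Sum>\<sigma> | \<sigma> permutes {..<d}. of_int (sign \<sigma>) * (\<Prod>j<d. \<eta> j ^ \<sigma> j) * (\<Prod>i<d. if \<sigma> i < k then \<phi> i else 1))"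
    unfolding det .
  then have "(\<Prod>i<d. \<phi> i)
      = (\<Sum>\<sigma> | \<sigma> permutes {..<d}. of_int (sign \<sigma>) * (\<Prod>j<d. \<eta> j ^ \<sigma> j) * (\<Prod>i<d. if \<sigma> i < k then \<phi> i else 1)) / vandermonde_det d \<eta>"
    using vandermonde_det_nonzero[OF inj] by (simp add: field_simps)
  then show ?thesis by (simp add: vandermonde_weight_def sum_divide_distrib)
qed

lemma sum_vandermonde_weight:
  assumes "inj_on \<eta> {..<d}" "\<And>i. i < d \<Longrightarrow> 0 < \<eta> i"
  shows "(\<Sum>\<sigma> | \<sigma> permutes {..<d}. vandermonde_weight d \<eta> \<sigma>) = 1"
  using interpolation_identity[OF assms, where k = 0] by simp

section \<open>Moments of the regularised Gram determinant\<close>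

abbreviation gauss_rows :: "nat \<Rightarrow> nat \<Rightarrow> (nat \<Rightarrow> nat \<Rightarrow> complex) measure" where
  "gauss_rows m k \<equiv> PiM {..<m} (\<lambda>_. gauss {..<k})"

lemma prob_space_gauss_rows: "prob_space (gauss_rows m k)"
  by (rule prob_space_PiM) (rule prob_space_gauss)

lemma borel_measurable_cnj [measurable]: "cnj \<in> borel_measurable borel"
  by (intro borel_measurable_continuous_onI continuous_intros)

lemma measurable_cgauss_borel: "M \<rightarrow>\<^sub>M cgauss = borel_measurable M"
  by (rule measurable_cong_sets) simp_all

lemma gauss_component: "b \<in> K \<Longrightarrow> (\<lambda>x. x b) \<in> borel_measurable (gauss K)"
  using measurable_component_singleton[of b K "\<lambda>_. cgauss"] unfolding measurable_cgauss_borel .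

lemma gauss_rows_component:
  assumes "i < m" "a < k"
  shows "(\<lambda>x. x i a) \<in> borel_measurable (gauss_rows m k)"
proof (rule measurable_compose[where N = "gauss {..<k}" and g = "\<lambda>y. y a"])
  show "(\<lambda>x. x i) \<in> gauss_rows m k \<rightarrow>\<^sub>M gauss {..<k}"
    using assms by (intro measurable_component_singleton) simp
  show "(\<lambda>y. y a) \<in> borel_measurable (gauss {..<k})"
    using assms by (intro gauss_component) simp
qed

lemma gram_mat_index_measurable:
  assumes "a < k" "b < k"
  shows "(\<lambda>x. gram_mat k {..<m} w x $$ (a, b)) \<in> borel_measurable (gauss_rows m k)"
proof -
  have "(\<lambda>x. \<Sum>c<m. of_real (w c) * cnj (x c a) * x c b) \<in> borel_measurable (gauss_rows m k)"
    by (intro borel_measurable_sum borel_measurable_times borel_measurable_const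
        measurable_compose[OF _ borel_measurable_cnj] gauss_rows_component assms) simp_all
  then show ?thesis using assms by (simp add: gram_mat_def)
qed

lemma det_measurable:
  fixes A :: "'x \<Rightarrow> complex mat"
  assumes "\<And>x. A x \<in> carrier_mat n n"
    and "\<And>i j. i < n \<Longrightarrow> j < n \<Longrightarrow> (\<lambda>x. A x $$ (i, j)) \<in> borel_measurable M"
  shows "(\<lambda>x. Determinant.det (A x)) \<in> borel_measurable M"
proof -
  have "(\<lambda>x. of_int (sign p) * (\<Prod>i = 0..<n. A x $$ (i, p i))) \<in> borel_measurable M" if "p permutes {0..<n}" for p
    using permutes_in_image[OF that] assms(2)
    by (intro borel_measurable_times borel_measurable_const borel_measurable_prod) auto
  then show ?thesis unfolding det_def'[OF assms(1)] by (intro borel_measurable_sum) simp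
qed

text \<open>This is \<open>det (1 + X\<^sup>* diag(w) X)\<close> for the matrix \<open>X\<close> with rows \<open>x 0, \<dots>, x (m - 1)\<close>. Adding the
  identity keeps it at least \<open>1\<close>, so that its reciprocal is bounded.\<close>

definition gram_det1 :: "nat \<Rightarrow> nat \<Rightarrow> (nat \<Rightarrow> real) \<Rightarrow> (nat \<Rightarrow> nat \<Rightarrow> complex) \<Rightarrow> real" where
  "gram_det1 m k w x = Re (Determinant.det (1\<^sub>m k + gram_mat k {..<m} w x))"

lemma gram_det1_measurable [measurable]: "gram_det1 m k w \<in> borel_measurable (gauss_rows m k)"
  unfolding gram_det1_def
proof (rule measurable_compose[OF det_measurable borel_measurable_Re])
  fix i j assume ij: "i < k" "j < k"
  have "(\<lambda>x. (1\<^sub>m k :: complex mat) $$ (i, j) + gram_mat k {..<m} w x $$ (i, j)) \<in> borel_measurable (gauss_rows m k)"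
    by (intro borel_measurable_add borel_measurable_const gram_mat_index_measurable ij)
  moreover have "(1\<^sub>m k + gram_mat k {..<m} w x) $$ (i, j) = (1\<^sub>m k :: complex mat) $$ (i, j) + gram_mat k {..<m} w x $$ (i, j)"
    for x
    using ij carrier_matD[OF gram_mat_carrier, of k "{..<m}" w x] by simp
  ultimately show "(\<lambda>x. (1\<^sub>m k + gram_mat k {..<m} w x) $$ (i, j)) \<in> borel_measurable (gauss_rows m k)"
    by (simp only:)
qed simp

lemma gram_mat_scale: "gram_mat k C (\<lambda>c. t * w c) z = of_real t \<cdot>\<^sub>m gram_mat k C w z"
  by (rule eq_matI) (auto simp: gram_mat_def sum_distrib_left mult_ac)

text \<open>\<open>det (1 + t W)\<close> is a polynomial in \<open>t\<close> of degree at most \<open>k\<close> with constant term \<open>1\<close> and negative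
  roots; this is the form that \<open>interpolation_identity\<close> requires.\<close>

lemma gram_det1_eigen:
  assumes "\<And>i. i < m \<Longrightarrow> 0 \<le> w i"
  obtains \<rho> where "\<And>a. a < k \<Longrightarrow> 0 \<le> \<rho> a" "\<And>t. gram_det1 m k (\<lambda>i. t * w i) x = (\<Prod>a<k. 1 + t * \<rho> a)"
    "Re (Determinant.det (gram_mat k {..<m} w x)) = (\<Prod>a<k. \<rho> a)"
proof -
  have "positive_semidefinite_mat k (gram_mat k {..<m} w x)"
    by (rule gram_mat_psd) (use assms in auto)
  then obtain \<rho> where \<rho>: "\<And>i. i < k \<Longrightarrow> 0 \<le> (\<rho> i :: real)"
    "\<And>t. Determinant.det (1\<^sub>m k + of_real t \<cdot>\<^sub>m gram_mat k {..<m} w x) = of_real (\<Prod>i<k. 1 + t * \<rho> i)"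
    "Determinant.det (gram_mat k {..<m} w x) = of_real (\<Prod>i<k. \<rho> i)"
    using psd_det_one_plus by blast
  show thesis
    by (rule that[OF \<rho>(1)]) (simp_all only: gram_det1_def gram_mat_scale \<rho>(2,3) Re_complex_of_real)
qed

lemma gram_det1_ge_1:
  assumes w: "\<And>i. i < m \<Longrightarrow> 0 \<le> w i"
  shows "gram_det1 m k w x \<ge> 1"
proof (rule gram_det1_eigen[of m w k x])
  fix \<rho> assume \<rho>: "\<And>a. a < k \<Longrightarrow> 0 \<le> \<rho> a" "\<And>t. gram_det1 m k (\<lambda>i. t * w i) x = (\<Prod>a<k. 1 + t * \<rho> a)"
  have "1 \<le> (\<Prod>a<k. 1 + 1 * \<rho> a)" using \<rho>(1) by (intro prod_ge_1) auto
  then show ?thesis using \<rho>(2)[of 1] by simp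
qed (rule w)

text \<open>Each power of \<open>1 / det\<close> is a Gaussian integral over an auxiliary matrix \<open>Z\<close> with \<open>n\<close> rows.
  Exchanging the order of integration leaves an integral over the rows of \<open>X\<close>, which are
  independent, so the dependence on the weights factorises.\<close>

lemma gram_det1_moments:
  assumes w: "\<And>i. i < m \<Longrightarrow> 0 \<le> w i"
  shows "(\<integral>\<^sup>+x. ennreal ((1 / gram_det1 m k w x) ^ n) \<partial>gauss_rows m k)
    = (\<integral>\<^sup>+z. ennreal (\<Prod>i<m. 1 / gram_det1 n k (\<lambda>_. w i) z) \<partial>gauss_rows n k)"
proof -
  interpret rows: product_sigma_finite "\<lambda>_. gauss {..<k}"
    by (intro product_sigma_finite.intro prob_space_imp_sigma_finite prob_space_gauss)
  interpret pair: pair_sigma_finite "gauss_rows m k" "gauss_rows n k"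
    by (intro pair_sigma_finite.intro prob_space_imp_sigma_finite prob_space_gauss_rows)
  define q where "q i x z = w i * (cmod (\<Sum>b<k. z b * x b))\<^sup>2" for i and x z :: "nat \<Rightarrow> complex"
  have q1: "(\<lambda>z. q i x z) \<in> borel_measurable (gauss {..<k})"
    and q2: "(\<lambda>x. q i x z) \<in> borel_measurable (gauss {..<k})" for i and x z :: "nat \<Rightarrow> complex"
    unfolding q_def
    by (intro borel_measurable_times borel_measurable_const borel_measurable_power borel_measurable_norm
        borel_measurable_sum gauss_component; simp)+
  have qm: "(\<lambda>(x, z). ennreal (\<Prod>c<n. exp (- (\<Sum>i<m. q i (x i) (z c))))) \<in> borel_measurable (gauss_rows m k \<Otimes>\<^sub>M gauss_rows n k)"
  proof -
    have x: "(\<lambda>p. fst p i b) \<in> borel_measurable (gauss_rows m k \<Otimes>\<^sub>M gauss_rows n k)" if "i < m" "b < k" for i b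
      using measurable_compose[OF measurable_fst gauss_rows_component[OF that]] .
    have z: "(\<lambda>p. snd p c b) \<in> borel_measurable (gauss_rows m k \<Otimes>\<^sub>M gauss_rows n k)" if "c < n" "b < k" for c b
      using measurable_compose[OF measurable_snd gauss_rows_component[OF that]] .
    show ?thesis
      unfolding q_def case_prod_unfold
      by (intro measurable_compose[OF _ measurable_ennreal] borel_measurable_prod
          measurable_compose[OF _ borel_measurable_exp] borel_measurable_uminus borel_measurable_sum
          borel_measurable_times borel_measurable_const borel_measurable_power measurable_compose[OF _ borel_measurable_norm] x z) auto
  qed
  \<comment> \<open>the same double integral, over the auxiliary matrix first and over \<open>x\<close> first\<close>
  have det_x: "ennreal ((1 / gram_det1 m k w x) ^ n)
      = (\<integral>\<^sup>+z. ennreal (\<Prod>c<n. exp (- (\<Sum>i<m. q i (x i) (z c)))) \<partial>gauss_rows n k)" for x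
  proof -
    have "1 \<le> gram_det1 m k w x" by (rule gram_det1_ge_1) (rule w)
    then have pos: "0 \<le> 1 / gram_det1 m k w x" by simp
    have "(\<integral>\<^sup>+z. ennreal (\<Prod>c<n. exp (- (\<Sum>i<m. q i (x i) (z c)))) \<partial>gauss_rows n k)
        = (\<integral>\<^sup>+z. (\<Prod>c<n. ennreal (exp (- (\<Sum>i<m. q i (x i) (z c))))) \<partial>gauss_rows n k)"
      by (simp add: prod_ennreal)
    also have "\<dots> = (\<Prod>c<n. \<integral>\<^sup>+z. ennreal (exp (- (\<Sum>i<m. q i (x i) z))) \<partial>gauss {..<k})"
      by (intro rows.product_nn_integral_prod measurable_compose[OF _ measurable_ennreal]
          measurable_compose[OF _ borel_measurable_exp] borel_measurable_uminus borel_measurable_sum q1) auto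
    also have "\<dots> = (\<Prod>c<n. ennreal (1 / gram_det1 m k w x))"
      unfolding q_def gram_det1_def by (intro prod.cong refl gauss_exp_quadratic) (use w in auto)
    finally show ?thesis using pos by (simp add: ennreal_power)
  qed
  have det_z: "(\<integral>\<^sup>+x. ennreal (\<Prod>c<n. exp (- (\<Sum>i<m. q i (x i) (z c)))) \<partial>gauss_rows m k)
      = ennreal (\<Prod>i<m. 1 / gram_det1 n k (\<lambda>_. w i) z)" for z
  proof -
    have "(\<Prod>c<n. exp (- (\<Sum>i<m. q i (x i) (z c)))) = (\<Prod>i<m. exp (- (\<Sum>c<n. q i (x i) (z c))))"
      for x :: "nat \<Rightarrow> nat \<Rightarrow> complex"
      by (simp add: exp_sum[symmetric] sum_negf[symmetric] sum.swap[of _ "{..<n}"])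
    then have "(\<integral>\<^sup>+x. ennreal (\<Prod>c<n. exp (- (\<Sum>i<m. q i (x i) (z c)))) \<partial>gauss_rows m k)
        = (\<integral>\<^sup>+x. (\<Prod>i<m. ennreal (exp (- (\<Sum>c<n. q i (x i) (z c))))) \<partial>gauss_rows m k)"
      by (simp add: prod_ennreal)
    also have "\<dots> = (\<Prod>i<m. \<integral>\<^sup>+x. ennreal (exp (- (\<Sum>c<n. q i x (z c)))) \<partial>gauss {..<k})"
      by (intro rows.product_nn_integral_prod measurable_compose[OF _ measurable_ennreal]
          measurable_compose[OF _ borel_measurable_exp] borel_measurable_uminus borel_measurable_sum q2) auto
    also have "\<dots> = (\<Prod>i<m. ennreal (1 / gram_det1 n k (\<lambda>_. w i) z))"
    proof (intro prod.cong refl)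
      fix i assume "i \<in> {..<m}"
      then show "(\<integral>\<^sup>+x. ennreal (exp (- (\<Sum>c<n. q i x (z c)))) \<partial>gauss {..<k}) = ennreal (1 / gram_det1 n k (\<lambda>_. w i) z)"
        unfolding q_def gram_det1_def mult.commute[of "z _ _"]
        by (intro gauss_exp_quadratic[where w = "\<lambda>_. w i"]) (use w in auto)
    qed
    also have "\<dots> = ennreal (\<Prod>i<m. 1 / gram_det1 n k (\<lambda>_. w i) z)"
    proof (rule prod_ennreal)
      fix i assume "i \<in> {..<m}"
      then show "0 \<le> 1 / gram_det1 n k (\<lambda>_. w i) z"
        using gram_det1_ge_1[of n "\<lambda>_. w i" k z] w by auto
    qed
    finally show ?thesis .
  qed
  show ?thesis
    unfolding det_x det_z[symmetric] by (rule pair.Fubini'[OF qm, symmetric])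
qed

section \<open>The Gram determinant as a signed mixture\<close>

lemma gram_det1_moments_real:
  assumes w: "\<And>i. i < m \<Longrightarrow> 0 \<le> w i"
  shows "(LINT x|(gauss_rows m k). (1 / gram_det1 m k w x) ^ n)
    = (LINT z|(gauss_rows n k). (\<Prod>i<m. 1 / gram_det1 n k (\<lambda>_. w i) z))"
proof -
  have 1: "1 \<le> gram_det1 m k w x" for x by (rule gram_det1_ge_1) (rule w)
  have 2: "1 \<le> gram_det1 n k (\<lambda>_. w i) z" if "i < m" for i z by (rule gram_det1_ge_1) (rule w[OF that])
  have "(LINT x|(gauss_rows m k). (1 / gram_det1 m k w x) ^ n)
      = enn2real (\<integral>\<^sup>+x. ennreal ((1 / gram_det1 m k w x) ^ n) \<partial>gauss_rows m k)"
    by (rule integral_eq_nn_integral) (use order_trans[OF zero_le_one 1] in auto)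
  also have "\<dots> = enn2real (\<integral>\<^sup>+z. ennreal (\<Prod>i<m. 1 / gram_det1 n k (\<lambda>_. w i) z) \<partial>gauss_rows n k)"
    by (subst gram_det1_moments) (use w in auto)
  also have "\<dots> = (LINT z|(gauss_rows n k). (\<Prod>i<m. 1 / gram_det1 n k (\<lambda>_. w i) z))"
    by (rule integral_eq_nn_integral[symmetric])
       (use order_trans[OF zero_le_one 2] in \<open>auto intro!: AE_I2 prod_nonneg\<close>)
  finally show ?thesis .
qed

text \<open>Keeps the \<open>k\<close> rows that \<open>\<sigma>\<close> sends below \<open>k\<close>.\<close>

definition restrict_weight :: "nat \<Rightarrow> (nat \<Rightarrow> nat) \<Rightarrow> (nat \<Rightarrow> real) \<Rightarrow> nat \<Rightarrow> real" where
  "restrict_weight k \<sigma> w i = (if \<sigma> i < k then w i else 0)"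

lemma inverse_gram_det1_bounds:
  assumes w: "\<And>i. i < m \<Longrightarrow> 0 \<le> w i"
  shows "1 / gram_det1 m k w x \<in> {0..1}"
proof -
  have "1 \<le> gram_det1 m k w x" by (rule gram_det1_ge_1) (rule w)
  then show ?thesis by auto
qed

text \<open>After the exchange of the roles of \<open>X\<close> and \<open>Z\<close> the integrand is a product of the form treated in
  \<open>interpolation_identity\<close>, and exchanging them back turns each of its terms into a moment of the
  same determinant with only the rows in \<open>{i. \<sigma> i < k}\<close> present.\<close>

lemma gram_det1_mixture_moments:
  assumes inj: "inj_on \<eta> {..<d}" and pos: "\<And>i. i < d \<Longrightarrow> 0 < \<eta> i" and r: "0 < r"
  defines "w \<equiv> \<lambda>i. r * (1 / \<eta> i)"
  shows "(LINT x|(gauss_rows d k). (1 / gram_det1 d k w x) ^ n)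
    = (\<Sum>\<sigma> | \<sigma> permutes {..<d}. vandermonde_weight d \<eta> \<sigma> *
        (LINT x|(gauss_rows d k). (1 / gram_det1 d k (restrict_weight k \<sigma> w) x) ^ n))"
proof -
  interpret prob_space "gauss_rows n k" by (rule prob_space_gauss_rows)
  have w: "0 \<le> w i" if "i < d" for i using pos[OF that] r by (simp add: w_def)
  have w': "0 \<le> restrict_weight k \<sigma> w i" if "i < d" for \<sigma> i using w[OF that] by (simp add: restrict_weight_def)
  have pt: "(\<Prod>i<d. 1 / gram_det1 n k (\<lambda>_. w i) z)
      = (\<Sum>\<sigma> | \<sigma> permutes {..<d}. vandermonde_weight d \<eta> \<sigma> *
          (\<Prod>i<d. 1 / gram_det1 n k (\<lambda>_. restrict_weight k \<sigma> w i) z))" for z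
  proof (rule gram_det1_eigen[of n "\<lambda>_. 1" k z])
    fix \<rho> assume \<rho>: "\<And>a. a < k \<Longrightarrow> 0 \<le> \<rho> a"
      and "\<And>t. gram_det1 n k (\<lambda>i. t * 1) z = (\<Prod>a<k. 1 + t * \<rho> a)"
    then have gd: "gram_det1 n k (\<lambda>_. t) z = (\<Prod>a<k. 1 + t * \<rho> a)" for t by simp
    have "1 / gram_det1 n k (\<lambda>_. w i) z = 1 / (\<Prod>a<k. 1 + r * \<rho> a / \<eta> i)" for i
      by (simp add: gd w_def mult_ac)
    moreover have "1 / gram_det1 n k (\<lambda>_. restrict_weight k \<sigma> w i) z
        = (if \<sigma> i < k then 1 / (\<Prod>a<k. 1 + r * \<rho> a / \<eta> i) else 1)" for \<sigma> i
      by (simp add: gd w_def restrict_weight_def mult_ac)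
    ultimately show ?thesis
      using interpolation_identity[OF inj pos, of k "\<lambda>a. r * \<rho> a"] \<rho> r by simp
  qed simp
  have int: "integrable (gauss_rows n k) (\<lambda>z. \<Prod>i<d. 1 / gram_det1 n k (\<lambda>_. restrict_weight k \<sigma> w i) z)" for \<sigma>
  proof (rule integrable_const_bound[where B = 1])
    have b: "1 / gram_det1 n k (\<lambda>_. restrict_weight k \<sigma> w i) z \<in> {0..1}" if "i < d" for i z
      by (rule inverse_gram_det1_bounds) (rule w'[OF that])
    show "AE z in gauss_rows n k. norm (\<Prod>i<d. 1 / gram_det1 n k (\<lambda>_. restrict_weight k \<sigma> w i) z) \<le> 1"
    proof (rule AE_I2)
      fix z
      have "0 \<le> (\<Prod>i<d. 1 / gram_det1 n k (\<lambda>_. restrict_weight k \<sigma> w i) z)"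
        using b by (intro prod_nonneg) auto
      moreover have "(\<Prod>i<d. 1 / gram_det1 n k (\<lambda>_. restrict_weight k \<sigma> w i) z) \<le> 1"
        using b by (intro prod_le_1) auto
      ultimately show "norm (\<Prod>i<d. 1 / gram_det1 n k (\<lambda>_. restrict_weight k \<sigma> w i) z) \<le> 1" by simp
    qed
  qed measurable
  have "(LINT x|(gauss_rows d k). (1 / gram_det1 d k w x) ^ n)
      = (LINT z|(gauss_rows n k). (\<Sum>\<sigma> | \<sigma> permutes {..<d}. vandermonde_weight d \<eta> \<sigma> *
          (\<Prod>i<d. 1 / gram_det1 n k (\<lambda>_. restrict_weight k \<sigma> w i) z)))"
    unfolding pt[symmetric] by (rule gram_det1_moments_real[OF w])
  also have "\<dots> = (\<Sum>\<sigma> | \<sigma> permutes {..<d}. vandermonde_weight d \<eta> \<sigma> *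
      (LINT z|(gauss_rows n k). (\<Prod>i<d. 1 / gram_det1 n k (\<lambda>_. restrict_weight k \<sigma> w i) z)))"
    by (subst Bochner_Integration.integral_sum) (auto intro!: integrable_mult_right int simp: int)
  also have "\<dots> = (\<Sum>\<sigma> | \<sigma> permutes {..<d}. vandermonde_weight d \<eta> \<sigma> *
        (LINT x|(gauss_rows d k). (1 / gram_det1 d k (restrict_weight k \<sigma> w) x) ^ n))"
    by (intro sum.cong refl arg_cong2[where f = "(*)"] gram_det1_moments_real[symmetric] w')
  finally show ?thesis .
qed

text \<open>If a signed mixture of laws on \<open>[0, 1]\<close> has the moments of a given law, Weierstrass
  approximation extends the agreement to continuous functions.\<close>

lemma mixture_of_moments_continuous:
  fixes V :: "'a \<Rightarrow> real" and V' :: "'s \<Rightarrow> 'a \<Rightarrow> real"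
  assumes M: "prob_space M" and S: "finite S"
    and V [measurable]: "V \<in> borel_measurable M" and V01: "\<And>x. x \<in> space M \<Longrightarrow> V x \<in> {0..1}"
    and V' [measurable]: "\<And>\<sigma>. V' \<sigma> \<in> borel_measurable M" and V'01: "\<And>\<sigma> x. x \<in> space M \<Longrightarrow> V' \<sigma> x \<in> {0..1}"
    and mom: "\<And>n. (LINT x|M. V x ^ n) = (\<Sum>\<sigma>\<in>S. c \<sigma> * (LINT x|M. V' \<sigma> x ^ n))"
    and g: "continuous_on {0..1} g" and gm [measurable]: "g \<in> borel_measurable borel"
  shows "(LINT x|M. g (V x)) = (\<Sum>\<sigma>\<in>S. c \<sigma> * (LINT x|M. g (V' \<sigma> x)))"
proof -
  interpret prob_space M by (rule M)
  define \<L> where "\<L> h = (LINT x|M. h (V x)) - (\<Sum>\<sigma>\<in>S. c \<sigma> * (LINT x|M. h (V' \<sigma> x)))" for h :: "real \<Rightarrow> real"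
  have int_bdd: "integrable M (\<lambda>x. h (W x))"
    if "\<And>x. x \<in> space M \<Longrightarrow> W x \<in> {0..1}" "W \<in> borel_measurable M" "h \<in> borel_measurable borel"
      "\<And>v. v \<in> {0..1} \<Longrightarrow> \<bar>h v\<bar> \<le> B" for h :: "real \<Rightarrow> real" and W :: "'a \<Rightarrow> real" and B
    by (rule integrable_const_bound[where B = B])
       (use that measurable_compose[OF that(2,3)] in auto)
  \<comment> \<open>the functional vanishes on Bernstein polynomials\<close>
  have pm [measurable]: "(\<lambda>v::real. v ^ a * (1 - v) ^ b) \<in> borel_measurable borel" for a b
    by measurable
  have pb: "\<bar>v ^ a * (1 - v) ^ b\<bar> \<le> 1" if "v \<in> {0..1}" for v :: real and a b
    using that by (auto simp: abs_mult power_abs intro!: mult_le_one power_le_one)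
  have int_pm: "integrable M (\<lambda>x. W x ^ a * (1 - W x) ^ b)"
    if W: "\<And>x. x \<in> space M \<Longrightarrow> W x \<in> {0..1}" "W \<in> borel_measurable M" for W :: "'a \<Rightarrow> real" and a b
    by (rule integrable_const_bound[where B = 1])
       (use pb[OF W(1)] measurable_compose[OF W(2) pm] in auto)
  have bern: "\<L> (\<lambda>v. v ^ a * (1 - v) ^ b) = 0" for a b
  proof (induction b arbitrary: a)
    case 0
    show ?case using mom[of a] by (simp add: \<L>_def)
  next
    case (Suc b)
    have split: "v ^ a * (1 - v) ^ Suc b = v ^ a * (1 - v) ^ b - v ^ Suc a * (1 - v) ^ b" for v :: real
      by (simp add: algebra_simps)
    have "(LINT x|M. W x ^ a * (1 - W x) ^ Suc b)
        = (LINT x|M. W x ^ a * (1 - W x) ^ b) - (LINT x|M. W x ^ Suc a * (1 - W x) ^ b)"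
      if "\<And>x. x \<in> space M \<Longrightarrow> W x \<in> {0..1}" "W \<in> borel_measurable M" for W :: "'a \<Rightarrow> real"
      unfolding split
      by (intro Bochner_Integration.integral_diff int_pm[OF that])
    then have "\<L> (\<lambda>v. v ^ a * (1 - v) ^ Suc b)
        = \<L> (\<lambda>v. v ^ a * (1 - v) ^ b) - \<L> (\<lambda>v. v ^ Suc a * (1 - v) ^ b)"
      unfolding \<L>_def using V01 V'01 V V' by (simp add: sum_subtractf right_diff_distrib)
    then show ?case by (simp only: Suc.IH)
  qed
  define C where "C = 1 + (\<Sum>\<sigma>\<in>S. \<bar>c \<sigma>\<bar>)"
  have C: "C > 0" unfolding C_def by (intro add_pos_nonneg sum_nonneg) auto
  have "compact (g ` {0..1})" by (rule compact_continuous_image[OF g]) simp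
  then have "bounded (g ` {0..1})" by (rule compact_imp_bounded)
  then obtain B where "\<forall>v\<in>{0..1}. \<bar>g v\<bar> \<le> B" by (auto simp: bounded_iff)
  then have B: "\<bar>g v\<bar> \<le> B" if "v \<in> {0..1}" for v using that by blast
  have "\<bar>\<L> g\<bar> \<le> e" if e: "e > 0" for e
  proof -
    define e' where "e' = e / C"
    have e': "e' > 0" using e C by (simp add: e'_def)
    obtain n where n: "\<And>v. v \<in> {0..1} \<Longrightarrow> \<bar>g v - (\<Sum>k\<le>n. g (k / n) * Bernstein n k v)\<bar> < e'"
      using Bernstein_Weierstrass[OF g e'] by blast
    define p where "p v = (\<Sum>k\<le>n. g (k / n) * Bernstein n k v)" for v
    have pm: "p \<in> borel_measurable borel" unfolding p_def Bernstein_def by measurable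
    have pB: "\<bar>p v\<bar> \<le> B + e'" if "v \<in> {0..1}" for v
      using n[OF that] B[OF that] by (simp add: p_def)
    have lin: "(LINT x|M. p (W x)) = (\<Sum>k\<le>n. g (k / n) * (n choose k) * (LINT x|M. W x ^ k * (1 - W x) ^ (n - k)))"
      if W: "\<And>x. x \<in> space M \<Longrightarrow> W x \<in> {0..1}" "W \<in> borel_measurable M" for W :: "'a \<Rightarrow> real"
    proof -
      have "p v = (\<Sum>k\<le>n. (g (k / n) * (n choose k)) * (v ^ k * (1 - v) ^ (n - k)))" for v
        by (simp add: p_def Bernstein_def mult_ac)
      then show ?thesis
        by (simp only:) (subst Bochner_Integration.integral_sum,
            auto intro!: integrable_mult_right int_pm[OF W])
    qed
    have "\<L> p = (\<Sum>k\<le>n. g (k / n) * (n choose k) * \<L> (\<lambda>v. v ^ k * (1 - v) ^ (n - k)))"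
    proof -
      have "\<L> p = (\<Sum>k\<le>n. g (k / n) * (n choose k) * (LINT x|M. V x ^ k * (1 - V x) ^ (n - k)))
          - (\<Sum>\<sigma>\<in>S. c \<sigma> * (\<Sum>k\<le>n. g (k / n) * (n choose k) * (LINT x|M. V' \<sigma> x ^ k * (1 - V' \<sigma> x) ^ (n - k))))"
        unfolding \<L>_def using lin[OF V01 V] lin[OF V'01 V'] by simp
      also have "(\<Sum>\<sigma>\<in>S. c \<sigma> * (\<Sum>k\<le>n. g (k / n) * (n choose k) * (LINT x|M. V' \<sigma> x ^ k * (1 - V' \<sigma> x) ^ (n - k))))
          = (\<Sum>k\<le>n. g (k / n) * (n choose k) * (\<Sum>\<sigma>\<in>S. c \<sigma> * (LINT x|M. V' \<sigma> x ^ k * (1 - V' \<sigma> x) ^ (n - k))))"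
        by (simp only: sum_distrib_left) (subst sum.swap, intro sum.cong refl, simp only: mult_ac)
      finally show ?thesis by (simp only: \<L>_def sum_subtractf right_diff_distrib)
    qed
    then have Lp: "\<L> p = 0" by (simp add: bern)
    have diff: "\<bar>(LINT x|M. g (W x)) - (LINT x|M. p (W x))\<bar> \<le> e'"
      if W: "\<And>x. x \<in> space M \<Longrightarrow> W x \<in> {0..1}" "W \<in> borel_measurable M" for W :: "'a \<Rightarrow> real"
    proof -
      have ig: "integrable M (\<lambda>x. g (W x))" by (rule int_bdd[OF W gm B])
      have ip: "integrable M (\<lambda>x. p (W x))" by (rule int_bdd[OF W pm pB])
      have "\<bar>(LINT x|M. g (W x)) - (LINT x|M. p (W x))\<bar> = \<bar>LINT x|M. g (W x) - p (W x)\<bar>"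
        using ig ip by simp
      also have "\<dots> \<le> (LINT x|M. \<bar>g (W x) - p (W x)\<bar>)" by (rule integral_abs_bound)
      also have "\<dots> \<le> (LINT x|M. e')"
      proof (rule integral_mono)
        show "\<bar>g (W x) - p (W x)\<bar> \<le> e'" if "x \<in> space M" for x
          using n[OF W(1)[OF that]] by (simp add: p_def)
      qed (use ig ip in auto)
      finally show ?thesis by (simp add: prob_space)
    qed
    have "\<L> g = \<L> g - \<L> p" using Lp by simp
    also have "\<dots> = ((LINT x|M. g (V x)) - (LINT x|M. p (V x)))
        - (\<Sum>\<sigma>\<in>S. c \<sigma> * ((LINT x|M. g (V' \<sigma> x)) - (LINT x|M. p (V' \<sigma> x))))"
      by (simp add: \<L>_def right_diff_distrib sum_subtractf)
    finally have "\<bar>\<L> g\<bar> \<le> \<bar>(LINT x|M. g (V x)) - (LINT x|M. p (V x))\<bar>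
        + \<bar>\<Sum>\<sigma>\<in>S. c \<sigma> * ((LINT x|M. g (V' \<sigma> x)) - (LINT x|M. p (V' \<sigma> x)))\<bar>" by linarith
    also have "\<dots> \<le> e' + (\<Sum>\<sigma>\<in>S. \<bar>c \<sigma>\<bar> * e')"
      by (intro add_mono diff V01 V order_trans[OF sum_abs] sum_mono)
         (auto simp: abs_mult intro!: mult_left_mono diff V' V'01)
    also have "\<dots> = C * e'" by (simp add: C_def distrib_right sum_distrib_right)
    also have "\<dots> = e" using C by (simp add: e'_def)
    finally show ?thesis .
  qed
  then have "\<bar>\<L> g\<bar> \<le> 0" by (rule field_le_epsilon) simp
  then show ?thesis by (simp add: \<L>_def)
qed

definition gram_det :: "nat \<Rightarrow> nat \<Rightarrow> (nat \<Rightarrow> real) \<Rightarrow> (nat \<Rightarrow> nat \<Rightarrow> complex) \<Rightarrow> real" where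
  "gram_det m k w x = Re (Determinant.det (gram_mat k {..<m} w x))"

lemma gram_det_measurable [measurable]: "gram_det m k w \<in> borel_measurable (gauss_rows m k)"
  unfolding gram_det_def
  by (rule measurable_compose[OF det_measurable[of _ k] borel_measurable_Re])
     (auto intro: gram_mat_index_measurable)

lemma gram_det_nonneg:
  assumes w: "\<And>i. i < m \<Longrightarrow> 0 \<le> w i"
  shows "0 \<le> gram_det m k w x"
proof (rule gram_det1_eigen[of m w k x])
  fix \<rho> assume "\<And>a. a < k \<Longrightarrow> 0 \<le> \<rho> a" "Re (Determinant.det (gram_mat k {..<m} w x)) = (\<Prod>a<k. \<rho> a)"
  then show ?thesis by (auto simp: gram_det_def intro!: prod_nonneg)
qed (rule w)

text \<open>Large weights drown the identity matrix: in terms of the eigenvalues, \<open>(1 + t \<rho>) / t\<close> tends to \<open>\<rho>\<close>.\<close>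

lemma gram_det1_tendsto_gram_det:
  assumes w: "\<And>i. i < m \<Longrightarrow> 0 \<le> w i"
  shows "(\<lambda>p. gram_det1 m k (\<lambda>i. real (Suc p) * w i) x / real (Suc p) ^ k) \<longlonglongrightarrow> gram_det m k w x"
proof (rule gram_det1_eigen[of m w k x])
  fix \<rho> assume \<rho>: "\<And>t. gram_det1 m k (\<lambda>i. t * w i) x = (\<Prod>a<k. 1 + t * \<rho> a)"
    "Re (Determinant.det (gram_mat k {..<m} w x)) = (\<Prod>a<k. \<rho> a)"
  have "(\<Prod>a<k. 1 + t * \<rho> a) / t ^ k = (\<Prod>a<k. 1 / t + \<rho> a)" if "t > 0" for t :: real
  proof -
    have "(\<Prod>a<k. 1 / t + \<rho> a) = (\<Prod>a<k. (1 + t * \<rho> a) / t)"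
      using that by (intro prod.cong refl) (simp add: field_simps)
    then show ?thesis by (simp add: prod_dividef)
  qed
  then have "(\<lambda>p. gram_det1 m k (\<lambda>i. real (Suc p) * w i) x / real (Suc p) ^ k)
      = (\<lambda>p. \<Prod>a<k. 1 / real (Suc p) + \<rho> a)"
    unfolding \<rho> by simp
  moreover have "(\<lambda>p. \<Prod>a<k. 1 / real (Suc p) + \<rho> a) \<longlonglongrightarrow> (\<Prod>a<k. 0 + \<rho> a)"
    by (intro tendsto_prod tendsto_add tendsto_const LIMSEQ_Suc[OF lim_1_over_n])
  ultimately show ?thesis by (simp add: gram_det_def \<rho>)
qed (rule w)

text \<open>Bounded and continuous for every real \<open>s\<close>, unlike the power itself.\<close>

definition clamp_powr :: "real \<Rightarrow> real \<Rightarrow> real \<Rightarrow> real" where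
  "clamp_powr s K x = (max (1 / K) (min x K)) powr s"

lemma clamp_powr_continuous:
  assumes "K > 0"
  shows "continuous_on UNIV (clamp_powr s K)"
proof -
  have "0 < max (1 / K) (min x K)" for x using assms by (simp add: less_max_iff_disj)
  then have "max (1 / K) (min x K) \<noteq> 0" for x by (metis less_irrefl)
  then show ?thesis unfolding clamp_powr_def by (intro continuous_intros) auto
qed

lemma clamp_powr_bounded:
  assumes "K > 0"
  shows "clamp_powr s K x \<in> {0..max (K powr s) ((1 / K) powr s)}"
proof -
  define u where "u = max (1 / K) (min x K)"
  have u: "1 / K \<le> u" "u \<le> max K (1 / K)" "0 < u" using assms by (auto simp: u_def less_max_iff_disj)
  have "u powr s \<le> max (K powr s) ((1 / K) powr s)"
  proof (cases "s \<ge> 0")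
    case True
    then have "u powr s \<le> (max K (1 / K)) powr s" using u by (intro powr_mono2) auto
    then show ?thesis by (auto simp: max_def split: if_splits)
  next
    case False
    then have "u powr s \<le> (1 / K) powr s" using u assms by (intro powr_mono2') auto
    then show ?thesis by simp
  qed
  then show ?thesis by (simp add: clamp_powr_def u_def)
qed

text \<open>A clamped power of a multiple of \<open>det (1 + W)\<close> is a continuous function of \<open>1 / det (1 + W)\<close> on
  \<open>[0, 1]\<close>, so that \<open>mixture_of_moments_continuous\<close> applies; then the weights are sent to infinity and the
  determinants are rescaled.\<close>

lemma gram_det_mixture_clamp:
  assumes inj: "inj_on \<eta> {..<d}" and pos: "\<And>i. i < d \<Longrightarrow> 0 < \<eta> i" and K: "0 < K"
  defines "w \<equiv> \<lambda>i. 1 / \<eta> i"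
  shows "(LINT x|(gauss_rows d k). clamp_powr s K (gram_det d k w x))
    = (\<Sum>\<sigma> | \<sigma> permutes {..<d}. vandermonde_weight d \<eta> \<sigma> *
        (LINT x|(gauss_rows d k). clamp_powr s K (gram_det d k (restrict_weight k \<sigma> w) x)))"
proof -
  interpret prob_space "gauss_rows d k" by (rule prob_space_gauss_rows)
  have w: "0 \<le> w i" if "i < d" for i using pos[OF that] by (simp add: w_def)
  have w': "0 \<le> restrict_weight k \<sigma> w i" if "i < d" for \<sigma> i using w[OF that] by (simp add: restrict_weight_def)
  have cm [measurable]: "clamp_powr s K \<in> borel_measurable borel"
    by (intro borel_measurable_continuous_onI clamp_powr_continuous K)
  define D where "D p v x = gram_det1 d k (\<lambda>i. real (Suc p) * v i) x / real (Suc p) ^ k" for p v x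
  have Dm [measurable]: "D p v \<in> borel_measurable (gauss_rows d k)" for p v unfolding D_def by measurable
  have step: "(LINT x|(gauss_rows d k). clamp_powr s K (D p w x))
    = (\<Sum>\<sigma> | \<sigma> permutes {..<d}. vandermonde_weight d \<eta> \<sigma> *
        (LINT x|(gauss_rows d k). clamp_powr s K (D p (restrict_weight k \<sigma> w) x)))" for p
  proof -
    define r where "r = real (Suc p)"
    have r: "r > 0" by (simp add: r_def)
    define g where "g v = (max (1 / K) (1 / max (r ^ k * v) (1 / K))) powr s" for v
    have gcont: "continuous_on UNIV g"
    proof -
      have "0 < max a (1 / K)" "0 < max (1 / K) a" for a
        using K by (simp_all add: less_max_iff_disj)
      then have "max a (1 / K) \<noteq> 0" "max (1 / K) a \<noteq> 0" for a by (metis less_irrefl)+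
      then show ?thesis unfolding g_def by (intro continuous_intros) auto
    qed
    have gD: "g (1 / gram_det1 d k (\<lambda>i. r * v i) x) = clamp_powr s K (D p v x)"
      if "\<And>i. i < d \<Longrightarrow> 0 \<le> v i" for v x
    proof -
      have "1 \<le> gram_det1 d k (\<lambda>i. r * v i) x" by (rule gram_det1_ge_1) (use that r in auto)
      then have Dpos: "0 < D p v x" unfolding D_def r_def[symmetric] using r by simp
      have "r ^ k * (1 / gram_det1 d k (\<lambda>i. r * v i) x) = 1 / D p v x"
        unfolding D_def r_def by simp
      moreover have "1 / max (1 / D p v x) (1 / K) = min (D p v x) K"
        using Dpos K by (auto simp: max_def min_def field_simps)
      ultimately show ?thesis by (simp add: g_def clamp_powr_def)
    qed
    have res: "restrict_weight k \<sigma> (\<lambda>i. r * (1 / \<eta> i)) = (\<lambda>i. r * restrict_weight k \<sigma> w i)" for \<sigma>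
      by (auto simp: restrict_weight_def w_def)
    have "(LINT x|(gauss_rows d k). g (1 / gram_det1 d k (\<lambda>i. r * w i) x))
      = (\<Sum>\<sigma> | \<sigma> permutes {..<d}. vandermonde_weight d \<eta> \<sigma> *
          (LINT x|(gauss_rows d k). g (1 / gram_det1 d k (\<lambda>i. r * restrict_weight k \<sigma> w i) x)))"
    proof (rule mixture_of_moments_continuous[OF prob_space_gauss_rows, where g = g
          and V = "\<lambda>x. 1 / gram_det1 d k (\<lambda>i. r * w i) x"
          and V' = "\<lambda>\<sigma> x. 1 / gram_det1 d k (\<lambda>i. r * restrict_weight k \<sigma> w i) x"])
      show "continuous_on {0..1} g" by (rule continuous_on_subset[OF gcont]) simp
      show "g \<in> borel_measurable borel" by (rule borel_measurable_continuous_onI[OF gcont])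
      show "(LINT x|(gauss_rows d k). (1 / gram_det1 d k (\<lambda>i. r * w i) x) ^ n)
        = (\<Sum>\<sigma> | \<sigma> permutes {..<d}. vandermonde_weight d \<eta> \<sigma> *
          (LINT x|(gauss_rows d k). (1 / gram_det1 d k (\<lambda>i. r * restrict_weight k \<sigma> w i) x) ^ n))" for n
        using gram_det1_mixture_moments[OF inj pos r, of k n] unfolding res by (simp add: w_def)
      show "1 / gram_det1 d k (\<lambda>i. r * w i) x \<in> {0..1}" for x
        by (rule inverse_gram_det1_bounds) (use w r in auto)
      show "1 / gram_det1 d k (\<lambda>i. r * restrict_weight k \<sigma> w i) x \<in> {0..1}" for \<sigma> x
        by (rule inverse_gram_det1_bounds) (use w' r in auto)
    qed (auto simp: finite_permutations)
    then show ?thesis by (simp only: gD[OF w] gD[OF w'])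
  qed
  have lim: "(\<lambda>p. LINT x|(gauss_rows d k). clamp_powr s K (D p v x))
      \<longlonglongrightarrow> (LINT x|(gauss_rows d k). clamp_powr s K (gram_det d k v x))"
    if v: "\<And>i. i < d \<Longrightarrow> 0 \<le> v i" for v
  proof (rule integral_dominated_convergence)
    show "AE x in gauss_rows d k. (\<lambda>p. clamp_powr s K (D p v x)) \<longlonglongrightarrow> clamp_powr s K (gram_det d k v x)"
    proof (rule AE_I2)
      fix x
      have "isCont (clamp_powr s K) (gram_det d k v x)"
        using clamp_powr_continuous[OF K] by (simp add: continuous_on_eq_continuous_at)
      moreover have "(\<lambda>p. D p v x) \<longlonglongrightarrow> gram_det d k v x"
        unfolding D_def by (rule gram_det1_tendsto_gram_det[OF v])
      ultimately show "(\<lambda>p. clamp_powr s K (D p v x)) \<longlonglongrightarrow> clamp_powr s K (gram_det d k v x)"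
        by (rule isCont_tendsto_compose)
    qed
    show "AE x in gauss_rows d k. norm (clamp_powr s K (D p v x)) \<le> max (K powr s) ((1 / K) powr s)" for p
      using clamp_powr_bounded[OF K] by (intro AE_I2) auto
  qed auto
  have "(\<lambda>p. LINT x|(gauss_rows d k). clamp_powr s K (D p w x))
      \<longlonglongrightarrow> (\<Sum>\<sigma> | \<sigma> permutes {..<d}. vandermonde_weight d \<eta> \<sigma> *
        (LINT x|(gauss_rows d k). clamp_powr s K (gram_det d k (restrict_weight k \<sigma> w) x)))"
    unfolding step by (intro tendsto_sum tendsto_mult tendsto_const lim w')
  from LIMSEQ_unique[OF lim[OF w] this] show ?thesis .
qed

section \<open>Moments of the determinant of a square Gaussian matrix\<close>

text \<open>For \<open>s < 0\<close> the value at \<open>0\<close> has to be \<open>\<infinity>\<close> and not the default \<open>0 powr s = 0\<close>: a finite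
  expectation then shows that the argument is almost surely nonzero.\<close>

definition ext_powr :: "real \<Rightarrow> real \<Rightarrow> ennreal" where
  "ext_powr s x = (if x \<le> 0 \<and> s < 0 then \<infinity> else ennreal (x powr s))"

lemma ext_powr_measurable [measurable]: "ext_powr s \<in> borel_measurable borel"
  unfolding ext_powr_def by measurable

lemma ext_powr_pos: "0 < x \<Longrightarrow> ext_powr s x = ennreal (x powr s)"
  by (simp add: ext_powr_def)

lemma ext_powr_mult:
  assumes "0 \<le> x" "0 \<le> y"
  shows "ext_powr s (x * y) = ext_powr s x * ext_powr s y"
proof (cases "x = 0 \<or> y = 0")
  case True
  have "ext_powr s z \<noteq> 0" if "s < 0" "0 \<le> z" for z
    using that by (auto simp: ext_powr_def)
  then show ?thesis using True assms by (cases "s < 0") (auto simp: ext_powr_def ennreal_mult_top ennreal_top_mult)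
next
  case False
  then have "0 < x" "0 < y" using assms by auto
  then show ?thesis by (simp add: ext_powr_pos powr_mult ennreal_mult)
qed

lemma ext_powr_1 [simp]: "ext_powr s 1 = 1"
  by (simp add: ext_powr_def)

lemma cgauss_norm_square_distributed:
  "distr cgauss lborel (\<lambda>z. (cmod z)\<^sup>2) = density lborel (\<lambda>r. ennreal (exponential_density 1 r))"
proof (rule measure_eqI)
  fix A assume "A \<in> sets (distr cgauss lborel (\<lambda>z. (cmod z)\<^sup>2))"
  then have A [measurable]: "A \<in> sets borel" by simp
  have [measurable]: "(\<lambda>z. (cmod z)\<^sup>2) \<in> cgauss \<rightarrow>\<^sub>M lborel" by measurable
  have "emeasure (distr cgauss lborel (\<lambda>z. (cmod z)\<^sup>2)) A = (\<integral>\<^sup>+z. indicator A ((cmod z)\<^sup>2) \<partial>cgauss)"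
    by (subst nn_integral_distr[symmetric, of "\<lambda>z. (cmod z)\<^sup>2" cgauss lborel "indicator A"]) auto
  also have "\<dots> = (\<integral>\<^sup>+r. ennreal (exponential_density 1 r) * indicator A r \<partial>lborel)"
    by (rule nn_integral_cgauss_radial) measurable
  finally show "emeasure (distr cgauss lborel (\<lambda>z. (cmod z)\<^sup>2)) A
      = emeasure (density lborel (\<lambda>r. ennreal (exponential_density 1 r))) A"
    by (simp add: emeasure_density)
qed simp

text \<open>The squared norm of an \<open>n\<close>-dimensional vector has the Erlang (Gamma) distribution of shape \<open>n\<close>.\<close>

lemma gauss_norm_square_moment:
  assumes n: "0 < n" and s: "- 1 < s"
  shows "(\<integral>\<^sup>+x. ext_powr s (\<Sum>i<n. (cmod (x i))\<^sup>2) \<partial>gauss {..<n}) = ennreal (Gamma (real n + s) / Gamma (real n))"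
proof -
  interpret prob_space "gauss {..<n}" by (rule prob_space_gauss)
  have comp: "(\<lambda>x. x i) \<in> gauss {..<n} \<rightarrow>\<^sub>M cgauss" if "i < n" for i
    using that by (intro measurable_component_singleton) simp
  have cd: "distr (gauss {..<n}) cgauss (\<lambda>x. x i) = cgauss" if "i < n" for i
    using that by (intro distr_PiM_component prob_space_cgauss) simp
  have "indep_vars (\<lambda>_. cgauss) (\<lambda>i x. x i) {..<n}"
  proof (subst indep_vars_iff_distr_eq_PiM')
    have "distr (gauss {..<n}) (gauss {..<n}) (\<lambda>x. \<lambda>i\<in>{..<n}. x i) = distr (gauss {..<n}) (gauss {..<n}) (\<lambda>x. x)"
      by (intro distr_cong refl) (auto simp: space_PiM PiE_def intro!: extensionalityI[of _ "{..<n}"])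
    also have "\<dots> = PiM {..<n} (\<lambda>i. distr (gauss {..<n}) cgauss (\<lambda>x. x i))"
    proof -
      have "gauss {..<n} = PiM {..<n} (\<lambda>i. distr (gauss {..<n}) cgauss (\<lambda>x. x i))"
        by (rule PiM_cong) (simp_all add: cd)
      then show ?thesis by (simp add: distr_id)
    qed
    finally show "distr (gauss {..<n}) (gauss {..<n}) (\<lambda>x. \<lambda>i\<in>{..<n}. x i)
        = PiM {..<n} (\<lambda>i. distr (gauss {..<n}) cgauss (\<lambda>x. x i))" .
  qed (use n comp in auto)
  then have indep: "indep_vars (\<lambda>_. borel) (\<lambda>i x. (cmod (x i))\<^sup>2) {..<n}"
    by (rule indep_vars_compose2[where Y = "\<lambda>_ z. (cmod z)\<^sup>2"]) measurable
  have exp: "distributed (gauss {..<n}) lborel (\<lambda>x. (cmod (x i))\<^sup>2) (exponential_density 1)" if i: "i \<in> {..<n}" for i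
  proof -
    have i': "i < n" using i by simp
    have m: "(\<lambda>z. (cmod z)\<^sup>2) \<in> cgauss \<rightarrow>\<^sub>M lborel" by measurable
    have "distr (gauss {..<n}) lborel (\<lambda>x. (cmod (x i))\<^sup>2) = distr (distr (gauss {..<n}) cgauss (\<lambda>x. x i)) lborel (\<lambda>z. (cmod z)\<^sup>2)"
      by (subst distr_distr[OF m comp[OF i']]) (simp add: o_def)
    then show ?thesis
      unfolding distributed_def using measurable_compose[OF comp[OF i'] m]
      by (simp add: cd[OF i'] cgauss_norm_square_distributed)
  qed
  have erl: "distributed (gauss {..<n}) lborel (\<lambda>x. \<Sum>i<n. (cmod (x i))\<^sup>2) (erlang_density (n - 1) 1)"
    using exponential_distributed_sum[OF _ _ _ exp indep] n lessThan_empty_iff[of n] by auto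
  have "(\<integral>\<^sup>+x. ext_powr s (\<Sum>i<n. (cmod (x i))\<^sup>2) \<partial>gauss {..<n})
      = (\<integral>\<^sup>+t. ennreal (erlang_density (n - 1) 1 t) * ext_powr s t \<partial>lborel)"
    by (rule distributed_nn_integral[OF erl, symmetric]) measurable
  also have "\<dots> = (\<integral>\<^sup>+t. ennreal (1 / Gamma (real n)) * (ennreal (t powr (real n + s - 1) / exp t) * indicator {0..} t) \<partial>lborel)"
  proof (rule nn_integral_cong_AE)
    have "AE t in lborel. t \<noteq> (0::real)" by (rule AE_lborel_singleton)
    then show "AE t in lborel. ennreal (erlang_density (n - 1) 1 t) * ext_powr s t
        = ennreal (1 / Gamma (real n)) * (ennreal (t powr (real n + s - 1) / exp t) * indicator {0..} t)"
    proof eventually_elim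
      case (elim t)
      show ?case
      proof (cases "t < 0")
        case False
        then have t: "0 < t" using elim by simp
        have "fact (n - 1) = Gamma (real n)" using n Gamma_fact[of "n - 1", where 'a = real] by simp
        then have "erlang_density (n - 1) 1 t * t powr s = 1 / Gamma (real n) * (t powr (real n + s - 1) / exp t)"
          using t n by (simp add: erlang_density_def exp_minus powr_realpow[symmetric] powr_add[symmetric] of_nat_diff field_simps)
        moreover have "0 \<le> erlang_density (n - 1) 1 t" by simp
        moreover have "0 \<le> 1 / Gamma (real n)" using n by (simp add: less_imp_le Gamma_real_pos)
        ultimately show ?thesis using t by (simp add: ext_powr_pos ennreal_mult[symmetric])
      qed (simp add: erlang_density_def)
    qed
  qed
  also have "\<dots> = ennreal (1 / Gamma (real n)) * (\<integral>\<^sup>+t. ennreal (t powr (real n + s - 1) / exp t) * indicator {0..} t \<partial>lborel)"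
    by (rule nn_integral_cmult) measurable
  also have "(\<integral>\<^sup>+t. ennreal (t powr (real n + s - 1) / exp t) * indicator {0..} t \<partial>lborel) = ennreal (Gamma (real n + s))"
    by (rule nn_integral_has_integral_lebesgue'[OF _ Gamma_integral_real]) (use n s in auto)
  also have "ennreal (1 / Gamma (real n)) * ennreal (Gamma (real n + s)) = ennreal (Gamma (real n + s) / Gamma (real n))"
    using n s by (subst ennreal_mult[symmetric]) (auto simp: less_imp_le Gamma_real_pos)
  finally show ?thesis .
qed

lemma borel_measurable_clebesgue: "borel_measurable (clebesgue K) = borel_measurable (gauss K)"
  by (rule measurable_cong_sets) (auto intro!: sets_PiM_cong)

lemma det_array_measurable:
  assumes "\<And>i j. i < n \<Longrightarrow> j < n \<Longrightarrow> e (i, j) \<in> K"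
  shows "(\<lambda>x. Determinant.det (Matrix.mat n n (\<lambda>p. x (e p)))) \<in> borel_measurable (gauss K)"
  by (rule det_measurable[of _ n]) (auto intro: gauss_component assms)

lemma ext_powr_det_array_measurable:
  assumes "\<And>i j. i < n \<Longrightarrow> j < n \<Longrightarrow> e (i, j) \<in> K"
  shows "(\<lambda>x. ext_powr s ((cmod (Determinant.det (Matrix.mat n n (\<lambda>p. x (e p)))))\<^sup>2)) \<in> borel_measurable (gauss K)"
  by (rule measurable_compose[OF _ ext_powr_measurable])
     (intro borel_measurable_power measurable_compose[OF _ borel_measurable_norm] det_array_measurable assms)

text \<open>A unitary matrix turns the first column into a multiple of the first basis vector without
  changing the law of the other columns; the determinant splits into the length of the first
  column and the determinant of a smaller square matrix.\<close>

lemma gauss_square_det_moment: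
  assumes s: "- 1 < s"
  shows "(\<integral>\<^sup>+x. ext_powr s ((cmod (Determinant.det (Matrix.mat k k x)))\<^sup>2) \<partial>gauss ({..<k} \<times> {..<k}))
    = ennreal (\<Prod>i = 1..k. Gamma (real i + s) / Gamma (real i))"
proof (induction k)
  case 0
  interpret prob_space "gauss ({..<0} \<times> {..<0} :: (nat \<times> nat) set)" by (rule prob_space_gauss)
  have "Determinant.det (Matrix.mat 0 0 x) = 1" for x :: "nat \<times> nat \<Rightarrow> complex" by simp
  then show ?case using emeasure_space_1 by (simp del: lessThan_0)
next
  case (Suc n)
  define K0 where "K0 = {..<Suc n} \<times> {0::nat}"
  define K1 where "K1 = {..<Suc n} \<times> {Suc 0..<Suc n}"
  define h where "h x = ext_powr s ((cmod (Determinant.det (Matrix.mat (Suc n) (Suc n) x)))\<^sup>2)"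
    for x :: "nat \<times> nat \<Rightarrow> complex"
  have K: "{..<Suc n} \<times> {..<Suc n} = K0 \<union> K1" "K0 \<inter> K1 = {}" "finite K0" "finite K1"
    by (auto simp: K0_def K1_def)
  have h_meas: "h \<in> borel_measurable (gauss (K0 \<union> K1))"
    unfolding h_def using ext_powr_det_array_measurable[of "Suc n" "\<lambda>p. p" "K0 \<union> K1"] K(1) by blast
  define m where "m Z = ext_powr s ((cmod (Determinant.det (Matrix.mat n n (\<lambda>(i, j). Z (Suc i, Suc j)))))\<^sup>2)"
    for Z :: "nat \<times> nat \<Rightarrow> complex"
  have m_eq: "m Z = ext_powr s ((cmod (Determinant.det (Matrix.mat n n (\<lambda>p. Z (map_prod Suc Suc p)))))\<^sup>2)" for Z
    by (simp add: m_def case_prod_unfold map_prod_def)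
  have m_meas: "m \<in> borel_measurable (gauss K1)"
    unfolding m_eq[abs_def] by (rule ext_powr_det_array_measurable) (auto simp: K1_def)
  \<comment> \<open>the integral over the other columns for a fixed first column \<open>x\<close>\<close>
  have inner: "(\<integral>\<^sup>+Z. h (merge K0 K1 (x, Z)) \<partial>gauss K1)
      = ext_powr s (\<Sum>i<Suc n. (cmod (x (i, 0)))\<^sup>2) * (\<integral>\<^sup>+Z. m Z \<partial>gauss K1)"
    if x: "x \<in> space (gauss K0)" for x
  proof -
    define v where "v = vec (Suc n) (\<lambda>i. x (i, 0))"
    have v: "v \<in> carrier_vec (Suc n)" by (simp add: v_def)
    obtain Q where Q: "unitary_mat (Suc n) Q"
      and Qv: "\<And>i. i < Suc n \<Longrightarrow> i \<noteq> 0 \<Longrightarrow> (mat_adjoint Q *\<^sub>v v) $ i = 0"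
    proof (cases "v = 0\<^sub>v (Suc n)")
      case True
      show thesis
        by (rule that[of "1\<^sub>m (Suc n)"]) (auto simp: unitary_mat_def True)
    next
      case False
      obtain Q c where Q: "unitary_mat (Suc n) Q" and c: "col Q 0 = c \<cdot>\<^sub>v v"
        using unitary_mat_with_first_col[OF v False] .
      note Q' = unitary_matD[OF Q]
      have "c \<cdot>\<^sub>v (mat_adjoint Q *\<^sub>v v) = mat_adjoint Q *\<^sub>v (c \<cdot>\<^sub>v v)"
        using mult_mat_vec[OF mat_adjoint_carrier[OF Q'(1)] v, of c] by simp
      also have "\<dots> = col (mat_adjoint Q * Q) 0"
        unfolding c[symmetric] by (rule col_mult2[symmetric, of _ "Suc n" "Suc n" _ "Suc n"]) (use Q'(1) in auto)
      also have "\<dots> = unit_vec (Suc n) 0" by (simp add: Q'(2))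
      finally have u: "c \<cdot>\<^sub>v (mat_adjoint Q *\<^sub>v v) = unit_vec (Suc n) 0" .
      have dim: "dim_vec (mat_adjoint Q *\<^sub>v v) = Suc n" using Q'(1) by simp
      have e: "c * (mat_adjoint Q *\<^sub>v v) $ i = unit_vec (Suc n) 0 $ i" if "i < Suc n" for i
        using arg_cong[OF u, of "\<lambda>w. w $ i"] that dim by simp
      have "c \<noteq> 0" using e[of 0] by auto
      then show thesis using that[OF Q] e by fastforce
    qed
    note Q' = unitary_matD[OF Q]
    define u where "u = mat_adjoint Q *\<^sub>v v"
    have Qu: "Q *\<^sub>v u = v"
      using assoc_mult_mat_vec[OF Q'(1) mat_adjoint_carrier[OF Q'(1)] v] Q'(3) v by (simp add: u_def)
    have udim: "u \<in> carrier_vec (Suc n)" using Q'(1) v by (simp add: u_def)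
    have norm_u: "(cmod (u $ 0))\<^sup>2 = (\<Sum>i<Suc n. (cmod (x (i, 0)))\<^sup>2)"
    proof -
      have "complex_of_real (\<Sum>i<Suc n. (cmod (x (i, 0)))\<^sup>2) = v \<bullet>c v"
        using cscalar_prod_self[OF v] by (simp add: v_def)
      also have "\<dots> = (eigen_mat (Suc n) Q (\<lambda>_. 1) *\<^sub>v v) \<bullet>c v"
      proof -
        have "eigen_mat (Suc n) Q (\<lambda>_. 1) = 1\<^sub>m (Suc n)"
          unfolding eigen_mat_const[OF Q] by (rule eq_matI) auto
        then show ?thesis using v by simp
      qed
      also have "\<dots> = complex_of_real (\<Sum>i<Suc n. (cmod (u $ i))\<^sup>2)"
        by (subst eigen_mat_form[OF Q v]) (simp add: u_def)
      finally have "(\<Sum>i<Suc n. (cmod (x (i, 0)))\<^sup>2) = (\<Sum>i<Suc n. (cmod (u $ i))\<^sup>2)"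
        by (simp only: of_real_eq_iff)
      also have "\<dots> = (\<Sum>i<Suc n. if i = 0 then (cmod (u $ 0))\<^sup>2 else 0)"
        by (intro sum.cong refl) (auto simp: u_def Qv)
      finally show ?thesis by simp
    qed
    define F where "F Z = h (merge K0 K1 (x, Z))" for Z
    have F: "F \<in> borel_measurable (gauss K1)"
    proof -
      have "(\<lambda>Z. merge K0 K1 (x, Z)) \<in> gauss K1 \<rightarrow>\<^sub>M gauss (K0 \<union> K1)"
        using x by (intro measurable_compose[OF measurable_Pair1' measurable_merge])
      from measurable_compose[OF this h_meas] show ?thesis unfolding F_def[abs_def] .
    qed
    have step: "F (\<lambda>(i, a)\<in>K1. \<Sum>j<Suc n. Q $$ (i, j) * Z (j, a))
        = ext_powr s (\<Sum>i<Suc n. (cmod (x (i, 0)))\<^sup>2) * m Z" for Z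
    proof -
      define A where "A = Matrix.mat (Suc n) (Suc n) (\<lambda>(i, j). if j = 0 then u $ i else Z (i, j))"
      have A: "A \<in> carrier_mat (Suc n) (Suc n)" by (simp add: A_def)
      have "Matrix.mat (Suc n) (Suc n) (merge K0 K1 (x, \<lambda>(i, a)\<in>K1. \<Sum>j<Suc n. Q $$ (i, j) * Z (j, a))) = Q * A"
      proof (rule eq_matI, goal_cases)
        case (1 i j)
        then have ij: "i < Suc n" "j < Suc n" using Q'(1) A by auto
        have QA: "(Q * A) $$ (i, j) = (\<Sum>l<Suc n. Q $$ (i, l) * A $$ (l, j))"
          using Q'(1) A ij by (simp add: scalar_prod_def atLeast0LessThan)
        show ?case
        proof (cases "j = 0")
          case True
          have "(\<Sum>l<Suc n. Q $$ (i, l) * A $$ (l, j)) = (Q *\<^sub>v u) $ i"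
            using Q'(1) udim ij True by (simp add: A_def scalar_prod_def atLeast0LessThan)
          also have "\<dots> = x (i, 0)" unfolding Qu using ij by (simp add: v_def)
          finally show ?thesis unfolding QA using True ij by (simp add: merge_def K0_def)
        next
          case False
          then have "(i, j) \<in> K1" "(i, j) \<notin> K0" using ij by (auto simp: K1_def K0_def)
          then show ?thesis unfolding QA using False ij by (simp add: merge_def A_def)
        qed
      qed (use Q'(1) A in auto)
      then have F_eq: "F (\<lambda>(i, a)\<in>K1. \<Sum>j<Suc n. Q $$ (i, j) * Z (j, a)) = ext_powr s ((cmod (Determinant.det (Q * A)))\<^sup>2)"
        by (simp only: F_def h_def)
      have "cnj (Determinant.det Q) * Determinant.det Q = 1"
        using det_mult[of "mat_adjoint Q" "Suc n" Q] Q' by (simp add: det_mat_adjoint)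
      then have "(complex_of_real (cmod (Determinant.det Q)))\<^sup>2 = 1" by (simp only: cnj_times_self)
      then have detQ: "(cmod (Determinant.det Q))\<^sup>2 = 1"
        by (metis of_real_eq_1_iff of_real_power)
      have "Determinant.det A = (\<Sum>i<Suc n. A $$ (i, 0) * cofactor A i 0)"
        by (rule laplace_expansion_column[OF A]) simp
      also have "\<dots> = (\<Sum>i<Suc n. if i = 0 then u $ 0 * cofactor A 0 0 else 0)"
        by (intro sum.cong refl) (auto simp: A_def u_def Qv)
      also have "\<dots> = u $ 0 * cofactor A 0 0" by simp
      also have "cofactor A 0 0 = Determinant.det (Matrix.mat n n (\<lambda>(i, j). Z (Suc i, Suc j)))"
        unfolding cofactor_def mat_delete_def by (auto simp: A_def intro!: arg_cong[where f = Determinant.det] eq_matI)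
      finally have "(cmod (Determinant.det (Q * A)))\<^sup>2
          = (cmod (u $ 0))\<^sup>2 * (cmod (Determinant.det (Matrix.mat n n (\<lambda>(i, j). Z (Suc i, Suc j)))))\<^sup>2"
        using det_mult[OF Q'(1) A] detQ by (simp add: norm_mult power_mult_distrib)
      then show ?thesis unfolding F_eq m_def norm_u[symmetric] by (simp add: ext_powr_mult)
    qed
    have "(\<integral>\<^sup>+Z. F Z \<partial>gauss K1) = (\<integral>\<^sup>+Z. F (\<lambda>(i, a)\<in>K1. \<Sum>j<Suc n. Q $$ (i, j) * Z (j, a)) \<partial>gauss K1)"
      using gauss_left_unitary[OF Q, of "{Suc 0..<Suc n}" F] F
      by (simp add: K1_def borel_measurable_clebesgue)
    also have "\<dots> = ext_powr s (\<Sum>i<Suc n. (cmod (x (i, 0)))\<^sup>2) * (\<integral>\<^sup>+Z. m Z \<partial>gauss K1)"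
      unfolding step by (rule nn_integral_cmult[OF m_meas])
    finally show ?thesis by (simp only: F_def)
  qed
  have minor: "(\<integral>\<^sup>+Z. m Z \<partial>gauss K1) = ennreal (\<Prod>i = 1..n. Gamma (real i + s) / Gamma (real i))"
  proof -
    have "gauss ({..<n} \<times> {..<n}) = distr (gauss K1) (gauss ({..<n} \<times> {..<n}))
        (\<lambda>\<omega>. \<lambda>p\<in>{..<n} \<times> {..<n}. \<omega> (map_prod Suc Suc p))" (is "_ = distr _ _ ?t")
      by (rule distr_PiM_reindex[symmetric]) (auto simp: K1_def prob_space_cgauss inj_on_def)
    then have "(\<integral>\<^sup>+x. ext_powr s ((cmod (Determinant.det (Matrix.mat n n x)))\<^sup>2) \<partial>gauss ({..<n} \<times> {..<n}))
        = (\<integral>\<^sup>+x. ext_powr s ((cmod (Determinant.det (Matrix.mat n n x)))\<^sup>2)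
            \<partial>distr (gauss K1) (gauss ({..<n} \<times> {..<n})) ?t)"
      by (rule arg_cong[where f = "\<lambda>M. \<integral>\<^sup>+x. ext_powr s ((cmod (Determinant.det (Matrix.mat n n x)))\<^sup>2) \<partial>M"])
    also have "\<dots> = (\<integral>\<^sup>+Z. ext_powr s ((cmod (Determinant.det (Matrix.mat n n (?t Z))))\<^sup>2) \<partial>gauss K1)"
    proof (rule nn_integral_distr)
      show "?t \<in> gauss K1 \<rightarrow>\<^sub>M gauss ({..<n} \<times> {..<n})"
        by (intro measurable_restrict measurable_component_singleton) (auto simp: K1_def)
      show "(\<lambda>x. ext_powr s ((cmod (Determinant.det (Matrix.mat n n x)))\<^sup>2))
          \<in> borel_measurable (distr (gauss K1) (gauss ({..<n} \<times> {..<n})) ?t)"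
        unfolding measurable_distr_eq1 by (rule ext_powr_det_array_measurable[where e = "\<lambda>p. p"]) auto
    qed
    also have "\<dots> = (\<integral>\<^sup>+Z. m Z \<partial>gauss K1)"
    proof (rule nn_integral_cong)
      fix Z
      have "Matrix.mat n n (?t Z) = Matrix.mat n n (\<lambda>p. Z (map_prod Suc Suc p))"
        by (rule eq_matI) auto
      then show "ext_powr s ((cmod (Determinant.det (Matrix.mat n n (?t Z))))\<^sup>2) = m Z"
        by (simp only: m_eq)
    qed
    finally show ?thesis using Suc.IH by simp
  qed
  have first: "(\<integral>\<^sup>+x. ext_powr s (\<Sum>i<Suc n. (cmod (x (i, 0)))\<^sup>2) \<partial>gauss K0)
      = ennreal (Gamma (real (Suc n) + s) / Gamma (real (Suc n)))"
  proof -
    have "gauss {..<Suc n} = distr (gauss K0) (gauss {..<Suc n}) (\<lambda>\<omega>. \<lambda>i\<in>{..<Suc n}. \<omega> (i, 0))"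
      (is "_ = distr _ _ ?t")
      by (rule distr_PiM_reindex[symmetric]) (auto simp: K0_def prob_space_cgauss inj_on_def)
    then have "(\<integral>\<^sup>+x. ext_powr s (\<Sum>i<Suc n. (cmod (x i))\<^sup>2) \<partial>gauss {..<Suc n})
        = (\<integral>\<^sup>+x. ext_powr s (\<Sum>i<Suc n. (cmod (x i))\<^sup>2) \<partial>distr (gauss K0) (gauss {..<Suc n}) ?t)"
      by (rule arg_cong[where f = "\<lambda>M. \<integral>\<^sup>+x. ext_powr s (\<Sum>i<Suc n. (cmod (x i))\<^sup>2) \<partial>M"])
    also have "\<dots> = (\<integral>\<^sup>+x. ext_powr s (\<Sum>i<Suc n. (cmod (?t x i))\<^sup>2) \<partial>gauss K0)"
    proof (rule nn_integral_distr)
      show "?t \<in> gauss K0 \<rightarrow>\<^sub>M gauss {..<Suc n}"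
        by (intro measurable_restrict measurable_component_singleton) (auto simp: K0_def)
      show "(\<lambda>x. ext_powr s (\<Sum>i<Suc n. (cmod (x i))\<^sup>2)) \<in> borel_measurable (distr (gauss K0) (gauss {..<Suc n}) ?t)"
        unfolding measurable_distr_eq1 by (rule measurable_compose[OF _ ext_powr_measurable])
           (intro borel_measurable_sum borel_measurable_power measurable_compose[OF _ borel_measurable_norm] gauss_component)
    qed
    also have "\<dots> = (\<integral>\<^sup>+x. ext_powr s (\<Sum>i<Suc n. (cmod (x (i, 0)))\<^sup>2) \<partial>gauss K0)"
      by (intro nn_integral_cong arg_cong[where f = "ext_powr s"] sum.cong refl) simp
    finally show ?thesis using gauss_norm_square_moment[of "Suc n" s] s by (simp only: zero_less_Suc)
  qed
  have fm: "(\<lambda>x. ext_powr s (\<Sum>i<Suc n. (cmod (x (i, 0)))\<^sup>2)) \<in> borel_measurable (gauss K0)"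
    by (rule measurable_compose[OF _ ext_powr_measurable],
        intro borel_measurable_sum borel_measurable_power measurable_compose[OF _ borel_measurable_norm] gauss_component)
       (auto simp: K0_def)
  have "(\<integral>\<^sup>+x. h x \<partial>gauss (K0 \<union> K1)) = (\<integral>\<^sup>+x. \<integral>\<^sup>+Z. h (merge K0 K1 (x, Z)) \<partial>gauss K1 \<partial>gauss K0)"
    by (rule gauss.product_nn_integral_fold[OF K(2,3,4) h_meas])
  also have "\<dots> = (\<integral>\<^sup>+x. ext_powr s (\<Sum>i<Suc n. (cmod (x (i, 0)))\<^sup>2) * (\<integral>\<^sup>+Z. m Z \<partial>gauss K1) \<partial>gauss K0)"
    by (rule nn_integral_cong) (rule inner)
  also have "\<dots> = (\<integral>\<^sup>+x. ext_powr s (\<Sum>i<Suc n. (cmod (x (i, 0)))\<^sup>2) \<partial>gauss K0) * (\<integral>\<^sup>+Z. m Z \<partial>gauss K1)"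
    by (rule nn_integral_multc[OF fm])
  also have "\<dots> = ennreal (\<Prod>i = 1..Suc n. Gamma (real i + s) / Gamma (real i))"
    unfolding first minor using s
    by (subst ennreal_mult[symmetric])
       (auto simp: mult.commute intro!: prod_nonneg divide_nonneg_nonneg less_imp_le[OF Gamma_real_pos])
  finally show ?case unfolding K(1) h_def .
qed

section \<open>Moments of the Gram determinant\<close>

lemma gauss_array_eq_rows:
  assumes f: "f \<in> borel_measurable (gauss ({..<m} \<times> {..<k}))"
  shows "(\<integral>\<^sup>+x. f x \<partial>gauss ({..<m} \<times> {..<k}))
    = (\<integral>\<^sup>+x. f (\<lambda>(i, a)\<in>{..<m} \<times> {..<k}. x i a) \<partial>gauss_rows m k)"
proof -
  let ?K = "{..<m} \<times> {..<k}"
  let ?t = "\<lambda>x. \<lambda>(i, a)\<in>?K. x i a :: complex"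
  interpret rows: product_sigma_finite "\<lambda>_. gauss {..<k}"
    by (intro product_sigma_finite.intro prob_space_imp_sigma_finite prob_space_gauss)
  have t: "?t \<in> gauss_rows m k \<rightarrow>\<^sub>M gauss ?K"
    by (intro measurable_restrict) (auto simp: measurable_cgauss_borel intro!: gauss_rows_component)
  have "distr (gauss_rows m k) (gauss ?K) ?t = gauss ?K"
  proof (rule gauss.PiM_eqI)
    fix A :: "nat \<times> nat \<Rightarrow> complex set" assume A: "\<And>p. p \<in> ?K \<Longrightarrow> A p \<in> sets cgauss"
    have "?t -` Pi\<^sub>E ?K A \<inter> space (gauss_rows m k) = (\<Pi>\<^sub>E i\<in>{..<m}. \<Pi>\<^sub>E a\<in>{..<k}. A (i, a))"
    proof (intro Set.set_eqI iffI)
      fix x assume "x \<in> ?t -` Pi\<^sub>E ?K A \<inter> space (gauss_rows m k)"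
      then have x: "x \<in> (\<Pi>\<^sub>E i\<in>{..<m}. \<Pi>\<^sub>E a\<in>{..<k}. UNIV)" and tx: "?t x \<in> Pi\<^sub>E ?K A"
        by (auto simp: space_PiM)
      have "x i a \<in> A (i, a)" if "i < m" "a < k" for i a
        using PiE_mem[OF tx, of "(i, a)"] that by simp
      then show "x \<in> (\<Pi>\<^sub>E i\<in>{..<m}. \<Pi>\<^sub>E a\<in>{..<k}. A (i, a))"
        using x by (auto simp: PiE_iff)
    next
      fix x assume x: "x \<in> (\<Pi>\<^sub>E i\<in>{..<m}. \<Pi>\<^sub>E a\<in>{..<k}. A (i, a))"
      then have "x \<in> space (gauss_rows m k)" by (auto simp: space_PiM PiE_iff)
      moreover have "?t x \<in> Pi\<^sub>E ?K A" using x by (auto simp: PiE_iff)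
      ultimately show "x \<in> ?t -` Pi\<^sub>E ?K A \<inter> space (gauss_rows m k)" by simp
    qed
    then have "emeasure (distr (gauss_rows m k) (gauss ?K) ?t) (Pi\<^sub>E ?K A)
        = emeasure (gauss_rows m k) (\<Pi>\<^sub>E i\<in>{..<m}. \<Pi>\<^sub>E a\<in>{..<k}. A (i, a))"
      using A by (subst emeasure_distr[OF t]) (auto intro!: sets_PiM_I_finite)
    also have "\<dots> = (\<Prod>i<m. emeasure (gauss {..<k}) (\<Pi>\<^sub>E a\<in>{..<k}. A (i, a)))"
      using A by (intro rows.emeasure_PiM sets_PiM_I_finite) auto
    also have "\<dots> = (\<Prod>i<m. \<Prod>a<k. emeasure cgauss (A (i, a)))"
      using A by (intro prod.cong refl gauss.emeasure_PiM) auto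
    also have "\<dots> = (\<Prod>p\<in>?K. emeasure cgauss (A p))"
      by (simp add: prod.cartesian_product)
    finally show "emeasure (distr (gauss_rows m k) (gauss ?K) ?t) (Pi\<^sub>E ?K A) = (\<Prod>p\<in>?K. emeasure cgauss (A p))" .
  qed auto
  then show ?thesis using nn_integral_distr[OF t, of f] f by simp
qed

lemma det_gram_mat_square:
  "Determinant.det (gram_mat k {..<k} v z)
    = of_real ((\<Prod>a<k. v a) * (cmod (Determinant.det (Matrix.mat k k (\<lambda>(a, b). z a b))))\<^sup>2)"
proof -
  define Y where "Y = Matrix.mat k k (\<lambda>(a, b). z a b)"
  have Y: "Y \<in> carrier_mat k k" by (simp add: Y_def)
  have "gram_mat k {..<k} v z = mat_adjoint Y * (mat_diag k (\<lambda>a. complex_of_real (v a)) * Y)"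
    unfolding mat_diag_mult_left[OF Y]
    by (rule eq_matI) (auto simp: gram_mat_def Y_def scalar_prod_def atLeast0LessThan mult_ac intro!: sum.cong)
  then have "Determinant.det (gram_mat k {..<k} v z)
      = cnj (Determinant.det Y) * ((\<Prod>a<k. complex_of_real (v a)) * Determinant.det Y)"
    using Y by (simp add: det_mult[of _ k] det_mat_adjoint det_mat_diag)
  also have "\<dots> = (\<Prod>a<k. complex_of_real (v a)) * (cnj (Determinant.det Y) * Determinant.det Y)"
    by simp
  finally show ?thesis by (simp add: cnj_times_self Y_def)
qed

text \<open>With only \<open>k\<close> rows left, the Gram matrix is a product of square matrices.\<close>

lemma gram_det_restrict_weight:
  assumes \<sigma>: "\<sigma> permutes {..<d}" and k: "k \<le> d"
  shows "gram_det d k (restrict_weight k \<sigma> w) x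
    = (\<Prod>i<d. if \<sigma> i < k then w i else 1) * (cmod (Determinant.det (Matrix.mat k k (\<lambda>(a, b). x (inv_into UNIV \<sigma> a) b))))\<^sup>2"
proof -
  have inv_in: "inv_into UNIV \<sigma> a < d" if "a < d" for a
    using permutes_in_image[OF permutes_inv[OF \<sigma>], of a] that by simp
  have bij: "bij_betw (inv_into UNIV \<sigma>) {..<k} {i \<in> {..<d}. \<sigma> i < k}"
    by (rule bij_betwI[where g = \<sigma>]) (use inv_in k permutes_inverses[OF \<sigma>] in auto)
  have "gram_mat k {..<d} (restrict_weight k \<sigma> w) x = gram_mat k {..<k} (\<lambda>a. w (inv_into UNIV \<sigma> a)) (\<lambda>a. x (inv_into UNIV \<sigma> a))"
  proof (rule eq_matI, goal_cases)
    case (1 a b)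
    then have ab: "a < k" "b < k" by (auto simp: gram_mat_def)
    have "(\<Sum>c<d. of_real (restrict_weight k \<sigma> w c) * cnj (x c a) * x c b)
        = (\<Sum>c\<in>{i \<in> {..<d}. \<sigma> i < k}. of_real (w c) * cnj (x c a) * x c b)"
      unfolding sum.inter_filter[OF finite_lessThan] by (intro sum.cong) (auto simp: restrict_weight_def)
    also have "\<dots> = (\<Sum>c<k. of_real (w (inv_into UNIV \<sigma> c)) * cnj (x (inv_into UNIV \<sigma> c) a) * x (inv_into UNIV \<sigma> c) b)"
      by (rule sum.reindex_bij_betw[OF bij, symmetric])
    finally show ?case using ab by (simp add: gram_mat_def)
  qed (auto simp: gram_mat_def)
  moreover have "(\<Prod>a<k. w (inv_into UNIV \<sigma> a)) = (\<Prod>i<d. if \<sigma> i < k then w i else 1)"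
  proof -
    have "(\<Prod>a<k. w (inv_into UNIV \<sigma> a)) = (\<Prod>i\<in>{i \<in> {..<d}. \<sigma> i < k}. w i)"
      by (rule prod.reindex_bij_betw[OF bij])
    also have "\<dots> = (\<Prod>i<d. if \<sigma> i < k then w i else 1)"
      by (rule prod.inter_filter) simp
    finally show ?thesis .
  qed
  ultimately show ?thesis by (simp only: gram_det_def det_gram_mat_square Re_complex_of_real)
qed

lemma gauss_rows_square_det_moment:
  assumes \<sigma>: "\<sigma> permutes {..<d}" and k: "k \<le> d" and s: "- 1 < s"
  shows "(\<integral>\<^sup>+x. ext_powr s ((cmod (Determinant.det (Matrix.mat k k (\<lambda>(a, b). x (inv_into UNIV \<sigma> a) b))))\<^sup>2) \<partial>gauss_rows d k)
    = ennreal (\<Prod>i = 1..k. Gamma (real i + s) / Gamma (real i))"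
proof -
  define g where "g y = ext_powr s ((cmod (Determinant.det (Matrix.mat k k (\<lambda>(a, b). y a b))))\<^sup>2)"
    for y :: "nat \<Rightarrow> nat \<Rightarrow> complex"
  have inv_in: "inv_into UNIV \<sigma> a < d" if "a < k" for a
    using permutes_in_image[OF permutes_inv[OF \<sigma>], of a] that k by simp
  have inj: "inj (inv_into UNIV \<sigma>)" using permutes_inj[OF permutes_inv[OF \<sigma>]] .
  have gm: "g \<in> borel_measurable (gauss_rows k k)"
    unfolding g_def
    by (intro measurable_compose[OF _ ext_powr_measurable] borel_measurable_power
        measurable_compose[OF _ borel_measurable_norm] det_measurable[of _ k])
       (auto intro: gauss_rows_component)
  let ?t = "\<lambda>x. \<lambda>a\<in>{..<k}. x (inv_into UNIV \<sigma> a)"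
  have t: "?t \<in> gauss_rows d k \<rightarrow>\<^sub>M gauss_rows k k"
    by (intro measurable_restrict measurable_component_singleton) (use inv_in in auto)
  have "distr (gauss_rows d k) (gauss_rows k k) ?t = gauss_rows k k"
    by (rule distr_PiM_reindex) (use inv_in inj prob_space_gauss in \<open>auto intro: inj_on_subset\<close>)
  then have "(\<integral>\<^sup>+y. g y \<partial>gauss_rows k k) = (\<integral>\<^sup>+x. g (?t x) \<partial>gauss_rows d k)"
    using nn_integral_distr[OF t, of g] gm by simp
  moreover have "g (?t x) = ext_powr s ((cmod (Determinant.det (Matrix.mat k k (\<lambda>(a, b). x (inv_into UNIV \<sigma> a) b))))\<^sup>2)" for x
  proof -
    have "Matrix.mat k k (\<lambda>(a, b). ?t x a b) = Matrix.mat k k (\<lambda>(a, b). x (inv_into UNIV \<sigma> a) b)"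
      by (rule eq_matI) auto
    then show ?thesis by (simp only: g_def)
  qed
  moreover have "(\<integral>\<^sup>+y. g y \<partial>gauss_rows k k) = ennreal (\<Prod>i = 1..k. Gamma (real i + s) / Gamma (real i))"
  proof -
    have "ennreal (\<Prod>i = 1..k. Gamma (real i + s) / Gamma (real i))
        = (\<integral>\<^sup>+x. ext_powr s ((cmod (Determinant.det (Matrix.mat k k x)))\<^sup>2) \<partial>gauss ({..<k} \<times> {..<k}))"
      by (rule gauss_square_det_moment[OF s, symmetric])
    also have "\<dots> = (\<integral>\<^sup>+x. ext_powr s ((cmod (Determinant.det (Matrix.mat k k (\<lambda>(i, a)\<in>{..<k} \<times> {..<k}. x i a))))\<^sup>2) \<partial>gauss_rows k k)"
      by (rule gauss_array_eq_rows) (rule ext_powr_det_array_measurable[where e = "\<lambda>p. p"], auto)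
    also have "\<dots> = (\<integral>\<^sup>+y. g y \<partial>gauss_rows k k)"
    proof (rule nn_integral_cong)
      fix x
      have "Matrix.mat k k (\<lambda>(i, a)\<in>{..<k} \<times> {..<k}. x i a) = Matrix.mat k k (\<lambda>(i, a). x i a)"
        for x :: "nat \<Rightarrow> nat \<Rightarrow> complex"
        by (rule eq_matI) auto
      then show "ext_powr s ((cmod (Determinant.det (Matrix.mat k k (\<lambda>(i, a)\<in>{..<k} \<times> {..<k}. x i a))))\<^sup>2) = g x"
        by (simp only: g_def)
    qed
    finally show ?thesis ..
  qed
  ultimately show ?thesis by simp
qed

text \<open>The mixture of the \<open>s\<close>-th moments of the Gram determinants formed from the \<open>k\<close> rows in
  \<open>{i. \<sigma> i < k}\<close>: each of these is the \<open>s\<close>-th power of the product of the chosen weights times a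
  moment that depends on \<open>k\<close> only.\<close>

definition det_moment :: "nat \<Rightarrow> nat \<Rightarrow> (nat \<Rightarrow> real) \<Rightarrow> real \<Rightarrow> real" where
  "det_moment d k \<eta> s = (\<Prod>i = 1..k. Gamma (real i + s) / Gamma (real i)) *
    (\<Sum>\<sigma> | \<sigma> permutes {..<d}. vandermonde_weight d \<eta> \<sigma> * (\<Prod>i<d. if \<sigma> i < k then 1 / \<eta> i else 1) powr s)"

lemma clamp_powr_le:
  assumes "1 \<le> K" "0 < x"
  shows "clamp_powr s K x \<le> 1 + x powr s"
proof -
  have Kp: "0 < K" "1 / K \<le> 1" using assms by auto
  define u where "u = max (1 / K) (min x K)"
  have u: "0 < u" using Kp by (simp add: u_def less_max_iff_disj)
  have "1 / K \<le> max 1 x" "min x K \<le> max 1 x" using Kp by (auto simp: max.coboundedI1 max.coboundedI2 min.coboundedI1)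
  then have "u \<le> max 1 x" by (simp add: u_def)
  have "min 1 x \<le> min x K" using assms by auto
  then have "min 1 x \<le> u" by (simp add: u_def max.coboundedI2)
  consider "0 \<le> s" | "s < 0" by linarith
  then have "u powr s \<le> max 1 (x powr s)"
  proof cases
    case 1
    have "u powr s \<le> (max 1 x) powr s" using \<open>u \<le> max 1 x\<close> u 1 by (intro powr_mono2) auto
    then show ?thesis by (auto simp: max_def split: if_splits)
  next
    case 2
    have "u powr s \<le> (min 1 x) powr s" using \<open>min 1 x \<le> u\<close> assms 2 by (intro powr_mono2') auto
    then show ?thesis by (auto simp: min_def split: if_splits)
  qed
  also have "\<dots> \<le> 1 + x powr s" by simp
  finally show ?thesis by (simp add: clamp_powr_def u_def)
qed

lemma clamp_powr_eventually_eq: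
  assumes "0 < x"
  shows "eventually (\<lambda>p. clamp_powr s (real (Suc p)) x = x powr s) sequentially"
proof -
  obtain n where n: "max x (1 / x) < real n" using reals_Archimedean2 by blast
  have "clamp_powr s (real (Suc p)) x = x powr s" if "n \<le> p" for p
  proof -
    have p: "x < real (Suc p)" "1 / x < real (Suc p)" using n that by auto
    then have "1 / real (Suc p) < x" using assms by (simp add: field_simps)
    then show ?thesis using p by (simp add: clamp_powr_def)
  qed
  then show ?thesis by (auto simp: eventually_sequentially)
qed

text \<open>Letting the clamping level tend to infinity turns \<open>gram_det_mixture_clamp\<close> into a statement on
  powers. The terms of the mixture have explicit moments and converge by domination; on the other
  side Fatou's lemma gives an inequality, which is all that Markov's inequality needs later.\<close>

lemma gram_det_moment_bound:
  assumes inj: "inj_on \<eta> {..<d}" and pos: "\<And>i. i < d \<Longrightarrow> 0 < \<eta> i" and k: "k \<le> d" and s: "- 1 < s"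
  shows "(\<integral>\<^sup>+x. ext_powr s (gram_det d k (\<lambda>i. 1 / \<eta> i) x) \<partial>gauss_rows d k) \<le> ennreal (det_moment d k \<eta> s)"
proof -
  interpret prob_space "gauss_rows d k" by (rule prob_space_gauss_rows)
  define w where "w i = 1 / \<eta> i" for i
  have w: "0 \<le> w i" if "i < d" for i using pos[OF that] by (simp add: w_def)
  have w': "0 \<le> restrict_weight k \<sigma> w i" if "i < d" for \<sigma> i using w[OF that] by (simp add: restrict_weight_def)
  define c where "c s = (\<Prod>i = 1..k. Gamma (real i + s) / Gamma (real i))" for s
  define \<tau> where "\<tau> \<sigma> = (\<Prod>i<d. if \<sigma> i < k then w i else 1)" for \<sigma>
  have \<tau>: "0 < \<tau> \<sigma>" for \<sigma> unfolding \<tau>_def w_def by (intro prod_pos) (use pos in auto)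
  have cm [measurable]: "clamp_powr s (real (Suc p)) \<in> borel_measurable borel" for p
    by (intro borel_measurable_continuous_onI clamp_powr_continuous) simp
  define X where "X \<sigma> = gram_det d k (restrict_weight k \<sigma> w)" for \<sigma>
  have Xm [measurable]: "X \<sigma> \<in> borel_measurable (gauss_rows d k)" for \<sigma> unfolding X_def by measurable
  have X0: "0 \<le> X \<sigma> x" for \<sigma> x unfolding X_def by (rule gram_det_nonneg) (rule w')
  have Xmom: "(\<integral>\<^sup>+x. ext_powr t (X \<sigma> x) \<partial>gauss_rows d k) = ennreal (\<tau> \<sigma> powr t * c t)"
    if \<sigma>: "\<sigma> permutes {..<d}" and t: "- 1 < t" for \<sigma> t
  proof -
    let ?q = "\<lambda>x. (cmod (Determinant.det (Matrix.mat k k (\<lambda>(a, b). x (inv_into UNIV \<sigma> a) b))))\<^sup>2"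
    have inv_in: "inv_into UNIV \<sigma> a < d" if "a < k" for a
      using permutes_in_image[OF permutes_inv[OF \<sigma>], of a] that k by simp
    have qm: "(\<lambda>x. ext_powr t (?q x)) \<in> borel_measurable (gauss_rows d k)"
      by (intro measurable_compose[OF _ ext_powr_measurable] borel_measurable_power
          measurable_compose[OF _ borel_measurable_norm] det_measurable[of _ k])
         (auto intro: gauss_rows_component inv_in)
    have "(\<integral>\<^sup>+x. ext_powr t (X \<sigma> x) \<partial>gauss_rows d k) = (\<integral>\<^sup>+x. ext_powr t (\<tau> \<sigma>) * ext_powr t (?q x) \<partial>gauss_rows d k)"
      unfolding X_def gram_det_restrict_weight[OF \<sigma> k] \<tau>_def[symmetric]
      by (intro nn_integral_cong ext_powr_mult) (use \<tau> in \<open>auto intro: less_imp_le\<close>)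
    also have "\<dots> = ext_powr t (\<tau> \<sigma>) * ennreal (c t)"
      unfolding c_def gauss_rows_square_det_moment[OF \<sigma> k t, symmetric] by (rule nn_integral_cmult[OF qm])
    finally show ?thesis
      using \<tau> t by (subst ennreal_mult) (auto simp: ext_powr_pos c_def intro!: prod_nonneg divide_nonneg_nonneg less_imp_le[OF Gamma_real_pos])
  qed
  \<comment> \<open>a negative moment is finite, so the determinant is almost surely nonzero\<close>
  have Xpos: "AE x in gauss_rows d k. 0 < X \<sigma> x" if \<sigma>: "\<sigma> permutes {..<d}" for \<sigma>
  proof -
    have "AE x in gauss_rows d k. ext_powr (- 1 / 2) (X \<sigma> x) \<noteq> \<infinity>"
      by (rule nn_integral_noteq_infinite) (use Xmom[OF \<sigma>, of "- 1 / 2"] in auto)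
    then show ?thesis by eventually_elim (auto simp: ext_powr_def not_le split: if_splits)
  qed
  have lim: "(\<lambda>p. LINT x|(gauss_rows d k). clamp_powr s (real (Suc p)) (X \<sigma> x)) \<longlonglongrightarrow> \<tau> \<sigma> powr s * c s"
    if \<sigma>: "\<sigma> permutes {..<d}" for \<sigma>
  proof -
    have c0: "0 \<le> \<tau> \<sigma> powr s * c s" using \<tau>[of \<sigma>] s
      by (auto simp: c_def intro!: mult_nonneg_nonneg prod_nonneg divide_nonneg_nonneg less_imp_le[OF Gamma_real_pos])
    have "(\<integral>\<^sup>+x. ennreal (X \<sigma> x powr s) \<partial>gauss_rows d k) = ennreal (\<tau> \<sigma> powr s * c s)"
      unfolding Xmom[OF \<sigma> s, symmetric]
      by (rule nn_integral_cong_AE) (use Xpos[OF \<sigma>] in eventually_elim, simp add: ext_powr_pos)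
    then have hb: "has_bochner_integral (gauss_rows d k) (\<lambda>x. X \<sigma> x powr s) (\<tau> \<sigma> powr s * c s)"
      using c0 by (intro has_bochner_integral_nn_integral) auto
    have "(\<lambda>p. LINT x|(gauss_rows d k). clamp_powr s (real (Suc p)) (X \<sigma> x)) \<longlonglongrightarrow> (LINT x|(gauss_rows d k). X \<sigma> x powr s)"
    proof (rule integral_dominated_convergence[where w = "\<lambda>x. 1 + X \<sigma> x powr s"])
      show "integrable (gauss_rows d k) (\<lambda>x. 1 + X \<sigma> x powr s)"
        using hb by (intro Bochner_Integration.integrable_add) (auto simp: has_bochner_integral_iff)
      show "AE x in gauss_rows d k. (\<lambda>p. clamp_powr s (real (Suc p)) (X \<sigma> x)) \<longlonglongrightarrow> X \<sigma> x powr s"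
        using Xpos[OF \<sigma>] by eventually_elim (rule tendsto_eventually, rule clamp_powr_eventually_eq)
      show "AE x in gauss_rows d k. norm (clamp_powr s (real (Suc p)) (X \<sigma> x)) \<le> 1 + X \<sigma> x powr s" for p
        using Xpos[OF \<sigma>]
      proof eventually_elim
        case (elim x)
        have "0 \<le> clamp_powr s (real (Suc p)) (X \<sigma> x)" by (simp add: clamp_powr_def)
        then show ?case using clamp_powr_le[of "real (Suc p)" "X \<sigma> x" s] elim by simp
      qed
    qed (auto simp del: of_nat_Suc)
    then show ?thesis using hb by (simp add: has_bochner_integral_iff)
  qed
  define Y where "Y = gram_det d k w"
  have Ym [measurable]: "Y \<in> borel_measurable (gauss_rows d k)" unfolding Y_def by measurable
  have Y0: "0 \<le> Y x" for x unfolding Y_def by (rule gram_det_nonneg) (rule w)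
  have Yint: "(\<integral>\<^sup>+x. ennreal (clamp_powr s (real (Suc p)) (Y x)) \<partial>gauss_rows d k)
      = ennreal (LINT x|(gauss_rows d k). clamp_powr s (real (Suc p)) (Y x))" for p
  proof (rule nn_integral_eq_integral)
    show "integrable (gauss_rows d k) (\<lambda>x. clamp_powr s (real (Suc p)) (Y x))"
      using clamp_powr_bounded[of "real (Suc p)" s]
      by (intro integrable_const_bound[where B = "max (real (Suc p) powr s) ((1 / real (Suc p)) powr s)"])
         (auto simp del: of_nat_Suc)
  qed (simp add: clamp_powr_def)
  have "(\<lambda>p. LINT x|(gauss_rows d k). clamp_powr s (real (Suc p)) (Y x))
      \<longlonglongrightarrow> (\<Sum>\<sigma> | \<sigma> permutes {..<d}. vandermonde_weight d \<eta> \<sigma> * (\<tau> \<sigma> powr s * c s))"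
  proof -
    have "(LINT x|(gauss_rows d k). clamp_powr s (real (Suc p)) (Y x))
      = (\<Sum>\<sigma> | \<sigma> permutes {..<d}. vandermonde_weight d \<eta> \<sigma> *
        (LINT x|(gauss_rows d k). clamp_powr s (real (Suc p)) (X \<sigma> x)))" for p
      using gram_det_mixture_clamp[OF inj pos, of "real (Suc p)" k s] by (simp add: Y_def X_def w_def[abs_def])
    then show ?thesis by (simp only:) (intro tendsto_sum tendsto_mult tendsto_const lim, simp)
  qed
  also have "(\<Sum>\<sigma> | \<sigma> permutes {..<d}. vandermonde_weight d \<eta> \<sigma> * (\<tau> \<sigma> powr s * c s)) = det_moment d k \<eta> s"
    unfolding det_moment_def \<tau>_def w_def c_def sum_distrib_left by (simp only: mult_ac)
  finally have Ylim: "(\<lambda>p. ennreal (LINT x|(gauss_rows d k). clamp_powr s (real (Suc p)) (Y x))) \<longlonglongrightarrow> ennreal (det_moment d k \<eta> s)"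
    by (rule tendsto_ennrealI)
  \<comment> \<open>at \<open>0\<close> with \<open>s < 0\<close> the clamped powers diverge, in accordance with \<open>ext_powr\<close>\<close>
  have pt: "ext_powr s y \<le> liminf (\<lambda>p. ennreal (clamp_powr s (real (Suc p)) y))" if y: "0 \<le> y" for y
  proof (cases "y = 0")
    case False
    then have "eventually (\<lambda>p. clamp_powr s (real (Suc p)) y = y powr s) sequentially"
      using y by (intro clamp_powr_eventually_eq) simp
    then have "(\<lambda>p. ennreal (clamp_powr s (real (Suc p)) y)) \<longlonglongrightarrow> ennreal (y powr s)"
      by (intro tendsto_eventually) (auto elim: eventually_mono)
    from lim_imp_Liminf[OF _ this] show ?thesis using False y by (simp add: ext_powr_pos)
  next
    case True
    show ?thesis
    proof (cases "s < 0")
      case s0: True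
      have "clamp_powr s (real (Suc p)) 0 = real (Suc p) powr (- s)" for p
        by (simp add: clamp_powr_def powr_minus_divide powr_divide)
      moreover have "filterlim (\<lambda>p. real (Suc p) powr (- s)) at_top sequentially"
      proof -
        have "filterlim (\<lambda>p. exp (- s * ln (real (Suc p)))) at_top sequentially"
          by (intro filterlim_compose[OF exp_at_top] filterlim_tendsto_pos_mult_at_top[OF tendsto_const]
              filterlim_compose[OF ln_at_top] filterlim_compose[OF filterlim_real_sequentially filterlim_Suc])
             (use s0 in simp)
        then show ?thesis by (simp add: powr_def)
      qed
      ultimately have "(\<lambda>p. ennreal (clamp_powr s (real (Suc p)) 0)) \<longlonglongrightarrow> \<infinity>"
        by (simp add: flip: ennreal_tendsto_top_eq_at_top)
      from lim_imp_Liminf[OF _ this] show ?thesis using True s0 by (simp add: ext_powr_def)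
    qed (simp add: True ext_powr_def)
  qed
  have "(\<integral>\<^sup>+x. ext_powr s (Y x) \<partial>gauss_rows d k)
      \<le> (\<integral>\<^sup>+x. liminf (\<lambda>p. ennreal (clamp_powr s (real (Suc p)) (Y x))) \<partial>gauss_rows d k)"
    by (intro nn_integral_mono pt Y0)
  also have "\<dots> \<le> liminf (\<lambda>p. \<integral>\<^sup>+x. ennreal (clamp_powr s (real (Suc p)) (Y x)) \<partial>gauss_rows d k)"
    by (rule nn_integral_liminf) measurable
  also have "\<dots> = ennreal (det_moment d k \<eta> s)"
    unfolding Yint by (rule lim_imp_Liminf[OF _ Ylim]) simp
  finally show ?thesis by (simp add: Y_def w_def[abs_def])
qed

lemma gram_det1_mono:
  assumes w: "\<And>i. i < m \<Longrightarrow> 0 \<le> w i" and le: "\<And>i. i < m \<Longrightarrow> w i \<le> w' i"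
  shows "gram_det1 m k w x \<le> gram_det1 m k w' x"
proof -
  have w': "0 \<le> w' i" if "i < m" for i using w[OF that] le[OF that] by linarith
  have 1: "1 \<le> gram_det1 m k w x" by (rule gram_det1_ge_1) (rule w)
  have onew': "1 \<le> gram_det1 m k w' x" by (rule gram_det1_ge_1) (rule w')
  have int: "ennreal (1 / gram_det1 m k v x)
      = (\<integral>\<^sup>+z. ennreal (exp (- (\<Sum>c<m. v c * (cmod (\<Sum>b<k. z b * x c b))\<^sup>2))) \<partial>gauss {..<k})"
    if "\<And>i. i < m \<Longrightarrow> 0 \<le> v i" for v
    unfolding gram_det1_def by (rule gauss_exp_quadratic[symmetric]) (use that in auto)
  have "ennreal (1 / gram_det1 m k w' x) \<le> ennreal (1 / gram_det1 m k w x)"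
    by (subst (1 2) int) (use w w' le in \<open>auto intro!: nn_integral_mono ennreal_leI sum_mono mult_right_mono\<close>)
  then have "1 / gram_det1 m k w' x \<le> 1 / gram_det1 m k w x"
    using ennreal_le_iff[of "1 / gram_det1 m k w x" "1 / gram_det1 m k w' x"] 1 by simp
  then show ?thesis using 1 onew' by (simp add: field_simps)
qed

lemma gram_det_mono:
  assumes w: "\<And>i. i < m \<Longrightarrow> 0 \<le> w i" and le: "\<And>i. i < m \<Longrightarrow> w i \<le> w' i"
  shows "gram_det m k w x \<le> gram_det m k w' x"
proof (rule LIMSEQ_le[OF gram_det1_tendsto_gram_det gram_det1_tendsto_gram_det])
  show "0 \<le> w i" "0 \<le> w' i" if "i < m" for i using w[OF that] le[OF that] by linarith+
  show "\<exists>N. \<forall>n\<ge>N. gram_det1 m k (\<lambda>i. real (Suc n) * w i) x / real (Suc n) ^ k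
      \<le> gram_det1 m k (\<lambda>i. real (Suc n) * w' i) x / real (Suc n) ^ k"
    by (intro exI allI impI divide_right_mono gram_det1_mono mult_left_mono)
       (use w le in \<open>auto intro!: mult_nonneg_nonneg\<close>)
qed

lemma gram_det_scale:
  "gram_det m k (\<lambda>i. t * w i) x = t ^ k * gram_det m k w x"
proof -
  have "Determinant.det (gram_mat k {..<m} (\<lambda>i. t * w i) x)
      = complex_of_real (t ^ k) * Determinant.det (gram_mat k {..<m} w x)"
    unfolding gram_mat_scale by (simp add: det_smult carrier_matD[OF gram_mat_carrier])
  then show ?thesis by (simp only: gram_det_def Re_complex_of_real Re_divide_of_real times_complex.sel) simp
qed

lemma ext_powr_mono: "0 \<le> s \<Longrightarrow> 0 \<le> x \<Longrightarrow> x \<le> y \<Longrightarrow> ext_powr s x \<le> ext_powr s y"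
  by (auto simp: ext_powr_def intro!: ennreal_leI powr_mono2)

lemma ext_powr_antimono: "s < 0 \<Longrightarrow> 0 \<le> x \<Longrightarrow> x \<le> y \<Longrightarrow> ext_powr s y \<le> ext_powr s x"
  by (auto simp: ext_powr_def intro!: ennreal_leI powr_mono2')

text \<open>A relative error of \<open>exp \<epsilon>\<close> in the weights costs a factor \<open>exp (k \<epsilon> \<bar>s\<bar>)\<close> in the \<open>s\<close>-th moment.
  Coinciding weights are treated by nearby distinct ones in this way.\<close>

lemma gram_det_moment_bound_perturbed:
  assumes inj: "inj_on \<eta> {..<d}" and pos: "\<And>i. i < d \<Longrightarrow> 0 < \<eta> i" and k: "k \<le> d" and s: "- 1 < s"
    and w: "\<And>i. i < d \<Longrightarrow> 0 < w i"
    and near: "\<And>i. i < d \<Longrightarrow> w i \<le> exp \<epsilon> * (1 / \<eta> i)" "\<And>i. i < d \<Longrightarrow> exp (- \<epsilon>) * (1 / \<eta> i) \<le> w i"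
  shows "(\<integral>\<^sup>+x. ext_powr s (gram_det d k w x) \<partial>gauss_rows d k) \<le> ennreal (exp (real k * \<epsilon> * \<bar>s\<bar>) * det_moment d k \<eta> s)"
proof -
  define v where "v i = 1 / \<eta> i" for i
  have v: "0 < v i" if "i < d" for i using pos[OF that] by (simp add: v_def)
  have pt: "ext_powr s (gram_det d k w x) \<le> ennreal (exp (real k * \<epsilon> * \<bar>s\<bar>)) * ext_powr s (gram_det d k v x)" for x
  proof (cases "0 \<le> s")
    case True
    have "gram_det d k w x \<le> gram_det d k (\<lambda>i. exp \<epsilon> * v i) x"
      by (rule gram_det_mono) (use w near in \<open>auto simp: v_def less_imp_le\<close>)
    then have le: "gram_det d k w x \<le> exp \<epsilon> ^ k * gram_det d k v x" by (simp only: gram_det_scale)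
    have "ext_powr s (gram_det d k w x) \<le> ext_powr s (exp \<epsilon> ^ k * gram_det d k v x)"
      by (rule ext_powr_mono[OF True _ le]) (rule gram_det_nonneg, use w in \<open>auto intro: less_imp_le\<close>)
    also have "\<dots> = ext_powr s (exp \<epsilon> ^ k) * ext_powr s (gram_det d k v x)"
      by (rule ext_powr_mult) (auto intro!: gram_det_nonneg less_imp_le[OF v])
    also have "ext_powr s (exp \<epsilon> ^ k) = ennreal (exp (real k * \<epsilon> * \<bar>s\<bar>))"
      using True by (simp add: ext_powr_pos exp_of_nat_mult[symmetric] powr_def)
    finally show ?thesis .
  next
    case False
    have "gram_det d k (\<lambda>i. exp (- \<epsilon>) * v i) x \<le> gram_det d k w x"
      by (rule gram_det_mono) (use v near in \<open>auto simp: v_def less_imp_le\<close>)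
    then have le: "exp (- \<epsilon>) ^ k * gram_det d k v x \<le> gram_det d k w x" by (simp only: gram_det_scale)
    have "ext_powr s (gram_det d k w x) \<le> ext_powr s (exp (- \<epsilon>) ^ k * gram_det d k v x)"
      by (rule ext_powr_antimono[OF _ _ le])
         (use False in \<open>auto intro!: mult_nonneg_nonneg gram_det_nonneg less_imp_le[OF v]\<close>)
    also have "\<dots> = ext_powr s (exp (- \<epsilon>) ^ k) * ext_powr s (gram_det d k v x)"
      by (rule ext_powr_mult) (auto intro!: gram_det_nonneg less_imp_le[OF v])
    also have "ext_powr s (exp (- \<epsilon>) ^ k) = ennreal (exp (real k * \<epsilon> * \<bar>s\<bar>))"
      using False by (simp add: ext_powr_pos exp_of_nat_mult[symmetric] powr_def mult_ac)
    finally show ?thesis .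
  qed
  have "(\<integral>\<^sup>+x. ext_powr s (gram_det d k w x) \<partial>gauss_rows d k)
      \<le> (\<integral>\<^sup>+x. ennreal (exp (real k * \<epsilon> * \<bar>s\<bar>)) * ext_powr s (gram_det d k v x) \<partial>gauss_rows d k)"
    by (intro nn_integral_mono pt)
  also have "\<dots> = ennreal (exp (real k * \<epsilon> * \<bar>s\<bar>)) * (\<integral>\<^sup>+x. ext_powr s (gram_det d k v x) \<partial>gauss_rows d k)"
    by (rule nn_integral_cmult) measurable
  also have "\<dots> \<le> ennreal (exp (real k * \<epsilon> * \<bar>s\<bar>)) * ennreal (det_moment d k \<eta> s)"
    unfolding v_def by (intro mult_left_mono gram_det_moment_bound[OF inj pos k s]) auto
  finally show ?thesis by (simp add: ennreal_mult')
qed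

section \<open>One factor of the product\<close>

text \<open>In an eigenbasis \<open>Q\<close> of the projection \<open>B B\<^sup>*\<close> the range of \<open>B\<close> is spanned by \<open>k\<close> coordinate vectors, so
  up to a unitary change of coordinates on the source \<open>B\<close> consists of \<open>k\<close> columns of \<open>Q\<close>.\<close>

lemma isometry_eq_unitary_columns:
  assumes B: "B \<in> carrier_mat d k" and iso: "mat_adjoint B * B = 1\<^sub>m k"
  obtains Q e where "unitary_mat d Q" "inj_on e {..<k}" "e ` {..<k} \<subseteq> {..<d}"
    "\<And>i b. i < d \<Longrightarrow> i \<notin> e ` {..<k} \<Longrightarrow> b < k \<Longrightarrow> (mat_adjoint Q * B) $$ (i, b) = 0"
proof -
  have "positive_semidefinite_mat d (B * mat_adjoint B)"
    using positive_semidefinite_mat_gram[OF mat_adjoint_carrier[OF B]] by simp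
  then obtain Q \<delta> where Q: "unitary_mat d Q" and R: "B * mat_adjoint B = eigen_mat d Q (\<lambda>i. complex_of_real (\<delta> i))"
    using psd_spectral by metis
  note Q' = unitary_matD[OF Q]
  define C where "C = mat_adjoint Q * B"
  have C: "C \<in> carrier_mat d k"
    unfolding C_def by (rule mult_carrier_mat[OF mat_adjoint_carrier[OF Q'(1)] B])
  have CC: "C * mat_adjoint C = mat_diag d (\<lambda>i. complex_of_real (\<delta> i))"
  proof -
    have "C * mat_adjoint C = mat_adjoint Q * (B * mat_adjoint B) * Q"
      using Q'(1) B by (simp add: C_def mat_adjoint_mult[of _ d d _ k] assoc_mult_mat[of _ d k _ d _ d]
          assoc_mult_mat[of _ d d _ k _ d] assoc_mult_mat[of _ d d _ d _ d] mult_carrier_mat[of _ d k _ d]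
          mult_carrier_mat[of _ k d _ d])
    also have "\<dots> = (mat_adjoint Q * Q) * mat_diag d (\<lambda>i. complex_of_real (\<delta> i)) * (mat_adjoint Q * Q)"
      unfolding R eigen_mat_def using Q'(1) by (simp add: assoc_mult_mat[of _ d d _ d _ d])
    finally show ?thesis using Q' by simp
  qed
  have CtC: "mat_adjoint C * C = 1\<^sub>m k"
  proof -
    have "mat_adjoint C * C = mat_adjoint B * ((Q * mat_adjoint Q) * B)"
      using Q'(1) B by (simp add: C_def mat_adjoint_mult[of _ d d _ k] assoc_mult_mat[of _ k d _ d _ k]
          assoc_mult_mat[of _ d d _ d _ k] mult_carrier_mat[of _ d d _ k])
    then show ?thesis using Q' B iso by simp
  qed
  have row: "\<delta> i = (\<Sum>a<k. (cmod (C $$ (i, a)))\<^sup>2)" if i: "i < d" for i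
  proof -
    have "complex_of_real (\<delta> i) = (C * mat_adjoint C) $$ (i, i)" using i by (simp add: CC mat_diag_def)
    also have "\<dots> = (\<Sum>a<k. C $$ (i, a) * cnj (C $$ (i, a)))"
      using C i by (simp add: scalar_prod_def atLeast0LessThan)
    also have "\<dots> = complex_of_real (\<Sum>a<k. (cmod (C $$ (i, a)))\<^sup>2)"
      by (simp only: of_real_sum complex_norm_square)
    finally show ?thesis by (simp only: of_real_eq_iff)
  qed
  have col: "(\<Sum>i<d. (cmod (C $$ (i, a)))\<^sup>2) = 1" if a: "a < k" for a
  proof -
    have "1 = (mat_adjoint C * C) $$ (a, a)" using a by (simp add: CtC)
    also have "\<dots> = (\<Sum>i<d. cnj (C $$ (i, a)) * C $$ (i, a))"
      using C a by (simp add: scalar_prod_def atLeast0LessThan)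
    also have "\<dots> = complex_of_real (\<Sum>i<d. (cmod (C $$ (i, a)))\<^sup>2)"
      by (simp only: cnj_times_self of_real_sum of_real_power)
    finally show ?thesis by (metis of_real_eq_1_iff)
  qed
  \<comment> \<open>\<open>B B\<^sup>*\<close> is a projection, so its eigenvalues are \<open>0\<close> and \<open>1\<close>, and its trace \<open>k\<close> counts the ones\<close>
  have \<delta>01: "\<delta> i = 0 \<or> \<delta> i = 1" if i: "i < d" for i
  proof -
    have "(C * mat_adjoint C) * (C * mat_adjoint C) = C * ((mat_adjoint C * C) * mat_adjoint C)"
      using C by (simp add: assoc_mult_mat[of _ d k _ d _ d] assoc_mult_mat[of _ k d _ k _ d] mult_carrier_mat[of _ k d _ d])
    also have "\<dots> = C * mat_adjoint C" using CtC left_mult_one_mat[OF mat_adjoint_carrier[OF C]] by simp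
    finally have "mat_diag d (\<lambda>i. complex_of_real (\<delta> i) * complex_of_real (\<delta> i)) $$ (i, i)
        = mat_diag d (\<lambda>i. complex_of_real (\<delta> i)) $$ (i, i)"
      unfolding CC by simp
    then have "complex_of_real (\<delta> i * \<delta> i) = complex_of_real (\<delta> i)" using i by (simp add: mat_diag_def)
    then have "\<delta> i * \<delta> i = \<delta> i" by (simp only: of_real_eq_iff)
    then show ?thesis by simp
  qed
  define I where "I = {i \<in> {..<d}. \<delta> i = 1}"
  have "real (card I) = (\<Sum>i<d. \<delta> i)"
  proof -
    have "(\<Sum>i<d. \<delta> i) = (\<Sum>i<d. if \<delta> i = 1 then 1 else 0)" using \<delta>01 by (intro sum.cong) auto
    also have "\<dots> = (\<Sum>i\<in>I. 1)" unfolding I_def by (rule sum.inter_filter[symmetric]) simp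
    finally show ?thesis by simp
  qed
  also have "(\<Sum>i<d. \<delta> i) = (\<Sum>i<d. \<Sum>a<k. (cmod (C $$ (i, a)))\<^sup>2)" using row by simp
  also have "\<dots> = (\<Sum>a<k. \<Sum>i<d. (cmod (C $$ (i, a)))\<^sup>2)" by (rule sum.swap)
  also have "\<dots> = real k" using col by simp
  finally have "card I = k" by simp
  moreover have "finite I" by (simp add: I_def)
  ultimately obtain e where e: "bij_betw e {..<k} I"
    using ex_bij_betw_nat_finite[of I] by (auto simp: atLeast0LessThan)
  show thesis
  proof (rule that[OF Q])
    show "inj_on e {..<k}" "e ` {..<k} \<subseteq> {..<d}" using e by (auto simp: bij_betw_def I_def)
    fix i b assume "i < d" "i \<notin> e ` {..<k}" "b < k"
    then have "\<delta> i = 0" using \<delta>01[of i] e by (auto simp: bij_betw_def I_def)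
    then have "(\<Sum>a<k. (cmod (C $$ (i, a)))\<^sup>2) = 0" using row[OF \<open>i < d\<close>] by simp
    then have "C $$ (i, b) = 0" using \<open>b < k\<close> by (subst (asm) sum_nonneg_eq_0_iff) auto
    then show "(mat_adjoint Q * B) $$ (i, b) = 0" by (simp add: C_def)
  qed
qed

lemma gram_det_cong:
  assumes "\<And>i a. i < m \<Longrightarrow> a < k \<Longrightarrow> x i a = y i a"
  shows "gram_det m k w x = gram_det m k w y"
proof -
  have "gram_mat k {..<m} w x = gram_mat k {..<m} w y"
    using assms by (intro eq_matI) (auto simp: gram_mat_def intro!: sum.cong)
  then show ?thesis by (simp only: gram_det_def)
qed

lemma gram_det_array_measurable:
  assumes "\<And>i a. i < m \<Longrightarrow> a < k \<Longrightarrow> e (i, a) \<in> K"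
  shows "(\<lambda>x. gram_det m k w (\<lambda>i a. x (e (i, a)))) \<in> borel_measurable (gauss K)"
  unfolding gram_det_def
proof (rule measurable_compose[OF det_measurable[of _ k] borel_measurable_Re])
  fix a b assume ab: "a < k" "b < k"
  have "(\<lambda>x. \<Sum>c<m. of_real (w c) * cnj (x (e (c, a))) * x (e (c, b))) \<in> borel_measurable (gauss K)"
    by (intro borel_measurable_sum borel_measurable_times borel_measurable_const
        measurable_compose[OF _ borel_measurable_cnj] gauss_component assms ab) simp_all
  then show "(\<lambda>x. gram_mat k {..<m} w (\<lambda>i a. x (e (i, a))) $$ (a, b)) \<in> borel_measurable (gauss K)"
    using ab by (simp add: gram_mat_def)
qed simp

text \<open>A Gaussian matrix that is rotated from both sides is Gaussian again, and any \<open>k\<close> of its columns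
  form a \<open>d \<times> k\<close> Gaussian matrix.\<close>

lemma gauss_rotated_columns:
  assumes U: "unitary_mat d U" and Q: "unitary_mat d Q"
    and e: "inj_on e {..<k}" "e ` {..<k} \<subseteq> {..<d}"
  shows "(\<integral>\<^sup>+x. ext_powr s (gram_det d k w (\<lambda>i a. (U * Matrix.mat d d x * Q) $$ (i, e a))) \<partial>gauss ({..<d} \<times> {..<d}))
    = (\<integral>\<^sup>+x. ext_powr s (gram_det d k w x) \<partial>gauss_rows d k)"
proof -
  let ?K = "{..<d} \<times> {..<d}" and ?K' = "{..<d} \<times> {..<k}"
  note U' = unitary_matD[OF U] and Q' = unitary_matD[OF Q]
  have elt: "e a < d" if "a < k" for a using e(2) that by auto
  define f where "f x = ext_powr s (gram_det d k w (\<lambda>i a. x (i, e a)))" for x :: "nat \<times> nat \<Rightarrow> complex"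
  define L where "L x = (\<lambda>(i, a)\<in>?K. \<Sum>j<d. U $$ (i, j) * x (j, a))" for x :: "nat \<times> nat \<Rightarrow> complex"
  define R where "R x = (\<lambda>(a, i)\<in>?K. \<Sum>j<d. x (a, j) * Q $$ (j, i))" for x :: "nat \<times> nat \<Rightarrow> complex"
  have fm: "f \<in> borel_measurable (gauss ?K)"
    unfolding f_def
    using measurable_compose[OF gram_det_array_measurable[of d k "\<lambda>(i, a). (i, e a)" ?K w] ext_powr_measurable[of s]] elt
    by auto
  have Lm: "L \<in> gauss ?K \<rightarrow>\<^sub>M gauss ?K"
    unfolding L_def
  proof (rule measurable_restrict)
    fix p assume p: "p \<in> ?K"
    have "(\<lambda>x. \<Sum>j<d. U $$ (fst p, j) * x (j, snd p)) \<in> borel_measurable (gauss ?K)"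
      by (intro borel_measurable_sum borel_measurable_times borel_measurable_const gauss_component) (use p in auto)
    then show "(\<lambda>x. case p of (i, a) \<Rightarrow> \<Sum>j<d. U $$ (i, j) * x (j, a)) \<in> gauss ?K \<rightarrow>\<^sub>M cgauss"
      by (simp add: measurable_cgauss_borel case_prod_unfold)
  qed
  have LR: "f (L (R x)) = ext_powr s (gram_det d k w (\<lambda>i a. (U * Matrix.mat d d x * Q) $$ (i, e a)))" for x
  proof -
    have "L (R x) (i, a) = (U * Matrix.mat d d x * Q) $$ (i, a)" if "i < d" "a < d" for i a
    proof -
      have "(U * Matrix.mat d d x * Q) = U * (Matrix.mat d d x * Q)"
        using U'(1) Q'(1) by (simp add: assoc_mult_mat[of _ d d _ d _ d])
      moreover have "(U * (Matrix.mat d d x * Q)) $$ (i, a) = (\<Sum>j<d. U $$ (i, j) * (\<Sum>l<d. x (j, l) * Q $$ (l, a)))"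
        using U'(1) Q'(1) that by (simp add: scalar_prod_def atLeast0LessThan)
      ultimately show ?thesis using that by (simp add: L_def R_def)
    qed
    then show ?thesis unfolding f_def using elt by (intro arg_cong[where f = "ext_powr s"] gram_det_cong) auto
  qed
  have "(\<integral>\<^sup>+x. f (L (R x)) \<partial>gauss ?K) = (\<integral>\<^sup>+x. f (L x) \<partial>gauss ?K)"
    using gauss_right_unitary[OF Q, of "{..<d}" "\<lambda>x. f (L x)"] measurable_compose[OF Lm fm]
    by (simp add: R_def borel_measurable_clebesgue)
  also have "\<dots> = (\<integral>\<^sup>+x. f x \<partial>gauss ?K)"
    using gauss_left_unitary[OF U, of "{..<d}" f] fm by (simp add: L_def borel_measurable_clebesgue)
  also have "\<dots> = (\<integral>\<^sup>+x. ext_powr s (gram_det d k w (\<lambda>i a. x (i, a))) \<partial>gauss ?K')"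
  proof -
    let ?t = "\<lambda>x. \<lambda>p\<in>?K'. x (map_prod id e p) :: complex"
    have t: "?t \<in> gauss ?K \<rightarrow>\<^sub>M gauss ?K'"
      by (intro measurable_restrict measurable_component_singleton) (use elt in auto)
    have "distr (gauss ?K) (gauss ?K') ?t = gauss ?K'"
      by (rule distr_PiM_reindex) (use e prob_space_cgauss in \<open>auto simp: inj_on_def\<close>)
    then have "(\<integral>\<^sup>+x. ext_powr s (gram_det d k w (\<lambda>i a. x (i, a))) \<partial>gauss ?K')
        = (\<integral>\<^sup>+x. ext_powr s (gram_det d k w (\<lambda>i a. x (i, a))) \<partial>distr (gauss ?K) (gauss ?K') ?t)"
      by (rule arg_cong[OF sym])
    also have "\<dots> = (\<integral>\<^sup>+x. ext_powr s (gram_det d k w (\<lambda>i a. ?t x (i, a))) \<partial>gauss ?K)"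
    proof (rule nn_integral_distr[OF t])
      show "(\<lambda>x. ext_powr s (gram_det d k w (\<lambda>i a. x (i, a)))) \<in> borel_measurable (distr (gauss ?K) (gauss ?K') ?t)"
        unfolding measurable_distr_eq1
        by (rule measurable_compose[OF gram_det_array_measurable[of d k "\<lambda>p. p" ?K' w] ext_powr_measurable]) auto
    qed
    also have "\<dots> = (\<integral>\<^sup>+x. f x \<partial>gauss ?K)"
      unfolding f_def by (intro nn_integral_cong arg_cong[where f = "ext_powr s"] gram_det_cong) auto
    finally show ?thesis ..
  qed
  also have "\<dots> = (\<integral>\<^sup>+x. ext_powr s (gram_det d k w (\<lambda>i a. (\<lambda>(i, a)\<in>?K'. x i a) (i, a))) \<partial>gauss_rows d k)"
    by (rule gauss_array_eq_rows, rule measurable_compose[OF gram_det_array_measurable[of d k "\<lambda>p. p" ?K' w] ext_powr_measurable]) auto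
  also have "\<dots> = (\<integral>\<^sup>+x. ext_powr s (gram_det d k w x) \<partial>gauss_rows d k)"
    by (intro nn_integral_cong arg_cong[where f = "ext_powr s"] gram_det_cong) auto
  finally show ?thesis unfolding LR .
qed

lemma mult_mat_zero_vec:
  assumes "A \<in> carrier_mat m n"
  shows "A *\<^sub>v 0\<^sub>v n = (0\<^sub>v m :: complex vec)"
  using assms by (intro eq_vecI) (auto simp: scalar_prod_def)

lemma gram_singular_kernel:
  fixes B :: "complex mat"
  assumes B: "B \<in> carrier_mat d k" and sing: "Determinant.det (mat_adjoint B * B) = 0"
  obtains v where "v \<in> carrier_vec k" "v \<noteq> 0\<^sub>v k" "B *\<^sub>v v = 0\<^sub>v d"
proof -
  have S: "mat_adjoint B * B \<in> carrier_mat k k" using B by auto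
  obtain v where v: "v \<in> carrier_vec k" "v \<noteq> 0\<^sub>v k" "(mat_adjoint B * B) *\<^sub>v v = 0\<^sub>v k"
    using det_0_iff_vec_prod_zero_field[OF S] sing by auto
  have Bv: "B *\<^sub>v v \<in> carrier_vec d" by (rule mult_mat_vec_carrier[OF B v(1)])
  have "(B *\<^sub>v v) \<bullet>c (B *\<^sub>v v) = v \<bullet>c (mat_adjoint B *\<^sub>v (B *\<^sub>v v))"
    by (rule adjoint_cscalar_prod[OF B Bv v(1)])
  also have "mat_adjoint B *\<^sub>v (B *\<^sub>v v) = 0\<^sub>v k"
    using v assoc_mult_mat_vec[OF mat_adjoint_carrier[OF B] B v(1)] by simp
  finally have "(B *\<^sub>v v) \<bullet>c (B *\<^sub>v v) = 0" using v(1) by simp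
  then have "(\<Sum>i<d. (cmod ((B *\<^sub>v v) $ i))\<^sup>2) = 0"
    unfolding cscalar_prod_self[OF Bv] by (simp only: of_real_eq_0_iff)
  then have "\<forall>i<d. (B *\<^sub>v v) $ i = 0" by (subst (asm) sum_nonneg_eq_0_iff) auto
  then have "B *\<^sub>v v = 0\<^sub>v d" using Bv B by (intro eq_vecI) auto
  then show thesis using that v by blast
qed

lemma det_gram_nonneg:
  fixes B :: "complex mat"
  assumes "B \<in> carrier_mat m k"
  shows "0 \<le> Re (Determinant.det (mat_adjoint B * B))"
    and "Determinant.det (mat_adjoint B * B) = complex_of_real (Re (Determinant.det (mat_adjoint B * B)))"
proof -
  obtain \<rho> where "\<And>i. i < k \<Longrightarrow> 0 \<le> (\<rho> i :: real)" "Determinant.det (mat_adjoint B * B) = of_real (\<Prod>i<k. \<rho> i)"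
    using psd_det_one_plus[OF positive_semidefinite_mat_gram[OF assms]] by metis
  then show "0 \<le> Re (Determinant.det (mat_adjoint B * B))"
    and "Determinant.det (mat_adjoint B * B) = complex_of_real (Re (Determinant.det (mat_adjoint B * B)))"
    by (auto intro!: prod_nonneg simp flip: of_real_prod)
qed

lemma det_congruence:
  fixes M :: "complex mat"
  assumes M: "M \<in> carrier_mat k k" and T: "T \<in> carrier_mat k k"
  shows "Determinant.det (mat_adjoint T * M * T) = of_real ((cmod (Determinant.det T))\<^sup>2) * Determinant.det M"
proof -
  have "Determinant.det (mat_adjoint T * M * T) = cnj (Determinant.det T) * Determinant.det M * Determinant.det T"
    using M T by (simp add: det_mult[of _ k] det_mat_adjoint)
  also have "\<dots> = (cnj (Determinant.det T) * Determinant.det T) * Determinant.det M" by simp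
  finally show ?thesis by (simp add: cnj_times_self)
qed

lemma congruence_mult:
  fixes Y S T :: "complex mat"
  assumes Y: "Y \<in> carrier_mat d k" and S: "S \<in> carrier_mat d d" and T: "T \<in> carrier_mat k k"
  shows "mat_adjoint T * (mat_adjoint Y * S * Y) * T = mat_adjoint (Y * T) * S * (Y * T)"
proof -
  have T': "mat_adjoint T \<in> carrier_mat k k" and Y': "mat_adjoint Y \<in> carrier_mat k d"
    using T Y by auto
  have P: "mat_adjoint Y * S \<in> carrier_mat k d" by (rule mult_carrier_mat[OF Y' S])
  have "mat_adjoint T * (mat_adjoint Y * S * Y) * T = (mat_adjoint T * (mat_adjoint Y * S)) * Y * T"
    by (simp only: assoc_mult_mat[OF T' P Y])
  also have "\<dots> = (mat_adjoint T * (mat_adjoint Y * S)) * (Y * T)"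
    by (rule assoc_mult_mat[OF mult_carrier_mat[OF T' P] Y T])
  also have "mat_adjoint T * (mat_adjoint Y * S) = mat_adjoint (Y * T) * S"
    by (simp only: assoc_mult_mat[OF T' Y' S] mat_adjoint_mult[OF Y T])
  finally show ?thesis .
qed

text \<open>\<open>T\<close> is the inverse square root of the Gram matrix up to a unitary factor.\<close>

lemma gram_factor_isometry:
  fixes B :: "complex mat"
  assumes B: "B \<in> carrier_mat d k" and reg: "Determinant.det (mat_adjoint B * B) \<noteq> 0"
  obtains T where "T \<in> carrier_mat k k" "mat_adjoint (B * T) * (B * T) = 1\<^sub>m k"
    "of_real ((cmod (Determinant.det T))\<^sup>2) * Determinant.det (mat_adjoint B * B) = 1"
proof -
  let ?S = "mat_adjoint B * B"
  have S: "?S \<in> carrier_mat k k" using B by auto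
  obtain W \<rho> where W: "unitary_mat k W" and SW: "?S = eigen_mat k W (\<lambda>i. complex_of_real (\<rho> i))"
    and \<rho>: "\<And>i. i < k \<Longrightarrow> 0 \<le> \<rho> i"
    using psd_spectral[OF positive_semidefinite_mat_gram[OF B]] by metis
  note W' = unitary_matD[OF W]
  have \<rho>pos: "0 < \<rho> i" if "i < k" for i
    using reg that \<rho>[OF that] by (auto simp: SW det_eigen_mat[OF W] less_le)
  define D where "D = mat_diag k (\<lambda>i. complex_of_real (1 / sqrt (\<rho> i)))"
  define T where "T = W * D"
  have D: "D \<in> carrier_mat k k" by (simp add: D_def)
  have T: "T \<in> carrier_mat k k" using W' D by (simp add: T_def)
  have adjD: "mat_adjoint D = D" by (rule eq_matI) (auto simp: D_def mat_diag_def)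
  have TST: "mat_adjoint T * ?S * T = 1\<^sub>m k"
  proof -
    have "mat_adjoint T * ?S * T = D * ((mat_adjoint W * W) * (mat_diag k (\<lambda>i. complex_of_real (\<rho> i)) * ((mat_adjoint W * W) * D)))"
      unfolding SW eigen_mat_def T_def mat_adjoint_mult[OF W'(1) D] adjD
      using W'(1) D by (simp add: assoc_mult_mat[of _ k k _ k _ k])
    also have "\<dots> = mat_diag k (\<lambda>i. complex_of_real (1 / sqrt (\<rho> i)) * (complex_of_real (\<rho> i) * complex_of_real (1 / sqrt (\<rho> i))))"
      unfolding W'(2) using D by (simp add: D_def)
    also have "\<dots> = mat_diag k (\<lambda>_. 1)"
    proof (rule mat_diag_cong)
      fix i assume "i < k"
      have "complex_of_real (1 / sqrt (\<rho> i)) * (complex_of_real (\<rho> i) * complex_of_real (1 / sqrt (\<rho> i)))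
          = complex_of_real ((1 / sqrt (\<rho> i)) * (\<rho> i * (1 / sqrt (\<rho> i))))" by (simp only: of_real_mult)
      also have "(1 / sqrt (\<rho> i)) * (\<rho> i * (1 / sqrt (\<rho> i))) = 1"
        using \<rho>pos[OF \<open>i < k\<close>] by (simp add: field_simps)
      finally show "complex_of_real (1 / sqrt (\<rho> i)) * (complex_of_real (\<rho> i) * complex_of_real (1 / sqrt (\<rho> i))) = 1"
        by simp
    qed
    finally show ?thesis by simp
  qed
  have "mat_adjoint (B * T) * (B * T) = mat_adjoint T * ?S * T"
    using B T by (simp add: mat_adjoint_mult[OF B T] assoc_mult_mat[of _ k d _ k _ k] assoc_mult_mat[of _ k k _ d _ k]
        assoc_mult_mat[of _ k k _ k _ k] mult_carrier_mat[of _ d k _ k] mult_carrier_mat[of _ k d _ k])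
  then show thesis
    using that[OF T] TST det_congruence[OF S T] by simp
qed

lemma sum_over_image:
  fixes f :: "nat \<Rightarrow> complex"
  assumes "inj_on e {..<k}" "e ` {..<k} \<subseteq> {..<d}" "\<And>i. i < d \<Longrightarrow> i \<notin> e ` {..<k} \<Longrightarrow> f i = 0"
  shows "(\<Sum>i<d. f i) = (\<Sum>a<k. f (e a))"
proof -
  have "(\<Sum>i<d. f i) = (\<Sum>i\<in>e ` {..<k}. f i)"
    by (rule sum.mono_neutral_right) (use assms in auto)
  then show ?thesis using sum.reindex[OF assms(1), of f] by simp
qed

text \<open>If \<open>B\<close> has full column rank, it is the product of an isometry and an invertible square matrix,
  whose determinant accounts for \<open>det (B\<^sup>* B)\<close>. By unitary invariance a Gaussian matrix applied to an isometry, in the eigenbasis of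
  \<open>\<Sigma>\<close>, has the law of \<open>k\<close> Gaussian columns, so the remaining factor does not depend on \<open>B\<close>.
  Otherwise both determinants vanish.\<close>

lemma gauss_factor_step:
  assumes U: "unitary_mat d U" and \<Sigma>: "\<Sigma> = eigen_mat d U (\<lambda>i. complex_of_real (w i))"
    and w: "\<And>i. i < d \<Longrightarrow> 0 < w i"
    and B: "B \<in> carrier_mat d k" and C: "0 < C"
    and bound: "(\<integral>\<^sup>+x. ext_powr s (gram_det d k w x) \<partial>gauss_rows d k) \<le> ennreal C"
  shows "(\<integral>\<^sup>+x. ext_powr s (Re (Determinant.det
      (mat_adjoint (Matrix.mat d d x * B) * \<Sigma> * (Matrix.mat d d x * B)))) \<partial>gauss ({..<d} \<times> {..<d}))
    \<le> ennreal C * ext_powr s (Re (Determinant.det (mat_adjoint B * B)))"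
proof -
  note U' = unitary_matD[OF U]
  have \<Sigma>c: "\<Sigma> \<in> carrier_mat d d" using U by (simp add: \<Sigma>)
  let ?M = "\<lambda>B x. mat_adjoint (Matrix.mat d d x * B) * \<Sigma> * (Matrix.mat d d x * B)"
  let ?S = "mat_adjoint B * B"
  have X: "Matrix.mat d d x \<in> carrier_mat d d" for x :: "nat \<times> nat \<Rightarrow> complex" by simp
  have XB: "Matrix.mat d d x * B \<in> carrier_mat d k" for x using B by (rule mult_carrier_mat[OF X])
  show ?thesis
  proof (cases "Determinant.det ?S = 0")
    case True
    obtain v where v: "v \<in> carrier_vec k" "v \<noteq> 0\<^sub>v k" "B *\<^sub>v v = 0\<^sub>v d"
      using gram_singular_kernel[OF B True] .
    have "Determinant.det (?M B x) = 0" for x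
    proof -
      have Mc: "?M B x \<in> carrier_mat k k"
        by (rule mult_carrier_mat[OF mult_carrier_mat[OF mat_adjoint_carrier[OF XB] \<Sigma>c] XB])
      have "(Matrix.mat d d x * B) *\<^sub>v v = 0\<^sub>v d"
        using assoc_mult_mat_vec[OF X B v(1)] mult_mat_zero_vec[OF X] v(3) by simp
      then have "?M B x *\<^sub>v v = 0\<^sub>v k"
        using assoc_mult_mat_vec[OF mult_carrier_mat[OF mat_adjoint_carrier[OF XB] \<Sigma>c] XB v(1)]
          mult_mat_zero_vec[OF mult_carrier_mat[OF mat_adjoint_carrier[OF XB] \<Sigma>c]] by simp
      then show ?thesis using det_0_iff_vec_prod_zero_field[OF Mc] v by blast
    qed
    then show ?thesis using True C by (cases "s < 0") (simp_all add: ext_powr_def ennreal_mult_top)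
  next
    case False
    obtain T where T: "T \<in> carrier_mat k k" and iso: "mat_adjoint (B * T) * (B * T) = 1\<^sub>m k"
      and detT: "of_real ((cmod (Determinant.det T))\<^sup>2) * Determinant.det ?S = 1"
      using gram_factor_isometry[OF B False] .
    define B' where "B' = B * T"
    have B': "B' \<in> carrier_mat d k" unfolding B'_def by (rule mult_carrier_mat[OF B T])
    obtain Q e where Q: "unitary_mat d Q" and e: "inj_on e {..<k}" "e ` {..<k} \<subseteq> {..<d}"
      and zero: "\<And>i b. i < d \<Longrightarrow> i \<notin> e ` {..<k} \<Longrightarrow> b < k \<Longrightarrow> (mat_adjoint Q * B') $$ (i, b) = 0"
      using isometry_eq_unitary_columns[OF B' iso[folded B'_def]] by metis
    note Q' = unitary_matD[OF Q]
    have elt: "e a < d" if "a < k" for a using e(2) that by auto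
    define E where "E = mat_adjoint Q * B'"
    have E: "E \<in> carrier_mat d k" unfolding E_def by (rule mult_carrier_mat[OF mat_adjoint_carrier[OF Q'(1)] B'])
    \<comment> \<open>only \<open>k\<close> rows of \<open>E\<close> are nonzero; they form a unitary matrix\<close>
    define Ee where "Ee = Matrix.mat k k (\<lambda>(a, b). E $$ (e a, b))"
    have Ee: "Ee \<in> carrier_mat k k" by (simp add: Ee_def)
    have "mat_adjoint Ee * Ee = 1\<^sub>m k"
    proof -
      have "mat_adjoint Ee * Ee = mat_adjoint E * E"
      proof (rule eq_matI, goal_cases)
        case (1 a b)
        then have ab: "a < k" "b < k" using E by auto
        have "(\<Sum>i<d. cnj (E $$ (i, a)) * E $$ (i, b)) = (\<Sum>c<k. cnj (E $$ (e c, a)) * E $$ (e c, b))"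
          by (rule sum_over_image[OF e]) (use zero ab in \<open>simp add: E_def\<close>)
        then show ?case using E ab by (simp add: Ee_def scalar_prod_def atLeast0LessThan)
      qed (use E in \<open>auto simp: Ee_def\<close>)
      also have "\<dots> = mat_adjoint B' * ((Q * mat_adjoint Q) * B')"
        using Q'(1) B' by (simp add: E_def mat_adjoint_mult[of _ d d _ k] assoc_mult_mat[of _ k d _ d _ k]
          assoc_mult_mat[of _ d d _ d _ k] mult_carrier_mat[of _ d d _ k])
      finally show ?thesis unfolding Q'(3) left_mult_one_mat[OF B'] iso[folded B'_def] .
    qed
    then have detE: "of_real ((cmod (Determinant.det Ee))\<^sup>2) = (1 :: complex)"
      using det_congruence[OF one_carrier_mat Ee] Ee by simp
    have key: "Determinant.det (?M B x) = Determinant.det ?S *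
        Determinant.det (gram_mat k {..<d} w (\<lambda>i a. (mat_adjoint U * Matrix.mat d d x * Q) $$ (i, e a)))" for x
    proof -
      define H where "H = mat_adjoint U * Matrix.mat d d x * Q"
      have H: "H \<in> carrier_mat d d" using U'(1) Q'(1) by (simp add: H_def)
      define He where "He = Matrix.mat d k (\<lambda>(i, a). H $$ (i, e a))"
      have He: "He \<in> carrier_mat d k" by (simp add: He_def)
      let ?L = "mat_diag d (\<lambda>i. complex_of_real (w i))"
      have Mc: "?M B x \<in> carrier_mat k k"
        by (rule mult_carrier_mat[OF mult_carrier_mat[OF mat_adjoint_carrier[OF XB] \<Sigma>c] XB])
      have XT: "Matrix.mat d d x * B' = Matrix.mat d d x * B * T"
        unfolding B'_def by (rule assoc_mult_mat[OF X B T, symmetric])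
      have "mat_adjoint T * ?M B x * T = ?M B' x"
        unfolding XT by (rule congruence_mult[OF XB \<Sigma>c T])
      then have det1: "Determinant.det (?M B' x) = of_real ((cmod (Determinant.det T))\<^sup>2) * Determinant.det (?M B x)"
        using det_congruence[OF Mc T] by simp
      have HE: "mat_adjoint U * (Matrix.mat d d x * B') = He * Ee"
      proof -
        have "mat_adjoint U * (Matrix.mat d d x * B') = mat_adjoint U * (Matrix.mat d d x * ((Q * mat_adjoint Q) * B'))"
          unfolding Q'(3) left_mult_one_mat[OF B'] ..
        also have "\<dots> = H * E"
          using U'(1) Q'(1) B' by (simp add: H_def E_def assoc_mult_mat[of _ d d _ d _ k] assoc_mult_mat[of _ d d _ d _ d]
              mult_carrier_mat[of _ d d _ k])
        also have "\<dots> = He * Ee"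
        proof (rule eq_matI, goal_cases)
          case (1 i b)
          then have ib: "i < d" "b < k" by (auto simp: He_def Ee_def)
          have "(\<Sum>j<d. H $$ (i, j) * E $$ (j, b)) = (\<Sum>a<k. H $$ (i, e a) * E $$ (e a, b))"
            by (rule sum_over_image[OF e]) (use zero ib in \<open>simp add: E_def\<close>)
          then show ?case using H E ib by (simp add: He_def Ee_def scalar_prod_def atLeast0LessThan)
        qed (use H E in \<open>auto simp: He_def Ee_def\<close>)
        finally show ?thesis .
      qed
      have gram: "mat_adjoint He * (?L * He) = gram_mat k {..<d} w (\<lambda>i a. H $$ (i, e a))"
        unfolding mat_diag_mult_left[OF He]
        by (rule eq_matI) (auto simp: gram_mat_def He_def scalar_prod_def atLeast0LessThan mult_ac intro!: sum.cong)
      have XB': "Matrix.mat d d x * B' \<in> carrier_mat d k" by (rule mult_carrier_mat[OF X B'])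
      have "?M B' x = mat_adjoint (mat_adjoint U * (Matrix.mat d d x * B')) * (?L * (mat_adjoint U * (Matrix.mat d d x * B')))"
        unfolding \<Sigma> eigen_mat_def mat_adjoint_mult[OF mat_adjoint_carrier[OF U'(1)] XB'] mat_adjoint_adjoint
        using XB' U'(1)
        by (simp add: assoc_mult_mat[of _ k d _ d _ d] assoc_mult_mat[of _ k d _ d _ k] assoc_mult_mat[of _ d d _ d _ k]
            mult_carrier_mat[of _ d d _ k] mult_carrier_mat[of _ k d _ d] assoc_mult_mat[of _ d d _ d _ d])
      also have "\<dots> = mat_adjoint Ee * (mat_adjoint He * (?L * He)) * Ee"
        unfolding HE mat_adjoint_mult[OF He Ee] using He Ee
        by (simp add: assoc_mult_mat[of _ k k _ d _ k] assoc_mult_mat[of _ k d _ k _ k] assoc_mult_mat[of _ d d _ k _ k]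
            assoc_mult_mat[of _ k k _ k _ k] mult_carrier_mat[of _ d d _ k] mult_carrier_mat[of _ k d _ k] mult_carrier_mat[of _ d k _ k]
            mult_carrier_mat[of _ k k _ d])
      finally have "of_real ((cmod (Determinant.det T))\<^sup>2) * Determinant.det (?M B x)
          = Determinant.det (gram_mat k {..<d} w (\<lambda>i a. H $$ (i, e a)))"
        unfolding det1[symmetric] gram using det_congruence[OF gram_mat_carrier Ee] detE by simp
      moreover have "m = S * g" if "c * m = g" "c * S = 1" for c m S g :: complex
        unfolding that(1)[symmetric] using that(2) by (simp add: mult.assoc[symmetric] mult.commute[of S c])
      ultimately show ?thesis using detT unfolding H_def[symmetric] by blast
    qed
    have S0: "0 < Re (Determinant.det ?S)" and SR: "Determinant.det ?S = complex_of_real (Re (Determinant.det ?S))"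
      using det_gram_nonneg[OF B] False by (metis less_le of_real_0, metis)
    have pt: "ext_powr s (Re (Determinant.det (?M B x))) = ext_powr s (Re (Determinant.det ?S)) *
        ext_powr s (gram_det d k w (\<lambda>i a. (mat_adjoint U * Matrix.mat d d x * Q) $$ (i, e a)))" for x
    proof -
      have "Re (Determinant.det (?M B x)) = Re (Determinant.det ?S) *
          gram_det d k w (\<lambda>i a. (mat_adjoint U * Matrix.mat d d x * Q) $$ (i, e a))"
        unfolding key gram_det_def by (subst SR) simp
      then show ?thesis using S0 w by (simp add: ext_powr_mult gram_det_nonneg less_imp_le)
    qed
    have "(\<integral>\<^sup>+x. ext_powr s (Re (Determinant.det (?M B x))) \<partial>gauss ({..<d} \<times> {..<d}))
        = ext_powr s (Re (Determinant.det ?S)) * (\<integral>\<^sup>+x. ext_powr s (gram_det d k w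
            (\<lambda>i a. (mat_adjoint U * Matrix.mat d d x * Q) $$ (i, e a))) \<partial>gauss ({..<d} \<times> {..<d}))"
      unfolding pt ext_powr_pos[OF S0]
    proof (rule nn_integral_cmult)
      have HM: "(\<lambda>x. (mat_adjoint U * Matrix.mat d d x * Q) $$ (i, j)) \<in> borel_measurable (gauss ({..<d} \<times> {..<d}))"
        if ij: "i < d" "j < d" for i j
      proof -
        have "(\<lambda>x. \<Sum>l<d. (\<Sum>c<d. mat_adjoint U $$ (i, c) * x (c, l)) * Q $$ (l, j)) \<in> borel_measurable (gauss ({..<d} \<times> {..<d}))"
          by (intro borel_measurable_sum borel_measurable_times borel_measurable_const gauss_component) auto
        then show ?thesis using U'(1) Q'(1) ij by (simp add: scalar_prod_def atLeast0LessThan)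
      qed
      show "(\<lambda>x. ext_powr s (gram_det d k w (\<lambda>i a. (mat_adjoint U * Matrix.mat d d x * Q) $$ (i, e a))))
          \<in> borel_measurable (gauss ({..<d} \<times> {..<d}))"
        unfolding gram_det_def
      proof (intro measurable_compose[OF _ ext_powr_measurable] measurable_compose[OF det_measurable[of _ k] borel_measurable_Re])
        fix a b assume ab: "a < k" "b < k"
        have "(\<lambda>x. \<Sum>c<d. of_real (w c) * cnj ((mat_adjoint U * Matrix.mat d d x * Q) $$ (c, e a)) *
            (mat_adjoint U * Matrix.mat d d x * Q) $$ (c, e b)) \<in> borel_measurable (gauss ({..<d} \<times> {..<d}))"
          by (intro borel_measurable_sum borel_measurable_times borel_measurable_const
              measurable_compose[OF _ borel_measurable_cnj] HM elt ab) simp_all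
        then show "(\<lambda>x. gram_mat k {..<d} w (\<lambda>i a. (mat_adjoint U * Matrix.mat d d x * Q) $$ (i, e a)) $$ (a, b))
            \<in> borel_measurable (gauss ({..<d} \<times> {..<d}))"
          unfolding gram_mat_def index_mat(1)[OF ab] split .
      qed simp
    qed
    also have "\<dots> = ext_powr s (Re (Determinant.det ?S)) * (\<integral>\<^sup>+x. ext_powr s (gram_det d k w x) \<partial>gauss_rows d k)"
      by (subst gauss_rotated_columns[OF unitary_mat_adjoint[OF U] Q e]) (rule refl)
    also have "\<dots> \<le> ext_powr s (Re (Determinant.det ?S)) * ennreal C"
      by (rule mult_left_mono[OF bound]) simp
    finally show ?thesis by (simp add: mult.commute)
  qed
qed

section \<open>Moments along the product\<close>

definition mat_measurable :: "'x measure \<Rightarrow> nat \<Rightarrow> nat \<Rightarrow> ('x \<Rightarrow> complex mat) \<Rightarrow> bool" where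
  "mat_measurable M m n A \<longleftrightarrow> (\<forall>x. A x \<in> carrier_mat m n) \<and>
     (\<forall>i<m. \<forall>j<n. (\<lambda>x. A x $$ (i, j)) \<in> borel_measurable M)"

lemma mat_measurable_const: "A \<in> carrier_mat m n \<Longrightarrow> mat_measurable M m n (\<lambda>_. A)"
  by (auto simp: mat_measurable_def)

lemma mat_measurable_mult:
  assumes A: "mat_measurable M m n A" and B: "mat_measurable M n p B"
  shows "mat_measurable M m p (\<lambda>x. A x * B x)"
  unfolding mat_measurable_def
proof (intro conjI allI impI)
  have Ac: "A x \<in> carrier_mat m n" and Bc: "B x \<in> carrier_mat n p" for x
    using A B by (auto simp: mat_measurable_def)
  show "A x * B x \<in> carrier_mat m p" for x by (rule mult_carrier_mat[OF Ac Bc])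
  fix i j assume ij: "i < m" "j < p"
  have "(\<lambda>x. \<Sum>l<n. A x $$ (i, l) * B x $$ (l, j)) \<in> borel_measurable M"
    using A B ij by (intro borel_measurable_sum borel_measurable_times) (auto simp: mat_measurable_def)
  moreover have "(A x * B x) $$ (i, j) = (\<Sum>l<n. A x $$ (i, l) * B x $$ (l, j))" for x
    using Ac[of x] Bc[of x] ij by (simp add: scalar_prod_def atLeast0LessThan)
  ultimately show "(\<lambda>x. (A x * B x) $$ (i, j)) \<in> borel_measurable M" by (simp only:)
qed

lemma mat_measurable_adjoint:
  assumes A: "mat_measurable M m n A"
  shows "mat_measurable M n m (\<lambda>x. mat_adjoint (A x))"
  unfolding mat_measurable_def
proof (intro conjI allI impI)
  have Ac: "A x \<in> carrier_mat m n" for x using A by (auto simp: mat_measurable_def)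
  show "mat_adjoint (A x) \<in> carrier_mat n m" for x by (rule mat_adjoint_carrier[OF Ac])
  fix i j assume ij: "i < n" "j < m"
  have "(\<lambda>x. cnj (A x $$ (j, i))) \<in> borel_measurable M"
    by (rule measurable_compose[OF _ borel_measurable_cnj]) (use A ij in \<open>auto simp: mat_measurable_def\<close>)
  moreover have "mat_adjoint (A x) $$ (i, j) = cnj (A x $$ (j, i))" for x
    using Ac[of x] ij by simp
  ultimately show "(\<lambda>x. mat_adjoint (A x) $$ (i, j)) \<in> borel_measurable M" by (simp only:)
qed

lemma mat_measurable_sandwich:
  assumes "A \<in> carrier_mat m m" "mat_measurable M m n B"
  shows "mat_measurable M n n (\<lambda>x. mat_adjoint (B x) * A * B x)"
  by (rule mat_measurable_mult[OF mat_measurable_mult[OF mat_measurable_adjoint[OF assms(2)]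
        mat_measurable_const[OF assms(1)]] assms(2)])

lemma mat_measurable_det:
  assumes "mat_measurable M n n A"
  shows "(\<lambda>x. Determinant.det (A x)) \<in> borel_measurable M"
  by (rule det_measurable[of _ n]) (use assms in \<open>auto simp: mat_measurable_def\<close>)

lemma ext_powr_det_measurable:
  "mat_measurable M n n A \<Longrightarrow> (\<lambda>x. ext_powr s (Re (Determinant.det (A x)))) \<in> borel_measurable M"
  by (intro measurable_compose[OF _ ext_powr_measurable] measurable_compose[OF mat_measurable_det borel_measurable_Re])

lemma left_product_cong:
  "(\<And>n. 1 \<le> n \<Longrightarrow> n \<le> N \<Longrightarrow> A n = B n) \<Longrightarrow> left_product d A N = left_product d B N"
  by (induction N) auto

lemma left_product_carrier:
  "(\<And>n. 1 \<le> n \<Longrightarrow> A n \<in> carrier_mat d d) \<Longrightarrow> left_product d A N \<in> carrier_mat d d"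
  by (induction N) auto

text \<open>The independence assumption concerns the family of all entries, indexed by step, row and
  column; the product is treated as a function of that family.\<close>

definition level_mat :: "nat \<Rightarrow> (nat \<times> nat \<times> nat \<Rightarrow> complex) \<Rightarrow> nat \<Rightarrow> complex mat" where
  "level_mat d h n = Matrix.mat d d (\<lambda>p. h (n, p))"

lemma left_product_measurable:
  assumes S: "S \<in> carrier_mat d d" and K: "{1..N} \<times> {..<d} \<times> {..<d} \<subseteq> K"
  shows "mat_measurable (PiM K (\<lambda>_. borel)) d d (\<lambda>h. left_product d (\<lambda>n. S * level_mat d h n) N)"
  using K
proof (induction N)
  case 0
  show ?case by (simp add: mat_measurable_const)
next
  case (Suc N)
  have "mat_measurable (PiM K (\<lambda>_. borel)) d d (\<lambda>h. level_mat d h (Suc N))"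
    unfolding mat_measurable_def
  proof (intro conjI allI impI)
    show "level_mat d h (Suc N) \<in> carrier_mat d d" for h by (simp add: level_mat_def)
    fix i j assume "i < d" "j < d"
    then have "(\<lambda>h. h (Suc N, i, j)) \<in> PiM K (\<lambda>_. borel) \<rightarrow>\<^sub>M borel"
      using Suc.prems by (intro measurable_component_singleton) auto
    then show "(\<lambda>h. level_mat d h (Suc N) $$ (i, j)) \<in> borel_measurable (PiM K (\<lambda>_. borel))"
      using \<open>i < d\<close> \<open>j < d\<close> by (simp add: level_mat_def)
  qed
  moreover have "mat_measurable (PiM K (\<lambda>_. borel)) d d (\<lambda>h. left_product d (\<lambda>n. S * level_mat d h n) N)"
    by (rule Suc.IH) (use Suc.prems in auto)
  ultimately show ?case
    by (simp add: mat_measurable_mult[OF mat_measurable_mult[OF mat_measurable_const[OF S]]])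
qed

text \<open>The squared volume of the image of the columns of \<open>E\<close> after \<open>N\<close> steps.\<close>

definition image_gram :: "nat \<Rightarrow> complex mat \<Rightarrow> (nat \<Rightarrow> complex mat) \<Rightarrow> nat \<Rightarrow> complex mat \<Rightarrow> real" where
  "image_gram d S G N E = Re (Determinant.det
     (mat_adjoint (left_product d (\<lambda>n. S * G n) N * E) * (left_product d (\<lambda>n. S * G n) N * E)))"

text \<open>The past and the last factor are functions of disjoint blocks of the independent family of entries.
  Fubini allows the last factor to be integrated first, with the past frozen.\<close>

lemma image_gram_moment_step:
  assumes P: "prob_space M" and d: "1 \<le> d"
    and S: "S \<in> carrier_mat d d" "mat_adjoint S = S"
    and U: "unitary_mat d U" and SS: "S * S = eigen_mat d U (\<lambda>i. complex_of_real (w i))"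
    and w: "\<And>i. i < d \<Longrightarrow> 0 < w i"
    and G: "iid_complex_gaussian_matrices M d G"
    and E: "E \<in> carrier_mat d k" and C: "0 < C"
    and bound: "(\<integral>\<^sup>+x. ext_powr s (gram_det d k w x) \<partial>gauss_rows d k) \<le> ennreal C"
  shows "(\<integral>\<^sup>+\<omega>. ext_powr s (image_gram d S (\<lambda>n. G n \<omega>) (Suc N) E) \<partial>M)
    \<le> ennreal C * (\<integral>\<^sup>+\<omega>. ext_powr s (image_gram d S (\<lambda>n. G n \<omega>) N E) \<partial>M)"
proof -
  interpret prob_space M by (rule P)
  define X where "X v \<omega> = (case v of (n, i, j) \<Rightarrow> G n \<omega> $$ (i, j))" for v \<omega>
  let ?D = "{..<d} \<times> {..<d}"
  define A1 where "A1 = {Suc N} \<times> ?D"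
  define A2 where "A2 = {1..N} \<times> ?D"
  have Gc: "G n \<omega> \<in> carrier_mat d d" if "1 \<le> n" "\<omega> \<in> space M" for n \<omega>
    using G that by (auto simp: iid_complex_gaussian_matrices_def)
  have indep: "indep_vars (\<lambda>_. borel) X ({1..} \<times> ?D)"
    using G by (simp add: iid_complex_gaussian_matrices_def X_def[abs_def] case_prod_unfold)
  have Xd: "distr M borel (X v) = cgauss" if "v \<in> {1..} \<times> ?D" for v
  proof -
    obtain n i j where v: "v = (n, i, j)" by (cases v)
    have "X v = (\<lambda>\<omega>. G n \<omega> $$ (i, j))" by (auto simp: X_def v fun_eq_iff)
    then have "distributed M lborel (X v) (\<lambda>z. ennreal (exp (- (cmod z)\<^sup>2) / pi))"
      using G that v by (simp add: iid_complex_gaussian_matrices_def standard_complex_normal_def)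
    then have "distr M lborel (X v) = cgauss" by (simp add: distributed_def cgauss_def)
    moreover have "distr M borel (X v) = distr M lborel (X v)" by (rule distr_cong) auto
    ultimately show ?thesis by simp
  qed
  define Y1 where "Y1 \<omega> = (\<lambda>v\<in>A1. X v \<omega>)" for \<omega>
  define Y2 where "Y2 \<omega> = (\<lambda>v\<in>A2. X v \<omega>)" for \<omega>
  have ind: "indep_var (PiM A1 (\<lambda>_. borel)) Y1 (PiM A2 (\<lambda>_. borel)) Y2"
    unfolding Y1_def[abs_def] Y2_def[abs_def]
    by (rule indep_var_restrict[OF indep]) (auto simp: A1_def A2_def)
  have Y1m: "Y1 \<in> M \<rightarrow>\<^sub>M PiM A1 (\<lambda>_. borel)" and Y2m: "Y2 \<in> M \<rightarrow>\<^sub>M PiM A2 (\<lambda>_. borel)"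
    using indep_var_rv1[OF ind] indep_var_rv2[OF ind] .
  have Y1d: "distr M (PiM A1 (\<lambda>_. borel)) Y1 = gauss A1"
  proof -
    have A1ne: "A1 \<noteq> {}" using d by (auto simp: A1_def lessThan_empty_iff)
    have A1s: "A1 \<subseteq> {1..} \<times> ?D" by (auto simp: A1_def)
    have rv: "random_variable borel (X v)" if "v \<in> A1" for v
      using indep A1s that by (auto simp: indep_vars_def)
    have "distr M (PiM A1 (\<lambda>_. borel)) (\<lambda>\<omega>. \<lambda>v\<in>A1. X v \<omega>) = PiM A1 (\<lambda>v. distr M borel (X v))"
      using indep_vars_iff_distr_eq_PiM'[OF A1ne, where M' = "\<lambda>_. borel" and X = X] rv indep_vars_subset[OF indep A1s] by simp
    also have "\<dots> = gauss A1" by (rule PiM_cong) (use A1s Xd in auto)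
    finally show ?thesis by (simp add: Y1_def[abs_def])
  qed
  define \<beta> where "\<beta> h = left_product d (\<lambda>n. S * level_mat d h n) N * E" for h
  have \<beta>c: "\<beta> h \<in> carrier_mat d k" for h
    unfolding \<beta>_def
    by (rule mult_carrier_mat[OF left_product_carrier E]) (use S in \<open>simp add: level_mat_def\<close>)
  define T where "T g h = mat_adjoint (level_mat d g (Suc N) * \<beta> h) * (S * S) * (level_mat d g (Suc N) * \<beta> h)" for g h
  define F where "F g h = ext_powr s (Re (Determinant.det (T g h)))" for g h
  have \<beta>m: "mat_measurable (PiM A2 (\<lambda>_. borel)) d k \<beta>"
    unfolding \<beta>_def
    by (intro mat_measurable_mult[OF left_product_measurable mat_measurable_const[OF E]] S) (auto simp: A2_def)
  have lm: "mat_measurable (PiM A1 (\<lambda>_. borel)) d d (\<lambda>g. level_mat d g (Suc N))"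
    unfolding mat_measurable_def
  proof (intro conjI allI impI)
    show "level_mat d g (Suc N) \<in> carrier_mat d d" for g by (simp add: level_mat_def)
    fix i j assume "i < d" "j < d"
    then have "(\<lambda>h. h (Suc N, i, j)) \<in> PiM A1 (\<lambda>_. borel) \<rightarrow>\<^sub>M borel"
      by (intro measurable_component_singleton) (auto simp: A1_def)
    then show "(\<lambda>h. level_mat d h (Suc N) $$ (i, j)) \<in> borel_measurable (PiM A1 (\<lambda>_. borel))"
      using \<open>i < d\<close> \<open>j < d\<close> by (simp add: level_mat_def)
  qed
  let ?P = "PiM A1 (\<lambda>_. borel) \<Otimes>\<^sub>M PiM A2 (\<lambda>_. borel) :: ((nat \<times> nat \<times> nat \<Rightarrow> complex) \<times> (nat \<times> nat \<times> nat \<Rightarrow> complex)) measure"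
  have fst_m: "mat_measurable ?P d d (\<lambda>p. level_mat d (fst p) (Suc N))"
    using lm unfolding mat_measurable_def by (auto intro: measurable_compose[OF measurable_fst])
  have snd_m: "mat_measurable ?P d k (\<lambda>p. \<beta> (snd p))"
    using \<beta>m unfolding mat_measurable_def by (auto intro: measurable_compose[OF measurable_snd])
  have Fm: "(\<lambda>p. F (fst p) (snd p)) \<in> borel_measurable ?P"
    unfolding F_def T_def
    by (rule ext_powr_det_measurable[OF mat_measurable_sandwich[OF mult_carrier_mat[OF S(1) S(1)]
          mat_measurable_mult[OF fst_m snd_m]]])
  \<comment> \<open>given the past, only the last factor is integrated\<close>
  have inner: "(\<integral>\<^sup>+g. F g h \<partial>gauss A1) \<le> ennreal C * ext_powr s (Re (Determinant.det (mat_adjoint (\<beta> h) * \<beta> h)))" for h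
  proof -
    define f where "f x = ext_powr s (Re (Determinant.det
        (mat_adjoint (Matrix.mat d d x * \<beta> h) * (S * S) * (Matrix.mat d d x * \<beta> h))))" for x :: "nat \<times> nat \<Rightarrow> complex"
    let ?t = "\<lambda>g. \<lambda>p\<in>?D. g (Suc N, p) :: complex"
    have t: "?t \<in> gauss A1 \<rightarrow>\<^sub>M gauss ?D"
      by (intro measurable_restrict measurable_component_singleton) (auto simp: A1_def)
    have dt: "distr (gauss A1) (gauss ?D) ?t = gauss ?D"
      by (rule distr_PiM_reindex) (auto simp: A1_def prob_space_cgauss inj_on_def)
    have fm: "f \<in> borel_measurable (gauss ?D)"
    proof -
      have mm: "mat_measurable (gauss ?D) d d (\<lambda>x. Matrix.mat d d x)"
        by (auto simp: mat_measurable_def intro: gauss_component)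
      show ?thesis
        unfolding f_def
        by (rule ext_powr_det_measurable[OF mat_measurable_sandwich[OF mult_carrier_mat[OF S(1) S(1)]
              mat_measurable_mult[OF mm mat_measurable_const[OF \<beta>c]]]])
    qed
    have "F g h = f (?t g)" for g
    proof -
      have "level_mat d g (Suc N) = Matrix.mat d d (?t g)" by (rule eq_matI) (auto simp: level_mat_def)
      then show ?thesis by (simp only: F_def T_def f_def)
    qed
    then have "(\<integral>\<^sup>+g. F g h \<partial>gauss A1) = (\<integral>\<^sup>+x. f x \<partial>gauss ?D)"
      using nn_integral_distr[OF t, of f] fm dt by simp
    also have "\<dots> \<le> ennreal C * ext_powr s (Re (Determinant.det (mat_adjoint (\<beta> h) * \<beta> h)))"
      unfolding f_def by (rule gauss_factor_step[OF U SS w \<beta>c C bound])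
    finally show ?thesis .
  qed
  have past: "\<beta> (Y2 \<omega>) = left_product d (\<lambda>n. S * G n \<omega>) N * E"
    and now: "level_mat d (Y1 \<omega>) (Suc N) = G (Suc N) \<omega>" if \<omega>: "\<omega> \<in> space M" for \<omega>
  proof -
    have "level_mat d (Y2 \<omega>) n = G n \<omega>" if "1 \<le> n" "n \<le> N" for n
      using that Gc[OF that(1) \<omega>] by (intro eq_matI) (auto simp: level_mat_def Y2_def A2_def X_def)
    then show "\<beta> (Y2 \<omega>) = left_product d (\<lambda>n. S * G n \<omega>) N * E"
      unfolding \<beta>_def by (intro arg_cong2[where f = "(*)"] left_product_cong refl) simp
    show "level_mat d (Y1 \<omega>) (Suc N) = G (Suc N) \<omega>"
      using Gc[OF _ \<omega>, of "Suc N"] by (intro eq_matI) (auto simp: level_mat_def Y1_def A1_def X_def)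
  qed
  have F_eq: "ext_powr s (image_gram d S (\<lambda>n. G n \<omega>) (Suc N) E) = F (Y1 \<omega>) (Y2 \<omega>)" if \<omega>: "\<omega> \<in> space M" for \<omega>
  proof -
    let ?L = "left_product d (\<lambda>n. S * G n \<omega>) N" and ?G = "G (Suc N) \<omega>"
    have L: "?L \<in> carrier_mat d d" by (rule left_product_carrier) (use S Gc[OF _ \<omega>] in auto)
    have Gc': "?G \<in> carrier_mat d d" using Gc[OF _ \<omega>] by simp
    have H: "?G * (?L * E) \<in> carrier_mat d k" by (rule mult_carrier_mat[OF Gc' mult_carrier_mat[OF L E]])
    have "S * ?G * ?L * E = S * (?G * (?L * E))"
      using assoc_mult_mat[OF S(1) Gc' L] assoc_mult_mat[OF S(1) square_mat_mult_closed[OF Gc' L] E]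
        assoc_mult_mat[OF Gc' L E] by simp
    then have "mat_adjoint (S * ?G * ?L * E) * (S * ?G * ?L * E)
        = (mat_adjoint (?G * (?L * E)) * S) * (S * (?G * (?L * E)))"
      by (simp add: mat_adjoint_mult[OF S(1) H] S(2))
    also have "\<dots> = mat_adjoint (?G * (?L * E)) * (S * S) * (?G * (?L * E))"
      using assoc_mult_mat[OF mult_carrier_mat[OF mat_adjoint_carrier[OF H] S(1)] S(1) H]
        assoc_mult_mat[OF mat_adjoint_carrier[OF H] S(1) S(1)] by simp
    finally show ?thesis
      by (simp add: image_gram_def F_def T_def past[OF \<omega>] now[OF \<omega>])
  qed
  have gauss_sets: "sets (gauss A1) = sets (PiM A1 (\<lambda>_. borel))" by (rule sets_PiM_cong) auto
  interpret D2: prob_space "distr M (PiM A2 (\<lambda>_. borel)) Y2" by (rule prob_space_distr[OF Y2m])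
  interpret gA1: prob_space "gauss A1" by (rule prob_space_gauss)
  interpret pair: pair_sigma_finite "gauss A1" "distr M (PiM A2 (\<lambda>_. borel)) Y2" ..
  have Fm': "(\<lambda>(g, h). F g h) \<in> borel_measurable (gauss A1 \<Otimes>\<^sub>M distr M (PiM A2 (\<lambda>_. borel)) Y2)"
    using Fm by (simp add: case_prod_unfold measurable_cong_sets[OF sets_pair_measure_cong[OF gauss_sets sets_distr] refl])
  have "(\<integral>\<^sup>+\<omega>. ext_powr s (image_gram d S (\<lambda>n. G n \<omega>) (Suc N) E) \<partial>M) = (\<integral>\<^sup>+\<omega>. F (Y1 \<omega>) (Y2 \<omega>) \<partial>M)"
    by (rule nn_integral_cong) (rule F_eq)
  also have "\<dots> = (\<integral>\<^sup>+p. F (fst p) (snd p) \<partial>distr M ?P (\<lambda>\<omega>. (Y1 \<omega>, Y2 \<omega>)))"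
    by (subst nn_integral_distr) (use Y1m Y2m Fm in auto)
  also have "distr M ?P (\<lambda>\<omega>. (Y1 \<omega>, Y2 \<omega>)) = gauss A1 \<Otimes>\<^sub>M distr M (PiM A2 (\<lambda>_. borel)) Y2"
    using ind unfolding indep_var_distribution_eq Y1d by simp
  also have "(\<integral>\<^sup>+p. F (fst p) (snd p) \<partial>(gauss A1 \<Otimes>\<^sub>M distr M (PiM A2 (\<lambda>_. borel)) Y2))
      = (\<integral>\<^sup>+h. \<integral>\<^sup>+g. F g h \<partial>gauss A1 \<partial>distr M (PiM A2 (\<lambda>_. borel)) Y2)"
    using pair.nn_integral_snd[OF Fm'] by (simp add: case_prod_unfold)
  also have "\<dots> \<le> (\<integral>\<^sup>+h. ennreal C * ext_powr s (Re (Determinant.det (mat_adjoint (\<beta> h) * \<beta> h))) \<partial>distr M (PiM A2 (\<lambda>_. borel)) Y2)"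
    by (intro nn_integral_mono inner)
  also have "\<dots> = (\<integral>\<^sup>+\<omega>. ennreal C * ext_powr s (Re (Determinant.det (mat_adjoint (\<beta> (Y2 \<omega>)) * \<beta> (Y2 \<omega>)))) \<partial>M)"
  proof (rule nn_integral_distr[OF Y2m])
    show "(\<lambda>h. ennreal C * ext_powr s (Re (Determinant.det (mat_adjoint (\<beta> h) * \<beta> h))))
        \<in> borel_measurable (distr M (PiM A2 (\<lambda>_. borel)) Y2)"
      unfolding measurable_distr_eq1
      by (rule borel_measurable_times_ennreal[OF borel_measurable_const
            ext_powr_det_measurable[OF mat_measurable_mult[OF mat_measurable_adjoint[OF \<beta>m] \<beta>m]]])
  qed
  also have "\<dots> = ennreal C * (\<integral>\<^sup>+\<omega>. ext_powr s (Re (Determinant.det (mat_adjoint (\<beta> (Y2 \<omega>)) * \<beta> (Y2 \<omega>)))) \<partial>M)"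
    by (rule nn_integral_cmult)
       (rule measurable_compose[OF Y2m ext_powr_det_measurable[OF mat_measurable_mult[OF mat_measurable_adjoint[OF \<beta>m] \<beta>m]]])
  also have "(\<integral>\<^sup>+\<omega>. ext_powr s (Re (Determinant.det (mat_adjoint (\<beta> (Y2 \<omega>)) * \<beta> (Y2 \<omega>)))) \<partial>M)
      = (\<integral>\<^sup>+\<omega>. ext_powr s (image_gram d S (\<lambda>n. G n \<omega>) N E) \<partial>M)"
    by (rule nn_integral_cong) (simp add: past image_gram_def)
  finally show ?thesis .
qed

lemma image_gram_moment:
  assumes P: "prob_space M" and d: "1 \<le> d"
    and S: "S \<in> carrier_mat d d" "mat_adjoint S = S"
    and U: "unitary_mat d U" and SS: "S * S = eigen_mat d U (\<lambda>i. complex_of_real (w i))"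
    and w: "\<And>i. i < d \<Longrightarrow> 0 < w i"
    and G: "iid_complex_gaussian_matrices M d G"
    and E: "E \<in> carrier_mat d k" "mat_adjoint E * E = 1\<^sub>m k" and C: "0 < C"
    and bound: "(\<integral>\<^sup>+x. ext_powr s (gram_det d k w x) \<partial>gauss_rows d k) \<le> ennreal C"
  shows "(\<integral>\<^sup>+\<omega>. ext_powr s (image_gram d S (\<lambda>n. G n \<omega>) N E) \<partial>M) \<le> ennreal (C ^ N)"
proof (induction N)
  case 0
  interpret prob_space M by (rule P)
  have "image_gram d S (\<lambda>n. G n \<omega>) 0 E = 1" for \<omega>
    using E by (simp add: image_gram_def)
  then show ?case by (simp add: emeasure_space_1)
next
  case (Suc N)
  have "(\<integral>\<^sup>+\<omega>. ext_powr s (image_gram d S (\<lambda>n. G n \<omega>) (Suc N) E) \<partial>M)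
      \<le> ennreal C * (\<integral>\<^sup>+\<omega>. ext_powr s (image_gram d S (\<lambda>n. G n \<omega>) N E) \<partial>M)"
    by (rule image_gram_moment_step[OF P d S U SS w G E(1) C bound])
  also have "\<dots> \<le> ennreal C * ennreal (C ^ N)" by (rule mult_left_mono[OF Suc.IH]) simp
  also have "\<dots> = ennreal (C ^ Suc N)" using C by (simp add: ennreal_mult[symmetric])
  finally show ?case .
qed

lemma image_gram_measurable:
  assumes S: "S \<in> carrier_mat d d" and E: "E \<in> carrier_mat d k"
    and G: "iid_complex_gaussian_matrices M d G" and P: "prob_space M"
  shows "(\<lambda>\<omega>. image_gram d S (\<lambda>n. G n \<omega>) N E) \<in> borel_measurable M"
proof -
  interpret prob_space M by (rule P)
  let ?K = "{1..N} \<times> {..<d} \<times> {..<d}"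
  define Y where "Y \<omega> = (\<lambda>v\<in>?K. case v of (n, i, j) \<Rightarrow> G n \<omega> $$ (i, j))" for \<omega>
  define \<beta> where "\<beta> h = left_product d (\<lambda>n. S * level_mat d h n) N * E" for h
  have "(\<lambda>\<omega>. case v of (n, i, j) \<Rightarrow> G n \<omega> $$ (i, j)) \<in> borel_measurable M" if "v \<in> ?K" for v
    using G that by (auto simp: iid_complex_gaussian_matrices_def standard_complex_normal_def distributed_def)
  then have Ym: "Y \<in> M \<rightarrow>\<^sub>M PiM ?K (\<lambda>_. borel)"
    unfolding Y_def by (rule measurable_restrict)
  have \<beta>m: "mat_measurable (PiM ?K (\<lambda>_. borel)) d k \<beta>"
    unfolding \<beta>_def by (intro mat_measurable_mult[OF left_product_measurable mat_measurable_const[OF E]] S) simp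
  have "(\<lambda>h. Re (Determinant.det (mat_adjoint (\<beta> h) * \<beta> h))) \<in> borel_measurable (PiM ?K (\<lambda>_. borel))"
    by (rule measurable_compose[OF mat_measurable_det[OF mat_measurable_mult[OF mat_measurable_adjoint[OF \<beta>m] \<beta>m]]
          borel_measurable_Re])
  from measurable_compose[OF Ym this]
  have "(\<lambda>\<omega>. Re (Determinant.det (mat_adjoint (\<beta> (Y \<omega>)) * \<beta> (Y \<omega>)))) \<in> borel_measurable M" .
  moreover have "Re (Determinant.det (mat_adjoint (\<beta> (Y \<omega>)) * \<beta> (Y \<omega>))) = image_gram d S (\<lambda>n. G n \<omega>) N E"
    if \<omega>: "\<omega> \<in> space M" for \<omega>
  proof -
    have "level_mat d (Y \<omega>) n = G n \<omega>" if "1 \<le> n" "n \<le> N" for n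
    proof -
      have "G n \<omega> \<in> carrier_mat d d" using G that \<omega> by (auto simp: iid_complex_gaussian_matrices_def)
      then show ?thesis using that by (intro eq_matI) (auto simp: level_mat_def Y_def)
    qed
    then have "\<beta> (Y \<omega>) = left_product d (\<lambda>n. S * G n \<omega>) N * E"
      unfolding \<beta>_def by (intro arg_cong2[where f = "(*)"] left_product_cong refl) simp
    then show ?thesis by (simp add: image_gram_def)
  qed
  ultimately show ?thesis by (subst (asm) measurable_cong) auto
qed

section \<open>Almost sure growth\<close>

text \<open>The derivative of \<open>det_moment\<close> at \<open>0\<close>; it turns out to be the exponential growth rate of the
  principal minors of size \<open>k\<close>.\<close>

definition log_det_mean :: "nat \<Rightarrow> nat \<Rightarrow> (nat \<Rightarrow> real) \<Rightarrow> real" where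
  "log_det_mean d k \<eta> = (\<Sum>i = 1..k. Digamma (real i)) +
     (\<Sum>\<sigma> | \<sigma> permutes {..<d}. vandermonde_weight d \<eta> \<sigma> * (\<Sum>i<d. if \<sigma> i < k then - ln (\<eta> i) else 0))"

lemma det_moment_0:
  assumes "inj_on \<eta> {..<d}" "\<And>i. i < d \<Longrightarrow> 0 < \<eta> i"
  shows "det_moment d k \<eta> 0 = 1"
proof -
  have "(\<Prod>i<d. if \<sigma> i < k then 1 / \<eta> i else 1) \<noteq> 0" for \<sigma>
    using less_imp_neq[OF assms(2), symmetric] by (auto simp: prod_zero_iff)
  moreover have "Gamma (real i) \<noteq> 0" if "i \<in> {1..k}" for i
  proof -
    have "0 < Gamma (real i)" using that by (intro Gamma_real_pos) auto
    then show ?thesis by simp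
  qed
  ultimately show ?thesis
    using sum_vandermonde_weight[OF assms] by (simp add: det_moment_def)
qed

lemma det_moment_has_derivative:
  assumes inj: "inj_on \<eta> {..<d}" and pos: "\<And>i. i < d \<Longrightarrow> 0 < \<eta> i"
  shows "(det_moment d k \<eta> has_real_derivative log_det_mean d k \<eta>) (at 0)"
proof -
  define \<tau> where "\<tau> \<sigma> = (\<Prod>i<d. if \<sigma> i < k then 1 / \<eta> i else 1)" for \<sigma> :: "nat \<Rightarrow> nat"
  have \<tau>: "0 < \<tau> \<sigma>" for \<sigma> unfolding \<tau>_def by (intro prod_pos) (use pos in auto)
  have ln\<tau>: "ln (\<tau> \<sigma>) = (\<Sum>i<d. if \<sigma> i < k then - ln (\<eta> i) else 0)" for \<sigma>
    unfolding \<tau>_def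
    by (subst ln_prod) (use pos in \<open>auto simp: ln_div less_imp_neq[OF pos, symmetric] intro!: sum.cong\<close>)
  have G: "((\<lambda>s. Gamma (real i + s) / Gamma (real i)) has_real_derivative Digamma (real i)) (at 0)"
    if "i \<in> {1..k}" for i
  proof -
    have g: "0 < Gamma (real i)" using that by simp
    have "((\<lambda>s. Gamma (real i + s)) has_real_derivative Gamma (real i + 0) * Digamma (real i + 0) * 1) (at 0)"
      by (rule DERIV_chain2[OF has_field_derivative_Gamma])
         (use that in \<open>auto intro!: derivative_eq_intros dest: nonpos_Ints_nonpos\<close>)
    from DERIV_cdivide[OF this, of "Gamma (real i)"] show ?thesis using g by simp
  qed
  have one: "(\<Prod>i\<in>A. Gamma (real i + 0) / Gamma (real i)) = (1 :: real)" if "A \<subseteq> {1..k}" for A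
  proof (rule prod.neutral, intro ballI)
    fix i assume "i \<in> A"
    then have "0 < Gamma (real i)" using that by (intro Gamma_real_pos) auto
    then show "Gamma (real i + 0) / Gamma (real i) = 1" by simp
  qed
  have "((\<lambda>s. \<Prod>i = 1..k. Gamma (real i + s) / Gamma (real i)) has_real_derivative
      (\<Sum>i = 1..k. Digamma (real i) * (\<Prod>j\<in>{1..k} - {i}. Gamma (real j + 0) / Gamma (real j)))) (at 0)"
    by (rule has_field_derivative_prod) (rule G)
  also have "(\<Sum>i = 1..k. Digamma (real i) * (\<Prod>j\<in>{1..k} - {i}. Gamma (real j + 0) / Gamma (real j)))
      = (\<Sum>i = 1..k. Digamma (real i))"
    by (intro sum.cong refl) (subst one, auto)
  finally have D1: "((\<lambda>s. \<Prod>i = 1..k. Gamma (real i + s) / Gamma (real i)) has_real_derivative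
      (\<Sum>i = 1..k. Digamma (real i))) (at 0)" .
  have D2: "((\<lambda>s. \<Sum>\<sigma> | \<sigma> permutes {..<d}. vandermonde_weight d \<eta> \<sigma> * \<tau> \<sigma> powr s) has_real_derivative
      (\<Sum>\<sigma> | \<sigma> permutes {..<d}. vandermonde_weight d \<eta> \<sigma> * ln (\<tau> \<sigma>))) (at 0)"
  proof (rule DERIV_sum)
    fix \<sigma> :: "nat \<Rightarrow> nat"
    have "((\<lambda>s. exp (s * ln (\<tau> \<sigma>))) has_real_derivative ln (\<tau> \<sigma>)) (at 0)"
      by (auto intro!: derivative_eq_intros)
    then have "((\<lambda>s. \<tau> \<sigma> powr s) has_real_derivative ln (\<tau> \<sigma>)) (at 0)"
      using \<tau>[of \<sigma>] by (simp add: powr_def[abs_def])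
    from DERIV_cmult[OF this]
    show "((\<lambda>s. vandermonde_weight d \<eta> \<sigma> * \<tau> \<sigma> powr s) has_real_derivative
        vandermonde_weight d \<eta> \<sigma> * ln (\<tau> \<sigma>)) (at 0)" .
  qed
  have \<tau>0: "\<tau> \<sigma> powr 0 = 1" for \<sigma> using \<tau>[of \<sigma>] by simp
  have "(det_moment d k \<eta> has_real_derivative
      (\<Sum>i = 1..k. Digamma (real i)) * (\<Sum>\<sigma> | \<sigma> permutes {..<d}. vandermonde_weight d \<eta> \<sigma> * \<tau> \<sigma> powr 0)
      + (\<Sum>\<sigma> | \<sigma> permutes {..<d}. vandermonde_weight d \<eta> \<sigma> * ln (\<tau> \<sigma>))
        * (\<Prod>i = 1..k. Gamma (real i + 0) / Gamma (real i))) (at 0)"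
    using DERIV_mult[OF D1 D2] by (simp only: det_moment_def[abs_def] \<tau>_def)
  then show ?thesis
    unfolding one[OF order_refl] \<tau>0 ln\<tau> log_det_mean_def
    using sum_vandermonde_weight[OF assms] by simp
qed

text \<open>Since the moment function is \<open>1\<close> at \<open>0\<close>, any slope on the correct side of its derivative there
  beats it for small exponents of the corresponding sign.\<close>

lemma small_moments:
  fixes f :: "real \<Rightarrow> real"
  assumes f: "(f has_real_derivative m) (at 0)" "f 0 = 1" and \<delta>: "0 < \<delta>"
  obtains s where "0 < s" "s < 1" "f s < exp (s * (m + \<delta>))" "f (- s) < exp (- s * (m - \<delta>))"
proof -
  have "((\<lambda>s. f s - exp (s * (m + \<delta>))) has_real_derivative m - (m + \<delta>)) (at 0)"
    by (rule DERIV_diff[OF f(1)]) (auto intro!: derivative_eq_intros)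
  from DERIV_neg_dec_right[OF this] \<delta> obtain r where r: "0 < r" "\<And>h. 0 < h \<Longrightarrow> h < r \<Longrightarrow> f h < exp (h * (m + \<delta>))"
    using f(2) by auto
  have "((\<lambda>s. f s - exp (s * (m - \<delta>))) has_real_derivative m - (m - \<delta>)) (at 0)"
    by (rule DERIV_diff[OF f(1)]) (auto intro!: derivative_eq_intros)
  from DERIV_pos_inc_left[OF this] \<delta> obtain r' where r': "0 < r'" "\<And>h. 0 < h \<Longrightarrow> h < r' \<Longrightarrow> f (- h) < exp (- h * (m - \<delta>))"
    using f(2) by auto
  show thesis
    using r r' by (intro that[of "min (1 / 2) (min r r' / 2)"]) auto
qed

text \<open>The bound is assumed for every positive \<open>C'\<close> above \<open>C\<close>, so \<open>C\<close> itself may fail to be positive.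
  Any \<open>C'\<close> strictly between \<open>C\<close> and \<open>R\<close> makes the probabilities in Markov's inequality geometric, and
  the Borel-Cantelli lemma applies.\<close>

lemma (in prob_space) AE_eventually_less_power:
  assumes Z: "\<And>N. Z N \<in> borel_measurable M" and C: "C < R" "0 < R"
    and bound: "\<And>C' N. C \<le> C' \<Longrightarrow> 0 < C' \<Longrightarrow> (\<integral>\<^sup>+\<omega>. Z N \<omega> \<partial>M) \<le> ennreal (C' ^ N)"
  shows "AE \<omega> in M. eventually (\<lambda>N. Z N \<omega> < ennreal (R ^ N)) sequentially"
proof -
  \<comment> \<open>\<open>R / 2\<close> keeps \<open>C'\<close> positive\<close>
  define C' where "C' = max C (R / 2)"
  have C': "0 < C'" "C' < R" "C \<le> C'" using C by (auto simp: C'_def)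
  define A where "A N = {\<omega> \<in> space M. 1 \<le> ennreal (1 / R ^ N) * Z N \<omega>}" for N
  have AM: "A N \<in> sets M" for N
  proof -
    note [measurable] = Z[of N]
    show ?thesis unfolding A_def by measurable
  qed
  have Rpos: "0 < R ^ N" for N using C by simp
  have prob: "measure M (A N) \<le> (C' / R) ^ N" for N
  proof -
    have "emeasure M (A N) \<le> ennreal (1 / R ^ N) * (\<integral>\<^sup>+\<omega>. Z N \<omega> * indicator (space M) \<omega> \<partial>M)"
      unfolding A_def by (rule nn_integral_Markov_inequality)
        (auto intro!: borel_measurable_times_ennreal Z)
    also have "(\<integral>\<^sup>+\<omega>. Z N \<omega> * indicator (space M) \<omega> \<partial>M) = (\<integral>\<^sup>+\<omega>. Z N \<omega> \<partial>M)"
      by (rule nn_integral_cong) auto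
    also have "ennreal (1 / R ^ N) * \<dots> \<le> ennreal (1 / R ^ N) * ennreal (C' ^ N)"
      by (rule mult_left_mono[OF bound]) (use C' in auto)
    also have "\<dots> = ennreal ((C' / R) ^ N)"
      using C' C by (simp add: ennreal_mult[symmetric] power_divide)
    finally show ?thesis using C' C by (simp add: emeasure_eq_measure)
  qed
  have "summable (\<lambda>N. measure M (A N))"
    by (rule summable_comparison_test'[OF summable_geometric[of "C' / R"]]) (use C' C prob in auto)
  from borel_cantelli_AE1[OF AM _ this]
  have "AE \<omega> in M. eventually (\<lambda>N. \<omega> \<in> space M - A N) sequentially"
    by (simp add: emeasure_eq_measure)
  then show ?thesis
  proof (rule AE_mp, intro AE_I2 impI)
    fix \<omega> assume "eventually (\<lambda>N. \<omega> \<in> space M - A N) sequentially"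
    then show "eventually (\<lambda>N. Z N \<omega> < ennreal (R ^ N)) sequentially"
    proof eventually_elim
      case (elim N)
      show ?case
      proof (rule ccontr)
        assume "\<not> Z N \<omega> < ennreal (R ^ N)"
        then have "ennreal (1 / R ^ N) * ennreal (R ^ N) \<le> ennreal (1 / R ^ N) * Z N \<omega>"
          by (intro mult_left_mono) auto
        moreover have "ennreal (1 / R ^ N) * ennreal (R ^ N) = 1"
          using Rpos[of N] C by (simp add: ennreal_mult[symmetric])
        ultimately show False using elim by (auto simp: A_def)
      qed
    qed
  qed
qed

text \<open>Moments of small positive order control the growth from above and moments of small negative
  order control it from below.\<close>

lemma image_gram_growth:
  assumes P: "prob_space M" and d: "1 \<le> d" and k: "k \<le> d"
    and S: "S \<in> carrier_mat d d" "mat_adjoint S = S"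
    and U: "unitary_mat d U" and SS: "S * S = eigen_mat d U (\<lambda>i. complex_of_real (w i))"
    and w: "\<And>i. i < d \<Longrightarrow> 0 < w i"
    and G: "iid_complex_gaussian_matrices M d G"
    and E: "E \<in> carrier_mat d k" "mat_adjoint E * E = 1\<^sub>m k"
    and inj: "inj_on \<eta> {..<d}" and pos: "\<And>i. i < d \<Longrightarrow> 0 < \<eta> i"
    and near: "\<And>i. i < d \<Longrightarrow> w i \<le> exp \<epsilon> * (1 / \<eta> i)" "\<And>i. i < d \<Longrightarrow> exp (- \<epsilon>) * (1 / \<eta> i) \<le> w i"
    and \<delta>: "0 < \<delta>"
  defines "m \<equiv> log_det_mean d k \<eta>"
  shows "AE \<omega> in M. eventually (\<lambda>N.
      exp (real N * (m - real k * \<epsilon> - \<delta>)) \<le> image_gram d S (\<lambda>n. G n \<omega>) N E \<and>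
      image_gram d S (\<lambda>n. G n \<omega>) N E \<le> exp (real N * (m + real k * \<epsilon> + \<delta>))) sequentially"
proof -
  interpret prob_space M by (rule P)
  let ?D = "\<lambda>N \<omega>. image_gram d S (\<lambda>n. G n \<omega>) N E"
  obtain s where s: "0 < s" "s < 1"
    and up: "det_moment d k \<eta> s < exp (s * (m + \<delta>))"
    and lo: "det_moment d k \<eta> (- s) < exp (- s * (m - \<delta>))"
    using small_moments[OF det_moment_has_derivative[OF inj pos] det_moment_0[OF inj pos] \<delta>]
    unfolding m_def by metis
  have Zm: "(\<lambda>\<omega>. ext_powr t (?D N \<omega>)) \<in> borel_measurable M" for t N
    by (rule measurable_compose[OF image_gram_measurable[OF S(1) E(1) G P] ext_powr_measurable])
  have moments: "(\<integral>\<^sup>+\<omega>. ext_powr t (?D N \<omega>) \<partial>M) \<le> ennreal (C ^ N)"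
    if t: "- 1 < t" and C: "exp (real k * \<epsilon> * \<bar>t\<bar>) * det_moment d k \<eta> t \<le> C" "0 < C" for t C N
  proof (rule image_gram_moment[OF P d S U SS w G E C(2)])
    show "(\<integral>\<^sup>+x. ext_powr t (gram_det d k w x) \<partial>gauss_rows d k) \<le> ennreal C"
      using gram_det_moment_bound_perturbed[OF inj pos k t w near] C by (meson ennreal_leI order_trans)
  qed
  have grow: "AE \<omega> in M. eventually (\<lambda>N. ext_powr t (?D N \<omega>) < ennreal (exp (real k * \<epsilon> * \<bar>t\<bar> + c) ^ N)) sequentially"
    if t: "- 1 < t" and c: "det_moment d k \<eta> t < exp c" for t c
    by (rule AE_eventually_less_power[OF Zm, where C = "exp (real k * \<epsilon> * \<bar>t\<bar>) * det_moment d k \<eta> t"])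
       (use c moments[OF t] in \<open>auto simp: exp_add\<close>)
  have Lc: "left_product d (\<lambda>n. S * G n \<omega>) N \<in> carrier_mat d d" if "\<omega> \<in> space M" for \<omega> N
    using G S that by (intro left_product_carrier mult_carrier_mat[OF S(1)])
      (auto simp: iid_complex_gaussian_matrices_def)
  have D0: "0 \<le> ?D N \<omega>" if "\<omega> \<in> space M" for N \<omega>
    unfolding image_gram_def by (rule det_gram_nonneg[OF mult_carrier_mat[OF Lc[OF that] E(1)]])
  have pw: "ennreal (exp (real k * \<epsilon> * s + s * c) ^ N) = ext_powr s (exp (real N * (c + real k * \<epsilon>)))" for c N
    by (simp add: ext_powr_def powr_def exp_of_nat_mult[symmetric] algebra_simps)
  have pw': "ennreal (exp (real k * \<epsilon> * s - s * c) ^ N) = ext_powr (- s) (exp (real N * (c - real k * \<epsilon>)))" for c N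
    by (simp add: ext_powr_def powr_def exp_of_nat_mult[symmetric] algebra_simps)
  have "AE \<omega> in M. eventually (\<lambda>N. ext_powr s (?D N \<omega>) < ext_powr s (exp (real N * (m + \<delta> + real k * \<epsilon>)))) sequentially"
    using grow[OF _ up] s by (simp add: pw)
  moreover have "AE \<omega> in M. eventually (\<lambda>N. ext_powr (- s) (?D N \<omega>) < ext_powr (- s) (exp (real N * (m - \<delta> - real k * \<epsilon>)))) sequentially"
    using grow[OF _ lo] s by (simp add: pw')
  moreover note AE_space[of M]
  ultimately show ?thesis
  proof eventually_elim
    case (elim \<omega>)
    from elim(1,2) show ?case
    proof eventually_elim
      case (elim N)
      note \<omega> = D0[OF \<open>\<omega> \<in> space M\<close>, of N]
      have "?D N \<omega> \<le> exp (real N * (m + \<delta> + real k * \<epsilon>))"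
        using elim(1) ext_powr_mono[of s "exp (real N * (m + \<delta> + real k * \<epsilon>))" "?D N \<omega>"] s
        by (intro leI notI) (auto simp: not_less[symmetric])
      moreover have "exp (real N * (m - \<delta> - real k * \<epsilon>)) \<le> ?D N \<omega>"
        using elim(2) ext_powr_antimono[of "- s" "?D N \<omega>" "exp (real N * (m - \<delta> - real k * \<epsilon>))"] s \<omega>
        by (intro leI notI) (auto simp: not_less[symmetric])
      ultimately show ?case by (simp add: algebra_simps)
    qed
  qed
qed

text \<open>The columns are the unit vectors with index \<open>e 0, \<dots>, e (k - 1)\<close>, so that principal minors become
  Gram determinants of images of isometries.\<close>

definition coordinate_embedding :: "nat \<Rightarrow> nat \<Rightarrow> (nat \<Rightarrow> nat) \<Rightarrow> complex mat" where
  "coordinate_embedding d k e = Matrix.mat d k (\<lambda>(i, a). if i = e a then 1 else 0)"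

lemma coordinate_embedding_carrier [simp]: "coordinate_embedding d k e \<in> carrier_mat d k"
  by (simp add: coordinate_embedding_def)

lemma gram_coordinate_embedding:
  assumes A: "A \<in> carrier_mat d d" and e: "\<And>a. a < k \<Longrightarrow> e a < d"
  shows "mat_adjoint (A * coordinate_embedding d k e) * (A * coordinate_embedding d k e)
    = Matrix.mat k k (\<lambda>(a, b). (mat_adjoint A * A) $$ (e a, e b))"
proof -
  have "A * coordinate_embedding d k e = Matrix.mat d k (\<lambda>(i, a). A $$ (i, e a))"
  proof (rule eq_matI)
    fix i a assume "i < dim_row (Matrix.mat d k (\<lambda>(i, a). A $$ (i, e a)))" "a < dim_col (Matrix.mat d k (\<lambda>(i, a). A $$ (i, e a)))"
    then have ia: "i < d" "a < k" by auto
    have "(A * coordinate_embedding d k e) $$ (i, a) = (\<Sum>l<d. A $$ (i, l) * (if l = e a then 1 else 0))"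
      using A ia by (simp add: scalar_prod_def atLeast0LessThan coordinate_embedding_def)
    also have "\<dots> = A $$ (i, e a)" using e[OF ia(2)] by (simp add: if_distrib cong: if_cong)
    finally show "(A * coordinate_embedding d k e) $$ (i, a) = Matrix.mat d k (\<lambda>(i, a). A $$ (i, e a)) $$ (i, a)"
      using ia by simp
  qed (use A in \<open>auto simp: coordinate_embedding_def\<close>)
  then show ?thesis
    using A e by (intro eq_matI) (auto simp: scalar_prod_def mat_adjoint_altdef intro!: sum.cong)
qed

lemma coordinate_embedding_isometry:
  assumes "inj_on e {..<k}" "\<And>a. a < k \<Longrightarrow> e a < d"
  shows "mat_adjoint (coordinate_embedding d k e) * coordinate_embedding d k e = 1\<^sub>m k"
proof -
  have "mat_adjoint (coordinate_embedding d k e) * coordinate_embedding d k e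
      = Matrix.mat k k (\<lambda>(a, b). (1\<^sub>m d :: complex mat) $$ (e a, e b))"
    using gram_coordinate_embedding[of "1\<^sub>m d" d k e] assms(2)
      left_mult_one_mat[OF coordinate_embedding_carrier] by simp
  also have "\<dots> = 1\<^sub>m k"
    using assms by (intro eq_matI) (auto simp: inj_on_def)
  finally show ?thesis .
qed

text \<open>Applied to all coordinate embeddings and a sequence of error bounds at once, \<open>image_gram_growth\<close>
  holds simultaneously with the convergence that defines the exponents on a set of full measure. One
  point of it suffices, because the exponents are not random.\<close>

lemma exponent_sum_near_log_det_mean:
  assumes P: "prob_space M" and d: "1 \<le> d" and k: "k \<le> d"
    and S: "S \<in> carrier_mat d d" "mat_adjoint S = S"
    and U: "unitary_mat d U" and SS: "S * S = eigen_mat d U (\<lambda>i. complex_of_real (w i))"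
    and w: "\<And>i. i < d \<Longrightarrow> 0 < w i"
    and G: "iid_complex_gaussian_matrices M d G"
    and \<mu>: "lyapunov_exponents M d (\<lambda>n \<omega>. S * G n \<omega>) \<mu>"
    and inj: "inj_on \<eta> {..<d}" and pos: "\<And>i. i < d \<Longrightarrow> 0 < \<eta> i"
    and near: "\<And>i. i < d \<Longrightarrow> w i \<le> exp \<epsilon> * (1 / \<eta> i)" "\<And>i. i < d \<Longrightarrow> exp (- \<epsilon>) * (1 / \<eta> i) \<le> w i"
  shows "\<bar>2 * (\<Sum>i = 1..k. \<mu> i) - log_det_mean d k \<eta>\<bar> \<le> real k * \<epsilon>"
proof -
  interpret prob_space M by (rule P)
  define m where "m = log_det_mean d k \<eta>"
  define L where "L \<omega> N = left_product d (\<lambda>n. S * G n \<omega>) N" for \<omega> N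
  have Lc: "L \<omega> N \<in> carrier_mat d d" if "\<omega> \<in> space M" for \<omega> N
    unfolding L_def using G S that by (intro left_product_carrier mult_carrier_mat[OF S(1)])
      (auto simp: iid_complex_gaussian_matrices_def)
  define \<J> where "\<J> = {J. J \<subseteq> {..<d} \<and> card J = k}"
  have fin: "finite \<J>" unfolding \<J>_def by (rule finite_subset[of _ "Pow {..<d}"]) auto
  have "\<exists>e. bij_betw e {..<k} J" if "J \<in> \<J>" for J
    using that ex_bij_betw_nat_finite[of J] finite_subset[of J "{..<d}"] by (auto simp: \<J>_def atLeast0LessThan)
  then obtain e where e: "\<And>J. J \<in> \<J> \<Longrightarrow> bij_betw (e J) {..<k} J" by metis
  have ed: "e J a < d" if "J \<in> \<J>" "a < k" for J a
    using e[OF that(1)] that by (auto simp: \<J>_def bij_betw_def)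
  have minor: "Re (principal_minor (mat_adjoint (L \<omega> N) * L \<omega> N) J) = image_gram d S (\<lambda>n. G n \<omega>) N (coordinate_embedding d k (e J))"
    if "J \<in> \<J>" "\<omega> \<in> space M" for J \<omega> N
    using principal_minor_eq_det[OF e[OF that(1)]] gram_coordinate_embedding[OF Lc[OF that(2)] ed[OF that(1)]]
    by (simp add: image_gram_def L_def)
  have iso: "mat_adjoint (coordinate_embedding d k (e J)) * coordinate_embedding d k (e J) = 1\<^sub>m k" if "J \<in> \<J>" for J
    by (rule coordinate_embedding_isometry) (use e[OF that] ed[OF that] in \<open>auto simp: bij_betw_def\<close>)
  have "AE \<omega> in M. \<forall>p. \<forall>J\<in>\<J>. eventually (\<lambda>N.
      exp (real N * (m - real k * \<epsilon> - 1 / real (Suc p))) \<le> image_gram d S (\<lambda>n. G n \<omega>) N (coordinate_embedding d k (e J)) \<and>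
      image_gram d S (\<lambda>n. G n \<omega>) N (coordinate_embedding d k (e J)) \<le> exp (real N * (m + real k * \<epsilon> + 1 / real (Suc p)))) sequentially"
    unfolding AE_all_countable m_def
    by (intro allI AE_finite_allI[OF fin]
        image_gram_growth[OF P d k S U SS w G coordinate_embedding_carrier iso inj pos near]) auto
  moreover have "AE \<omega> in M. \<exists>V \<in> carrier_mat d d.
      mat_tendsto d (\<lambda>N. psd_root d (2 * N) (mat_adjoint (L \<omega> N) * L \<omega> N)) V \<and>
      char_poly V = (\<Prod>k = 1..d. [:- complex_of_real (exp (\<mu> k)), 1:])"
    using \<mu> by (simp add: lyapunov_exponents_def L_def Let_def)
  moreover note AE_space[of M]
  ultimately have "AE \<omega> in M. 2 * (\<Sum>i = 1..k. \<mu> i) \<in> {m - real k * \<epsilon>..m + real k * \<epsilon>}"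
  proof eventually_elim
    case (elim \<omega>)
    note \<omega> = \<open>\<omega> \<in> space M\<close>
    from elim(2) obtain V where V: "V \<in> carrier_mat d d"
      "mat_tendsto d (\<lambda>N. psd_root d (2 * N) (mat_adjoint (L \<omega> N) * L \<omega> N)) V"
      "char_poly V = (\<Prod>k = 1..d. [:- complex_of_real (exp (\<mu> k)), 1:])" by blast
    have grow: "eventually (\<lambda>N. \<forall>J\<in>\<J>.
        exp (real N * (m - real k * \<epsilon> - \<delta>)) \<le> Re (principal_minor (mat_adjoint (L \<omega> N) * L \<omega> N) J) \<and>
        Re (principal_minor (mat_adjoint (L \<omega> N) * L \<omega> N) J) \<le> exp (real N * (m + real k * \<epsilon> + \<delta>))) sequentially"
      if \<delta>: "0 < \<delta>" for \<delta>
    proof -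
      obtain p where p: "1 / real (Suc p) < \<delta>" using nat_approx_posE[OF \<delta>] .
      have "eventually (\<lambda>N. \<forall>J\<in>\<J>.
        exp (real N * (m - real k * \<epsilon> - 1 / real (Suc p))) \<le> image_gram d S (\<lambda>n. G n \<omega>) N (coordinate_embedding d k (e J)) \<and>
        image_gram d S (\<lambda>n. G n \<omega>) N (coordinate_embedding d k (e J)) \<le> exp (real N * (m + real k * \<epsilon> + 1 / real (Suc p)))) sequentially"
        using elim(1) by (simp add: eventually_ball_finite_distrib[OF fin])
      then show ?thesis
      proof eventually_elim
        case (elim N)
        have "exp (real N * (m - real k * \<epsilon> - \<delta>)) \<le> exp (real N * (m - real k * \<epsilon> - 1 / real (Suc p)))"
          "exp (real N * (m + real k * \<epsilon> + 1 / real (Suc p))) \<le> exp (real N * (m + real k * \<epsilon> + \<delta>))"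
          using p by (auto intro!: mult_left_mono simp del: of_nat_Suc)
        then show ?case
          using elim minor[OF _ \<omega>] by (auto simp del: of_nat_Suc intro: order_trans)
      qed
    qed
    show ?case
    proof (rule minor_growth_determines_exponent_sum[OF _ V _ k])
      show "positive_semidefinite_mat d (mat_adjoint (L \<omega> N) * L \<omega> N)" for N
        by (rule positive_semidefinite_mat_gram[OF Lc[OF \<omega>]])
      show "\<mu> j \<le> \<mu> i" if "1 \<le> i" "i \<le> j" "j \<le> d" for i j
        using \<mu> that by (simp add: lyapunov_exponents_def)
      show "0 \<le> Re (principal_minor (mat_adjoint (L \<omega> N) * L \<omega> N) J)" if "J \<subseteq> {..<d}" "card J = k" for J N
        using that minor[OF _ \<omega>] det_gram_nonneg(1)[OF mult_carrier_mat[OF Lc[OF \<omega>] coordinate_embedding_carrier]]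
        by (simp add: \<J>_def image_gram_def L_def)
      show "eventually (\<lambda>N. \<forall>J. J \<subseteq> {..<d} \<and> card J = k \<longrightarrow>
          Re (principal_minor (mat_adjoint (L \<omega> N) * L \<omega> N) J) \<le> exp (real N * (m + real k * \<epsilon> + \<delta>))) sequentially"
        if "0 < \<delta>" for \<delta>
        using grow[OF that] by eventually_elim (auto simp: \<J>_def)
      show "eventually (\<lambda>N. \<forall>J. J \<subseteq> {..<d} \<and> card J = k \<longrightarrow>
          exp (real N * (m - real k * \<epsilon> - \<delta>)) \<le> Re (principal_minor (mat_adjoint (L \<omega> N) * L \<omega> N) J)) sequentially"
        if "0 < \<delta>" for \<delta>
        using grow[OF that] by eventually_elim (auto simp: \<J>_def)
    qed
  qed
  then have "2 * (\<Sum>i = 1..k. \<mu> i) \<in> {m - real k * \<epsilon>..m + real k * \<epsilon>}" by simp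
  then show ?thesis unfolding m_def by auto
qed

section \<open>The exponents\<close>

text \<open>Expanded over permutations, \<open>det (exponent_mat d k y)\<close> attaches to each \<open>\<sigma>\<close> the logarithm of the one
  \<open>y j\<close> whose index \<open>\<sigma>\<close> sends to the row with the logarithms. The same term distinguishes the sums over
  \<open>\<sigma> i < k\<close> and \<open>\<sigma> i < k - 1\<close>.\<close>

lemma exponent_formula_eq_log_det_mean:
  assumes k: "k \<in> {1..d}"
  shows "2 * exponent_formula d k y
    = log_det_mean d k (\<lambda>i. y (Suc i)) - log_det_mean d (k - 1) (\<lambda>i. y (Suc i))"
proof -
  define \<eta> where "\<eta> i = y (Suc i)" for i
  obtain p where p: "k = Suc p" "p < d" using k by (cases k) auto
  have pick: "(\<Prod>j<d. if \<sigma> j = p then ln (\<eta> j) else 1) = ln (\<eta> j0)"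
    "(\<Sum>i<d. if \<sigma> i < Suc p then - ln (\<eta> i) else 0) = (\<Sum>i<d. if \<sigma> i < p then - ln (\<eta> i) else 0) - ln (\<eta> j0)"
    if \<sigma>: "\<sigma> permutes {..<d}" and j0: "j0 = inv_into UNIV \<sigma> p" for \<sigma> j0
  proof -
    have iff: "\<sigma> j = p \<longleftrightarrow> j = j0" for j using permutes_inverses[OF \<sigma>] by (auto simp: j0)
    have \<sigma>j0: "\<sigma> j0 = p" by (simp add: iff)
    have j0d: "j0 < d" using permutes_in_image[OF permutes_inv[OF \<sigma>], of p] p(2) by (simp add: j0)
    show "(\<Prod>j<d. if \<sigma> j = p then ln (\<eta> j) else 1) = ln (\<eta> j0)"
      unfolding iff using j0d by simp
    have "(\<Sum>i<d. if \<sigma> i < Suc p then - ln (\<eta> i) else 0)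
        = (\<Sum>i<d. (if \<sigma> i < p then - ln (\<eta> i) else 0) - (if i = j0 then ln (\<eta> i) else 0))"
      by (intro sum.cong refl) (use iff in \<open>auto simp: less_Suc_eq \<sigma>j0\<close>)
    also have "\<dots> = (\<Sum>i<d. if \<sigma> i < p then - ln (\<eta> i) else 0) - ln (\<eta> j0)"
      using j0d by (simp add: sum_subtractf)
    finally show "(\<Sum>i<d. if \<sigma> i < Suc p then - ln (\<eta> i) else 0) = (\<Sum>i<d. if \<sigma> i < p then - ln (\<eta> i) else 0) - ln (\<eta> j0)" .
  qed
  have vand: "(\<Prod>j = 1..d. \<Prod>i = 1..<j. y j - y i) = vandermonde_det d \<eta>"
    unfolding vandermonde_det_eq \<eta>_def
    unfolding prod.atLeast1_atMost_eq One_nat_def prod.atLeast_Suc_lessThan_Suc_shift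
    by (simp add: atLeast0LessThan)
  have "Determinant.det (exponent_mat d k y)
      = (\<Sum>\<sigma> | \<sigma> permutes {..<d}. of_int (sign \<sigma>) * (\<Prod>j<d. exponent_mat d k y $$ (\<sigma> j, j)))"
    by (rule det_by_columns) (simp add: exponent_mat_def)
  also have "\<dots> = (\<Sum>\<sigma> | \<sigma> permutes {..<d}. of_int (sign \<sigma>) * (\<Prod>j<d. \<eta> j ^ \<sigma> j) * ln (\<eta> (inv_into UNIV \<sigma> p)))"
  proof (rule sum.cong[OF refl])
    fix \<sigma> assume "\<sigma> \<in> {\<sigma>. \<sigma> permutes {..<d}}"
    then have \<sigma>: "\<sigma> permutes {..<d}" by simp
    have "(\<Prod>j<d. exponent_mat d k y $$ (\<sigma> j, j)) = (\<Prod>j<d. \<eta> j ^ \<sigma> j * (if \<sigma> j = p then ln (\<eta> j) else 1))"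
      using permutes_in_image[OF \<sigma>] by (intro prod.cong refl) (auto simp: exponent_mat_def \<eta>_def p)
    then show "of_int (sign \<sigma>) * (\<Prod>j<d. exponent_mat d k y $$ (\<sigma> j, j))
        = of_int (sign \<sigma>) * (\<Prod>j<d. \<eta> j ^ \<sigma> j) * ln (\<eta> (inv_into UNIV \<sigma> p))"
      by (simp add: prod.distrib pick(1)[OF \<sigma> refl])
  qed
  finally have det: "Determinant.det (exponent_mat d k y) / vandermonde_det d \<eta>
      = (\<Sum>\<sigma> | \<sigma> permutes {..<d}. vandermonde_weight d \<eta> \<sigma> * ln (\<eta> (inv_into UNIV \<sigma> p)))"
    by (simp add: sum_divide_distrib vandermonde_weight_def)
  have "(\<Sum>\<sigma> | \<sigma> permutes {..<d}. vandermonde_weight d \<eta> \<sigma> * (\<Sum>i<d. if \<sigma> i < Suc p then - ln (\<eta> i) else 0))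
      = (\<Sum>\<sigma> | \<sigma> permutes {..<d}. vandermonde_weight d \<eta> \<sigma> * (\<Sum>i<d. if \<sigma> i < p then - ln (\<eta> i) else 0)
          - vandermonde_weight d \<eta> \<sigma> * ln (\<eta> (inv_into UNIV \<sigma> p)))"
    by (intro sum.cong refl) (simp add: pick(2)[OF _ refl] right_diff_distrib)
  then have "log_det_mean d k \<eta> - log_det_mean d (k - 1) \<eta>
      = Digamma (real k) - Determinant.det (exponent_mat d k y) / vandermonde_det d \<eta>"
    unfolding det by (simp add: log_det_mean_def p sum_subtractf del: of_nat_Suc)
  moreover have "2 * exponent_formula d k y
      = Digamma (real k) - Determinant.det (exponent_mat d k y) / vandermonde_det d \<eta>"
    unfolding exponent_formula_def vand by (simp add: distrib_left)
  ultimately show ?thesis by (simp add: \<eta>_def[abs_def])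
qed

text \<open>In an eigenbasis \<open>U\<close> of the inverse, the \<open>i\<close>-th diagonal entry of \<open>U\<^sup>* \<Sigma> U\<close> times \<open>y (i + 1)\<close> is \<open>1\<close>, and that
  entry is a value of the form of \<open>\<Sigma>\<close>; hence \<open>y (i + 1)\<close> is positive.\<close>

lemma positive_definite_spectral:
  assumes \<Sigma>: "positive_definite_mat d \<Sigma>" and inv: "\<Sigma>_inv \<in> carrier_mat d d" "\<Sigma> * \<Sigma>_inv = 1\<^sub>m d"
    and cp: "char_poly \<Sigma>_inv = (\<Prod>j = 1..d. [:- complex_of_real (y j), 1:])"
  obtains U where "unitary_mat d U" "\<Sigma> = eigen_mat d U (\<lambda>i. complex_of_real (1 / y (Suc i)))"
    "\<And>i. i < d \<Longrightarrow> 0 < y (Suc i)"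
proof -
  have S: "\<Sigma> \<in> carrier_mat d d" "mat_adjoint \<Sigma> = \<Sigma>"
    using \<Sigma> by (auto simp: positive_definite_mat_def hermitian_mat_def)
  have "mat_adjoint \<Sigma>_inv * \<Sigma> = mat_adjoint (\<Sigma> * \<Sigma>_inv)"
    by (simp add: mat_adjoint_mult[OF S(1) inv(1)] S(2))
  then have left: "mat_adjoint \<Sigma>_inv * \<Sigma> = 1\<^sub>m d" by (simp add: inv(2))
  have "mat_adjoint \<Sigma>_inv = mat_adjoint \<Sigma>_inv * (\<Sigma> * \<Sigma>_inv)"
    using right_mult_one_mat[OF mat_adjoint_carrier[OF inv(1)]] by (simp add: inv(2))
  also have "\<dots> = (mat_adjoint \<Sigma>_inv * \<Sigma>) * \<Sigma>_inv"
    using assoc_mult_mat[OF mat_adjoint_carrier[OF inv(1)] S(1) inv(1)] by simp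
  also have "\<dots> = \<Sigma>_inv" by (simp add: left inv(1))
  finally have herm: "mat_adjoint \<Sigma>_inv = \<Sigma>_inv" .
  have "char_poly \<Sigma>_inv = (\<Prod>e\<leftarrow>map (\<lambda>j. complex_of_real (y (Suc j))) [0..<d]. [:- e, 1:])"
    unfolding cp by (simp add: prod.atLeast1_atMost_eq prod.distinct_set_conv_list[symmetric] comp_def atLeast0LessThan flip: of_real_minus)
  from hermitian_spectral[OF inv(1) herm this] obtain U where U: "unitary_mat d U"
    and "\<Sigma>_inv = U * mat_diag d (\<lambda>i. map (\<lambda>j. complex_of_real (y (Suc j))) [0..<d] ! i) * mat_adjoint U"
    by blast
  then have inv_eq: "\<Sigma>_inv = eigen_mat d U (\<lambda>i. complex_of_real (y (Suc i)))"
    unfolding eigen_mat_def by (simp cong: mat_diag_cong)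
  note U' = unitary_matD[OF U]
  let ?D = "mat_diag d (\<lambda>i. complex_of_real (y (Suc i)))"
  have Dc: "?D \<in> carrier_mat d d" by simp
  define H where "H = mat_adjoint U * (\<Sigma> * U)"
  have SU: "\<Sigma> * U \<in> carrier_mat d d" using S U' by simp
  have Hc: "H \<in> carrier_mat d d" unfolding H_def using SU U' by simp
  have invU: "\<Sigma>_inv * U = U * ?D"
    unfolding inv_eq eigen_mat_def
    using assoc_mult_mat[OF mult_carrier_mat[OF U'(1) Dc] mat_adjoint_carrier[OF U'(1)] U'(1)]
      right_mult_one_mat[OF mult_carrier_mat[OF U'(1) Dc]] by (simp add: U'(2))
  have "H * ?D = mat_adjoint U * (\<Sigma> * (U * ?D))"
    unfolding H_def
    using assoc_mult_mat[OF mat_adjoint_carrier[OF U'(1)] SU Dc] assoc_mult_mat[OF S(1) U'(1) Dc] by simp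
  also have "\<dots> = mat_adjoint U * (\<Sigma> * \<Sigma>_inv * U)"
    using assoc_mult_mat[OF S(1) inv(1) U'(1)] by (simp add: invU)
  also have "\<dots> = 1\<^sub>m d" by (simp add: inv(2) left_mult_one_mat[OF U'(1)] U'(2))
  finally have HD: "H * ?D = 1\<^sub>m d" .
  have y: "0 < y (Suc i)" if i: "i < d" for i
  proof -
    have "(H * ?D) $$ (i, i) = H $$ (i, i) * complex_of_real (y (Suc i))"
      using Hc i by (simp add: mat_diag_mult_right[OF Hc])
    then have one: "H $$ (i, i) * complex_of_real (y (Suc i)) = 1" using i by (simp add: HD)
    have entry: "(A * B) $$ (i, i) = (\<Sum>l<d. A $$ (i, l) * B $$ (l, i))"
      if "A \<in> carrier_mat d d" "B \<in> carrier_mat d d" for A B :: "complex mat"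
      using that i by (simp add: scalar_prod_def atLeast0LessThan)
    have H_form: "H $$ (i, i) = (\<Sigma> *\<^sub>v col U i) \<bullet>c col U i"
    proof -
      have "H $$ (i, i) = (\<Sum>l<d. cnj (U $$ (l, i)) * (\<Sigma> * U) $$ (l, i))"
        unfolding H_def entry[OF mat_adjoint_carrier[OF U'(1)] SU] using U' i by simp
      also have "\<dots> = (\<Sigma> *\<^sub>v col U i) \<bullet>c col U i"
        using S U' i by (simp add: scalar_prod_def[of _ "conjugate (col U i)"] atLeast0LessThan mult.commute)
      finally show ?thesis .
    qed
    have "col U i \<noteq> 0\<^sub>v d"
    proof
      assume "col U i = 0\<^sub>v d"
      then have "H $$ (i, i) = 0" unfolding H_form using S by simp
      then show False using one by simp
    qed
    then have pos: "0 < Re (H $$ (i, i))"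
      using \<Sigma> U' i unfolding H_form by (auto simp: positive_definite_mat_def)
    have "Re (H $$ (i, i)) * y (Suc i) = 1" using arg_cong[OF one, of Re] by simp
    then show ?thesis using zero_less_mult_pos[OF _ pos, of "y (Suc i)"] by simp
  qed
  let ?E = "eigen_mat d U (\<lambda>i. complex_of_real (1 / y (Suc i)))"
  have Ec: "?E \<in> carrier_mat d d" using U by simp
  have "?E * \<Sigma>_inv = eigen_mat d U (\<lambda>i. 1)"
    unfolding inv_eq eigen_mat_mult[OF U]
    by (rule eigen_mat_cong) (use y in \<open>auto simp: less_imp_neq[symmetric] simp flip: of_real_mult\<close>)
  also have "\<dots> = 1\<^sub>m d" unfolding eigen_mat_const[OF U] by (rule eq_matI) auto
  finally have E: "?E * \<Sigma>_inv = 1\<^sub>m d" .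
  have "\<Sigma> = ?E"
  proof -
    have comm: "\<Sigma>_inv * \<Sigma> = 1\<^sub>m d" using left by (simp add: herm)
    have "?E = ?E * (\<Sigma>_inv * \<Sigma>)" using right_mult_one_mat[OF Ec] by (simp only: comm)
    also have "\<dots> = \<Sigma>" using assoc_mult_mat[OF Ec inv(1) S(1)] left_mult_one_mat[OF S(1)] by (simp only: E)
    finally show ?thesis ..
  qed
  from that[OF U this y] show thesis .
qed

theorem proposition2:
  fixes M :: "'a measure" and d k :: nat
    and \<Sigma> \<Sigma>_half \<Sigma>_inv :: "complex mat"
    and G :: "nat \<Rightarrow> 'a \<Rightarrow> complex mat"
    and y \<mu> :: "nat \<Rightarrow> real"
  assumes "prob_space M"
    and "1 \<le> d"
    and "positive_definite_mat d \<Sigma>"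
    and "positive_definite_mat d \<Sigma>_half" and "\<Sigma>_half * \<Sigma>_half = \<Sigma>"
    and "\<Sigma>_inv \<in> carrier_mat d d" and "inverts_mat \<Sigma> \<Sigma>_inv" and "inverts_mat \<Sigma>_inv \<Sigma>"
    and "char_poly \<Sigma>_inv = (\<Prod>j = 1..d. [:- complex_of_real (y j), 1:])"
    and "iid_complex_gaussian_matrices M d G"
    and "lyapunov_exponents M d (\<lambda>n \<omega>. \<Sigma>_half * G n \<omega>) \<mu>"
    and "k \<in> {1..d}"
  shows "(inj_on y {1..d} \<longrightarrow> \<mu> k = exponent_formula d k y) \<and>
         (\<not> inj_on y {1..d} \<longrightarrow>
            (exponent_formula d k \<longlongrightarrow> \<mu> k) (at y within distinct_positive d))"
proof -
  have \<Sigma>c: "\<Sigma> \<in> carrier_mat d d"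
    using assms(3) by (simp add: positive_definite_mat_def hermitian_mat_def)
  have half: "\<Sigma>_half \<in> carrier_mat d d" "mat_adjoint \<Sigma>_half = \<Sigma>_half"
    using assms(4) by (auto simp: positive_definite_mat_def hermitian_mat_def)
  have "\<Sigma> * \<Sigma>_inv = 1\<^sub>m d" using assms(7) \<Sigma>c by (simp add: inverts_mat_def)
  then obtain U where U: "unitary_mat d U"
    and \<Sigma>U: "\<Sigma> = eigen_mat d U (\<lambda>i. complex_of_real (1 / y (Suc i)))"
    and y: "\<And>i. i < d \<Longrightarrow> 0 < y (Suc i)"
    using positive_definite_spectral[OF assms(3,6) _ assms(9)] by metis
  have SS: "\<Sigma>_half * \<Sigma>_half = eigen_mat d U (\<lambda>i. complex_of_real (1 / y (Suc i)))"
    using assms(5) \<Sigma>U by simp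
  have y_pos: "0 < y j" if "j \<in> {1..d}" for j using y[of "j - 1"] that by (cases j) auto
  \<comment> \<open>the exponents are compared with the formula at nearby distinct points; \<open>\<epsilon> = 0\<close> is the distinct case\<close>
  have near_formula: "\<bar>\<mu> k - exponent_formula d k z\<bar> \<le> real d * \<epsilon>"
    if z: "z \<in> distinct_positive d"
      and near: "\<And>j. j \<in> {1..d} \<Longrightarrow> exp (- \<epsilon>) * y j \<le> z j" "\<And>j. j \<in> {1..d} \<Longrightarrow> z j \<le> exp \<epsilon> * y j"
      and \<epsilon>: "0 \<le> \<epsilon>" for z \<epsilon>
  proof -
    let ?\<eta> = "\<lambda>i. z (Suc i)"
    have pos: "0 < ?\<eta> i" if "i < d" for i using z that by (simp add: distinct_positive_def)
    have inj: "inj_on ?\<eta> {..<d}"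
    proof (rule inj_onI)
      fix i j assume ij: "i \<in> {..<d}" "j \<in> {..<d}" and eq: "z (Suc i) = z (Suc j)"
      have "inj_on z {1..d}" using z by (simp add: distinct_positive_def)
      from inj_onD[OF this eq] ij show "i = j" by simp
    qed
    have w: "0 < 1 / y (Suc i)" if "i < d" for i using y[OF that] by simp
    have near': "1 / y (Suc i) \<le> exp \<epsilon> * (1 / ?\<eta> i)" "exp (- \<epsilon>) * (1 / ?\<eta> i) \<le> 1 / y (Suc i)" if "i < d" for i
      using near[of "Suc i"] y[OF that] pos[OF that] that by (auto simp: exp_minus field_simps)
    have sums: "\<bar>2 * (\<Sum>i = 1..l. \<mu> i) - log_det_mean d l ?\<eta>\<bar> \<le> real l * \<epsilon>" if "l \<le> d" for l
      by (rule exponent_sum_near_log_det_mean[OF assms(1,2) that half U SS w assms(10,11) inj pos near'])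
    obtain p where p: "k = Suc p" "p < d" using assms(12) by (cases k) auto
    have "\<bar>2 * \<mu> k - 2 * exponent_formula d k z\<bar> \<le> real (Suc p) * \<epsilon> + real p * \<epsilon>"
      using sums[of "Suc p"] sums[of p] exponent_formula_eq_log_det_mean[OF assms(12), of z] p
      by (simp add: algebra_simps abs_le_iff)
    also have "\<dots> \<le> real d * \<epsilon> + real d * \<epsilon>"
      using p \<epsilon> by (intro add_mono mult_right_mono) auto
    finally show ?thesis by (simp add: abs_le_iff mult.commute)
  qed
  show ?thesis
  proof (intro conjI impI)
    assume "inj_on y {1..d}"
    then have "y \<in> distinct_positive d" using y_pos by (simp add: distinct_positive_def)
    from near_formula[OF this, of 0] show "\<mu> k = exponent_formula d k y" by simp
  next
    show "(exponent_formula d k \<longlongrightarrow> \<mu> k) (at y within distinct_positive d)"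
    proof (rule tendstoI)
      fix r :: real assume r: "0 < r"
      define \<epsilon> where "\<epsilon> = r / (2 * real d)"
      have \<epsilon>: "0 < \<epsilon>" "real d * \<epsilon> < r" using r assms(2) by (auto simp: \<epsilon>_def)
      let ?F = "at y within distinct_positive d"
      have comp: "((\<lambda>z. z j) \<longlongrightarrow> y j) ?F" for j
      proof -
        have "continuous_on UNIV (\<lambda>z :: nat \<Rightarrow> real. z j)" by (rule continuous_on_product_coordinates)
        then have "((\<lambda>z. z j) \<longlongrightarrow> y j) (at y)" by (simp add: continuous_on_def)
        then show ?thesis by (rule tendsto_within_subset) simp
      qed
      have "eventually (\<lambda>z. exp (- \<epsilon>) * y j < z j \<and> z j < exp \<epsilon> * y j) ?F" if "j \<in> {1..d}" for j
        by (intro eventually_conj order_tendstoD[OF comp]) (use y_pos[OF that] \<epsilon> in auto)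
      then have "eventually (\<lambda>z. \<forall>j\<in>{1..d}. exp (- \<epsilon>) * y j < z j \<and> z j < exp \<epsilon> * y j) ?F"
        by (intro eventually_ball_finite) auto
      moreover have "eventually (\<lambda>z. z \<in> distinct_positive d) ?F"
        by (simp add: eventually_at_filter)
      ultimately show "eventually (\<lambda>z. dist (exponent_formula d k z) (\<mu> k) < r) ?F"
      proof eventually_elim
        case (elim z)
        have "\<bar>\<mu> k - exponent_formula d k z\<bar> \<le> real d * \<epsilon>"
          by (rule near_formula) (use elim \<epsilon> in \<open>auto simp: less_imp_le\<close>)
        then show ?case using \<epsilon>(2) by (simp add: dist_real_def abs_minus_commute)
      qed
    qed
  qed
qed

end
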